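(* Let $E\subset\mathbb{R}^N$ be open, $T>0$, $E_T=E\times(0,T)$. Let $u\in L^\infty_{\mathrm{loc}}(E_T)$ be a local solution of the parabolic $1$-Laplacian equation $$u_t-\mathrm{div}\Big(\frac{Du}{|Du|}\Big)=0\quad\text{in }E_T$$ (in the sense defined in the context). Let $(x_o,t_o)\in E_T$. Then $u$ is continuous at $(x_o,t_o)$ if and only if $$\limsup_{\rho\searrow0}\ \frac{\rho}{|Q_\rho|}\int_{t_o-\rho}^{t_o}\|Du(\cdot,t)\|(B_\rho(x_o))\,dt=0 .$$
   Context: Notation. $B_\rho(x_o)$ is the open ball of radius $\rho$ about $x_o$ in $\mathbb{R}^N$, $Q_\rho=B_\rho(0)\times(-\rho,0]$, $|Q_\rho|$ its Lebesgue measure in $\mathbb{R}^{N+1}$. $\|Dv\|(A)$ is the total variation of the distributional gradient of $v$ on the open set $A$. $L^1(0,T;BV(E))$ is the set of maps $v:[0,T]\to BV(E)$ with $v\in L^1(E_T)$, $t\mapsto\|Dv(t)\|(E)\in L^1(0,T)$, and $t\mapsto-\int_E v(t)\,\mathrm{div}\,\varphi\,dx$ measurable for all $\varphi\in[C^1_o(E)]^N$; $L^1_{\mathrm{loc}}(0,T;BV(E))$ is the version local in time. Let $\mathcal{P}$ be the class of all Lipschitz continuous, non-decreasing functions $p:\mathbb{R}\to\mathbb{R}$ with $p'$ compactly supported. Let $\mathcal{C}(E_T)$ be the class of all non-negative functions $\zeta$ defined in $E_T$ such that $\zeta(\cdot,t)\in C^1_o(E)$ for all $t\in(0,T)$ and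 $0\le\zeta_t<\infty$ in $E_T$. Local solution. A function $u\in C_{\mathrm{loc}}(0,T;L^1(E))$ is a local solution of the parabolic $1$-Laplacian equation in $E_T$ if: (a) $p(u)\in L^1_{\mathrm{loc}}(0,T;BV(E))$ for all $p\in\mathcal{P}$; (b) there exists a vector-valued function $\mathbf{z}\in[L^\infty(E_T)]^N$ with $\|\mathbf{z}\|_{\infty}\le1$ such that $u_t=\mathrm{div}\,\mathbf{z}$ in $\mathcal{D}'(E_T)$; (c) denoting by $d(\|Dp(u-\ell)\|)$ the total variation measure in $E$ of $Dp(u-\ell)$ (at fixed time), $$\int_E\Big(\int_0^{u-\ell}p(s)\,ds\Big)\zeta(x,t_2)\,dx+\int_{t_1}^{t_2}\int_E\zeta\,d(\|Dp(u-\ell)\|)\,dt$$ $$\le\int_E\Big(\int_0^{u-\ell}p(s)\,ds\Big)\zeta(x,t_1)\,dx+\int_{t_1}^{t_2}\int_E\Big(\int_0^{u-\ell}p(s)\,ds\Big)\zeta_t\,dx\,dt-\int_{t_1}^{t_2}\int_E\mathbf{z}\cdot D\zeta\;p(u-\ell)\,dx\,dt$$ for all $\ell\in\mathbb{R}$, all $p\in\mathcal{P}$, all $\zeta\in\mathcal{C}(E_T)$ and all $[t_1,t_2]\subset(0,T)$ (in the first and third integrals $u$ is evaluated at times $t_2$ and $t_1$ respectively). Continuity at a point of the a.e.-defined function $u$ means that the essential oscillation of $u$ over neighborhoods of $(x_o,t_o)$ tends to $0$ as the neighborhoods shrink to the point (equivalently, some representative of $u$ is continuous there). *)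

theory Defs
  imports "HOL-Analysis.Analysis" "HOL-Probability.Essential_Supremum"
begin

text \<open>
  Space-time points are pairs (x, t) with x in an arbitrary Euclidean space (in the role of
  the N-dimensional space) and t real; E_T is the set E \<times> {0<..<T}.
\<close>

fun Ck :: "nat \<Rightarrow> ('a::euclidean_space \<Rightarrow> 'b::real_normed_vector) \<Rightarrow> bool" where
  "Ck 0 f \<longleftrightarrow> continuous_on UNIV f"
| "Ck (Suc k) f \<longleftrightarrow>
     (\<forall>x. f differentiable (at x)) \<and> (\<forall>b\<in>Basis. Ck k (\<lambda>x. frechet_derivative f (at x) b))"

text \<open>Functions with compact support in an open set A are identified with their extensions by 0.\<close>

definition Ckc :: "nat \<Rightarrow> 'a::euclidean_space set \<Rightarrow> ('a \<Rightarrow> 'b::real_normed_vector) set" where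
  "Ckc k A = {f. Ck k f \<and> compact (closure {x. f x \<noteq> 0}) \<and> closure {x. f x \<noteq> 0} \<subseteq> A}"

definition Cinfc :: "'a::euclidean_space set \<Rightarrow> ('a \<Rightarrow> 'b::real_normed_vector) set" where
  "Cinfc A = (\<Inter>k. Ckc k A)"

definition diverg :: "('a::euclidean_space \<Rightarrow> 'a) \<Rightarrow> 'a \<Rightarrow> real" where
  "diverg \<phi> x = (\<Sum>b\<in>Basis. frechet_derivative \<phi> (at x) b \<bullet> b)"

definition grad :: "('a::euclidean_space \<Rightarrow> real) \<Rightarrow> 'a \<Rightarrow> 'a" where
  "grad f x = (\<Sum>b\<in>Basis. frechet_derivative f (at x) b *\<^sub>R b)"

definition space_grad :: "('a::euclidean_space \<times> real \<Rightarrow> real) \<Rightarrow> 'a \<times> real \<Rightarrow> 'a" where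
  "space_grad \<zeta> = (\<lambda>(x, t). grad (\<lambda>y. \<zeta> (y, t)) x)"

definition time_deriv :: "('a \<times> real \<Rightarrow> real) \<Rightarrow> 'a \<times> real \<Rightarrow> real" where
  "time_deriv \<zeta> = (\<lambda>(x, t). deriv (\<lambda>s. \<zeta> (x, s)) t)"

definition total_variation :: "('a::euclidean_space \<Rightarrow> real) \<Rightarrow> 'a set \<Rightarrow> ennreal" where
  "total_variation v A =
     (SUP \<phi>\<in>{\<phi> \<in> Ckc 1 A. \<forall>x. norm (\<phi> x) \<le> 1}. ennreal (LINT x:A|lebesgue. v x * diverg \<phi> x))"

definition BV :: "'a::euclidean_space set \<Rightarrow> ('a \<Rightarrow> real) set" where
  "BV E = {v. set_integrable lebesgue E v \<and> total_variation v E < \<infinity>}"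

text \<open>
  The total variation measure of Dv: the Borel measure on E whose value on open sets is the total
  variation and which is extended to Borel sets by outer regularity. For v in BV(E) this set
  function is countably additive on Borel sets; where it is not, measure_of yields the zero measure.
\<close>

definition tv_measure :: "'a::euclidean_space set \<Rightarrow> ('a \<Rightarrow> real) \<Rightarrow> 'a measure" where
  "tv_measure E v = measure_of E (sets (restrict_space borel E))
     (\<lambda>B. INF A\<in>{A. open A \<and> B \<subseteq> A \<and> A \<subseteq> E}. total_variation v A)"

definition L1_BV :: "real \<Rightarrow> real \<Rightarrow> 'a::euclidean_space set \<Rightarrow> ('a \<times> real \<Rightarrow> real) set" where
  "L1_BV a b E = {v.
     (\<forall>t\<in>{a..b}. (\<lambda>x. v (x, t)) \<in> BV E) \<and>
     set_integrable lebesgue (E \<times> {a<..<b}) v \<and>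
     set_integrable lebesgue {a<..<b} (\<lambda>t. enn2real (total_variation (\<lambda>x. v (x, t)) E)) \<and>
     (\<forall>\<phi>\<in>Ckc 1 E. set_borel_measurable lebesgue {a<..<b}
        (\<lambda>t. - (LINT x:E|lebesgue. v (x, t) * diverg \<phi> x)))}"

definition L1loc_BV :: "real \<Rightarrow> 'a::euclidean_space set \<Rightarrow> ('a \<times> real \<Rightarrow> real) set" where
  "L1loc_BV T E = {v. \<forall>a b. 0 < a \<and> a < b \<and> b < T \<longrightarrow> v \<in> L1_BV a b E}"

definition Linf_loc :: "'b::euclidean_space set \<Rightarrow> ('b \<Rightarrow> real) set" where
  "Linf_loc S = {u. set_borel_measurable lebesgue S u \<and>
     (\<forall>K. compact K \<and> K \<subseteq> S \<longrightarrow> (\<exists>M. AE w in lebesgue. w \<in> K \<longrightarrow> \<bar>u w\<bar> \<le> M))}"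

definition Cloc_L1 :: "real \<Rightarrow> 'a::euclidean_space set \<Rightarrow> ('a \<times> real \<Rightarrow> real) set" where
  "Cloc_L1 T E = {u. set_borel_measurable lebesgue (E \<times> {0<..<T}) u \<and>
     (\<forall>t\<in>{0<..<T}. set_integrable lebesgue E (\<lambda>x. u (x, t))) \<and>
     (\<forall>t\<in>{0<..<T}. ((\<lambda>s. LINT x:E|lebesgue. \<bar>u (x, s) - u (x, t)\<bar>) \<longlongrightarrow> 0) (at t))}"

definition classP :: "(real \<Rightarrow> real) set" where
  "classP = {p. (\<exists>L. L-lipschitz_on UNIV p) \<and> mono p \<and>
     (\<exists>K. compact K \<and> (AE s in lborel. s \<notin> K \<longrightarrow> (p has_real_derivative 0) (at s)))}"

definition primitive :: "(real \<Rightarrow> real) \<Rightarrow> real \<Rightarrow> real" where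
  "primitive p w = (LBINT s=0..ereal w. p s)"

definition classC :: "real \<Rightarrow> 'a::euclidean_space set \<Rightarrow> ('a \<times> real \<Rightarrow> real) set" where
  "classC T E = {\<zeta>.
     (\<forall>w\<in>E \<times> {0<..<T}. 0 \<le> \<zeta> w) \<and>
     (\<forall>t\<in>{0<..<T}. (\<lambda>x. \<zeta> (x, t)) \<in> Ckc 1 E) \<and>
     (\<forall>x\<in>E. \<forall>t\<in>{0<..<T}. \<exists>d\<ge>0. ((\<lambda>s. \<zeta> (x, s)) has_real_derivative d) (at t))}"

definition distributional_eq ::
  "real \<Rightarrow> 'a::euclidean_space set \<Rightarrow> ('a \<times> real \<Rightarrow> real) \<Rightarrow> ('a \<times> real \<Rightarrow> 'a) \<Rightarrow> bool" where
  "distributional_eq T E u z \<longleftrightarrow>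
     (\<forall>\<phi>\<in>Cinfc (E \<times> {0<..<T}).
        (LINT w:E \<times> {0<..<T}|lebesgue. u w * time_deriv \<phi> w) =
        (LINT w:E \<times> {0<..<T}|lebesgue. z w \<bullet> space_grad \<phi> w))"

text \<open>
  The conditions on the test functions in class C bound neither the time derivative nor, locally
  uniformly in time, the space gradient. The inequality is therefore required exactly for those
  data for which the two space-time integrals on its right-hand side exist; without this
  restriction the Bochner integral of a non-integrable function would be read as 0. The integrals
  over a single time always exist, and the one against the total variation measure is an integral
  of a non-negative function, with values in [0, \<infinity>].
\<close>

definition energy_ineq ::
  "real \<Rightarrow> 'a::euclidean_space set \<Rightarrow> ('a \<times> real \<Rightarrow> real) \<Rightarrow> ('a \<times> real \<Rightarrow> 'a) \<Rightarrow> bool" where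
  "energy_ineq T E u z \<longleftrightarrow>
     (\<forall>l. \<forall>p\<in>classP. \<forall>\<zeta>\<in>classC T E. \<forall>t1 t2. 0 < t1 \<and> t1 \<le> t2 \<and> t2 < T \<longrightarrow>
        set_integrable lebesgue (E \<times> {t1..t2}) (\<lambda>w. primitive p (u w - l) * time_deriv \<zeta> w) \<longrightarrow>
        set_integrable lebesgue (E \<times> {t1..t2}) (\<lambda>w. (z w \<bullet> space_grad \<zeta> w) * p (u w - l)) \<longrightarrow>
        ereal (LINT x:E|lebesgue. primitive p (u (x, t2) - l) * \<zeta> (x, t2))
        + enn2ereal (\<integral>\<^sup>+t\<in>{t1..t2}.
            (\<integral>\<^sup>+x. ennreal (\<zeta> (x, t)) \<partial>tv_measure E (\<lambda>x. p (u (x, t) - l))) \<partial>lebesgue)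
        \<le> ereal ((LINT x:E|lebesgue. primitive p (u (x, t1) - l) * \<zeta> (x, t1))
            + (LINT w:E \<times> {t1..t2}|lebesgue. primitive p (u w - l) * time_deriv \<zeta> w)
            - (LINT w:E \<times> {t1..t2}|lebesgue. (z w \<bullet> space_grad \<zeta> w) * p (u w - l))))"

definition local_solution ::
  "real \<Rightarrow> 'a::euclidean_space set \<Rightarrow> ('a \<times> real \<Rightarrow> real) \<Rightarrow> bool" where
  "local_solution T E u \<longleftrightarrow>
     u \<in> Cloc_L1 T E \<and>
     (\<forall>p\<in>classP. (\<lambda>w. p (u w)) \<in> L1loc_BV T E) \<and>
     (\<exists>z. set_borel_measurable lebesgue (E \<times> {0<..<T}) z \<and>
          (AE w in lebesgue. w \<in> E \<times> {0<..<T} \<longrightarrow> norm (z w) \<le> 1) \<and>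
          distributional_eq T E u z \<and>
          energy_ineq T E u z)"

text \<open>The essential infimum of f is minus the essential supremum of -f.\<close>

definition ess_osc :: "('b::euclidean_space \<Rightarrow> real) \<Rightarrow> 'b set \<Rightarrow> ereal" where
  "ess_osc f S =
     esssup (lebesgue_on S) (\<lambda>w. ereal (f w)) - (- esssup (lebesgue_on S) (\<lambda>w. ereal (- f w)))"

definition ess_continuous_at :: "('b::euclidean_space \<Rightarrow> real) \<Rightarrow> 'b \<Rightarrow> bool" where
  "ess_continuous_at f w \<longleftrightarrow> ((\<lambda>r. ess_osc f (ball w r)) \<longlongrightarrow> 0) (at_right 0)"

definition Qcyl :: "real \<Rightarrow> ('a::euclidean_space \<times> real) set" where
  "Qcyl \<rho> = ball 0 \<rho> \<times> {-\<rho><..0}"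

end

(*
  Testing the energy inequality with ramp functions p of u - k and a cutoff bounds both the mean
  square of p(u - k) at almost every time and the space-time total variation of p(u - k) by a multiple
  of the measure of {u > k} (Caccioppoli inequality). Applied with k the essential infimum of u and
  the ramp spanning its oscillation, it bounds the scaled variation of u by its oscillation, which is
  the necessity part.

  For the sufficiency part, the means of u over balls of radius r are Lipschitz in time with
  constant C/r, by the energy inequality with p = 1 and p = -1. Together with the Poincare
  inequality on each time slice, smallness of the scaled variation makes u close in measure to a
  constant c on a short cylinder below the given time. A cylinder reaching above it by a much shorter
  time adds only little measure. De Giorgi's iteration then bounds u from above by c + 3 delta near the
  point, and the same argument for -u bounds it from below. The iteration needs no Sobolev embedding: it
  suffices that translating a function by y changes its L1 norm by at most |y| times its total variation.
*)
theory Submission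
  imports Defs
begin

section \<open>Continuously differentiable functions and cutoffs\<close>

text \<open>The equation is invariant under scaling space and time by one factor. So cylinders have
  height comparable to their radius, and constants depend only on the dimension, the bound M and
  delta. One step of the iteration gains a factor proportional to the translation length, and no
  power of the measure. Lengths proportional to 2^-n keep this factor constant; making it at most
  2^-(N+2) lets the measures decay just fast enough for the mean squares to stay small on balls of
  that size. Two obstacles: \<open>tv_measure\<close> comes from \<open>measure_of\<close>, which
  would silently give the zero measure, so countable additivity must precede any use of the energy
  inequality. And u is only Lebesgue measurable, so estimates concern a bounded Borel function U
  that agrees with u on almost every time slice; the slice at t0 enters only through the means of
  u.\<close>

declare One_nat_def [simp del]

text \<open>With \<open>Ck_1D\<close> this is the whole interface to \<open>Ck 1\<close>. The
  literal 1 is kept from turning into \<open>Suc 0\<close>, and the recursion equations leave the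
  simp set right after these two lemmas.\<close>

lemma Ck_1I:
  assumes "\<And>x. (f has_derivative f' x) (at x)"
    and "\<And>b. b \<in> Basis \<Longrightarrow> continuous_on UNIV (\<lambda>x. f' x b)"
  shows "Ck 1 f"
proof -
  have "frechet_derivative f (at x) = f' x" for x
    using assms(1) frechet_derivative_at by metis
  then show ?thesis
    using assms unfolding One_nat_def by (auto simp: differentiable_def)
qed

lemma Ck_1D:
  assumes "Ck 1 f"
  shows "(f has_derivative frechet_derivative f (at x)) (at x)"
    and "b \<in> Basis \<Longrightarrow> continuous_on UNIV (\<lambda>x. frechet_derivative f (at x) b)"
  using assms unfolding One_nat_def by (auto simp: frechet_derivative_works)

declare Ck.simps [simp del]

lemma Ck_1_continuous: "Ck 1 f \<Longrightarrow> continuous_on S f"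
  by (intro continuous_at_imp_continuous_on ballI has_derivative_continuous[OF Ck_1D(1)])

lemma Ck_1_const: "Ck 1 (\<lambda>x. c)"
  by (rule Ck_1I[where f' = "\<lambda>x h. 0"]) auto

lemma Ck_1_add: "Ck 1 f \<Longrightarrow> Ck 1 g \<Longrightarrow> Ck 1 (\<lambda>x. f x + g x)"
  by (rule Ck_1I[where f' = "\<lambda>x h. frechet_derivative f (at x) h + frechet_derivative g (at x) h"])
    (intro has_derivative_add continuous_on_add Ck_1D; assumption)+

lemma Ck_1_scaleR:
  fixes g :: "'a::euclidean_space \<Rightarrow> real"
  assumes "Ck 1 g" "Ck 1 f"
  shows "Ck 1 (\<lambda>x. g x *\<^sub>R f x)"
  by (rule Ck_1I[where f' = "\<lambda>x h. g x *\<^sub>R frechet_derivative f (at x) h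
        + frechet_derivative g (at x) h *\<^sub>R f x"])
    (intro has_derivative_scaleR continuous_on_add continuous_on_scaleR Ck_1_continuous Ck_1D assms; assumption)+

lemma Ck_1_minus: "Ck 1 f \<Longrightarrow> Ck 1 (\<lambda>x. - f x)"
  using Ck_1_scaleR[OF Ck_1_const[of "-1"], of f] by simp

lemma Ck_1_mult:
  fixes f g :: "'a::euclidean_space \<Rightarrow> real"
  shows "Ck 1 g \<Longrightarrow> Ck 1 f \<Longrightarrow> Ck 1 (\<lambda>x. g x * f x)"
  using Ck_1_scaleR[of g f] by simp

lemma Ck_1_diff: "Ck 1 f \<Longrightarrow> Ck 1 g \<Longrightarrow> Ck 1 (\<lambda>x. f x - g x)"
  using Ck_1_add[of f "\<lambda>x. - g x"] Ck_1_minus[of g] by simp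

lemma diverg_add:
  assumes "Ck 1 f" "Ck 1 g"
  shows "diverg (\<lambda>x. f x + g x) x = diverg f x + diverg g x"
proof -
  have "frechet_derivative (\<lambda>x. f x + g x) (at x)
      = (\<lambda>h. frechet_derivative f (at x) h + frechet_derivative g (at x) h)"
    using assms by (intro frechet_derivative_at[symmetric] has_derivative_add Ck_1D)
  then show ?thesis
    by (simp add: diverg_def inner_add_left sum.distrib)
qed

lemma diverg_minus:
  assumes "Ck 1 f"
  shows "diverg (\<lambda>x. - f x) x = - diverg f x"
proof -
  have "frechet_derivative (\<lambda>x. - f x) (at x) = (\<lambda>h. - frechet_derivative f (at x) h)"
    using assms by (intro frechet_derivative_at[symmetric] has_derivative_minus Ck_1D)
  then show ?thesis
    by (simp add: diverg_def sum_negf)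
qed

text \<open>Along a fixed vector, divergence is a directional derivative. This is how translations
  enter the definition of total variation.\<close>

lemma diverg_scaleR_const:
  fixes f :: "'a::euclidean_space \<Rightarrow> real"
  assumes "(f has_derivative f') (at x)"
  shows "diverg (\<lambda>x. f x *\<^sub>R y) x = f' y"
proof -
  have "frechet_derivative (\<lambda>x. f x *\<^sub>R y) (at x) = (\<lambda>h. f' h *\<^sub>R y)"
    using assms by (intro frechet_derivative_at[symmetric] has_derivative_scaleR_left)
  then have "diverg (\<lambda>x. f x *\<^sub>R y) x = (\<Sum>b\<in>Basis. (y \<bullet> b) *\<^sub>R f' b)"
    by (simp add: diverg_def mult.commute)
  also have "\<dots> = f' (\<Sum>b\<in>Basis. (y \<bullet> b) *\<^sub>R b)"
    using has_derivative_linear[OF assms] by (simp add: linear_sum linear_cmul)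
  finally show ?thesis
    by (simp add: euclidean_representation)
qed

lemma continuous_on_diverg: "Ck 1 f \<Longrightarrow> continuous_on S (diverg f)"
  unfolding diverg_def
  by (rule continuous_on_subset[of UNIV])
    (intro continuous_on_sum continuous_on_inner continuous_on_const Ck_1D subset_UNIV; assumption)+

lemma CkcD:
  assumes "f \<in> Ckc k A"
  shows "Ck k f" "compact (closure {x. f x \<noteq> 0})" "closure {x. f x \<noteq> 0} \<subseteq> A"
  using assms by (auto simp: Ckc_def)

lemma Ckc_zero: "(\<lambda>x. 0) \<in> Ckc 1 A"
  by (auto simp: Ckc_def Ck_1_const)

lemma Ckc_supportI:
  assumes "Ck k f" "compact K" "{x. f x \<noteq> 0} \<subseteq> K" "K \<subseteq> A"
  shows "f \<in> Ckc k A"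
proof -
  have "closure {x. f x \<noteq> 0} \<subseteq> K"
    using assms compact_imp_closed closure_minimal by blast
  then show ?thesis
    using assms unfolding Ckc_def
    by (auto intro: compact_closure[THEN iffD2] bounded_subset compact_imp_bounded)
qed

lemma has_derivative_0_outside_support:
  assumes "x \<notin> closure {x. f x \<noteq> 0}"
  shows "(f has_derivative (\<lambda>h. 0)) (at x)"
proof -
  have "((\<lambda>y. 0) has_derivative (\<lambda>h. 0)) (at x)"
    by simp
  then show ?thesis
    by (rule has_derivative_transform_within_open[of _ _ _ _ "- closure {x. f x \<noteq> 0}"])
      (use assms closure_subset[of "{x. f x \<noteq> 0}"] in auto)
qed

lemma diverg_eq_0: "x \<notin> closure {x. f x \<noteq> 0} \<Longrightarrow> diverg f x = 0"
  by (simp add: diverg_def frechet_derivative_at[OF has_derivative_0_outside_support, symmetric])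

lemma diverg_bounded:
  assumes "f \<in> Ckc 1 A"
  obtains B where "\<And>x. \<bar>diverg f x\<bar> \<le> B" "B \<ge> 0"
proof -
  let ?K = "closure {x. f x \<noteq> 0}"
  have "compact (diverg f ` ?K)"
    using assms by (intro compact_continuous_image continuous_on_diverg CkcD)
  then obtain B where B: "\<And>x. x \<in> ?K \<Longrightarrow> \<bar>diverg f x\<bar> \<le> B"
    using compact_imp_bounded bounded_iff by (metis imageI real_norm_def)
  have "\<bar>diverg f x\<bar> \<le> \<bar>B\<bar>" for x
    using B[of x] diverg_eq_0[of x f] by (cases "x \<in> ?K") auto
  then show thesis
    using that[of "\<bar>B\<bar>"] by simp
qed

lemma borel_measurable_diverg:
  assumes "Ck 1 f"
  shows "diverg f \<in> borel_measurable borel"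
  using assms by (intro borel_measurable_continuous_onI continuous_on_diverg)

lemma integrable_mult_diverg:
  assumes "set_integrable lebesgue E v" "f \<in> Ckc 1 A"
  shows "set_integrable lebesgue E (\<lambda>x. v x * diverg f x)"
proof -
  obtain B where B: "\<And>x. \<bar>diverg f x\<bar> \<le> B" "B \<ge> 0"
    using diverg_bounded[OF assms(2)] by blast
  have "diverg f \<in> borel_measurable lebesgue"
    using borel_measurable_diverg[OF CkcD(1)[OF assms(2)]]
    by (simp add: measurable_completion)
  then have "integrable lebesgue (\<lambda>x. diverg f x * (indicator E x *\<^sub>R v x))"
    using assms(1) B unfolding set_integrable_def
    by (intro Bochner_Integration.integrable_bound[of _ "\<lambda>x. B *\<^sub>R (indicator E x *\<^sub>R v x)" "\<lambda>x. diverg f x * (indicator E x *\<^sub>R v x)"])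
      (auto simp: abs_mult intro!: mult_right_mono)
  then show ?thesis
    by (simp add: set_integrable_def mult_ac)
qed

lemma LINT_mult_diverg_cong:
  assumes "f \<in> Ckc 1 A" "A \<subseteq> E"
  shows "(LINT x:A|lebesgue. v x * diverg f x) = (LINT x:E|lebesgue. v x * diverg f x)"
  unfolding set_lebesgue_integral_def
proof (rule Bochner_Integration.integral_cong)
  fix x
  have "diverg f x = 0" if "x \<notin> A"
    using that assms diverg_eq_0[of x f] by (auto simp: Ckc_def)
  then show "indicator A x *\<^sub>R (v x * diverg f x) = indicator E x *\<^sub>R (v x * diverg f x)"
    using assms(2) by (auto simp: indicator_def)
qed auto

section \<open>Explicit radial cutoffs of class C1\<close>

definition sq_pos :: "real \<Rightarrow> real" where
  "sq_pos s = (max 0 s)\<^sup>2"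

text \<open>On [0, 1] this is the quartic 1 - (1 - s^2)^2, continued by 0 on the left and by 1 on
  the right. Squaring the positive part removes its corner, so the composition is C1, which is all
  that \<open>Ckc 1\<close> asks for.\<close>

definition step_fun :: "real \<Rightarrow> real" where
  "step_fun s = 1 - sq_pos (1 - sq_pos s)"

lemma has_real_derivative_sq_pos: "(sq_pos has_real_derivative 2 * max 0 s) (at s)"
proof -
  consider "s < 0" | "s = 0" | "s > 0" by linarith
  then show ?thesis
  proof cases
    case 1
    have "\<forall>\<^sub>F y in nhds s. y < 0"
      using 1 by (intro eventually_nhds[THEN iffD2] exI[of _ "{..<0}"]) auto
    then have "\<forall>\<^sub>F y in nhds s. sq_pos y = 0"
      by eventually_elim (auto simp: sq_pos_def)
    then show ?thesis
      using 1 by (subst DERIV_cong_ev[where g = "\<lambda>s. 0" and y = s]) auto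
  next
    case 2
    have "((\<lambda>h. \<bar>h\<bar>) \<longlongrightarrow> 0) (at (0::real))"
      by (rule tendsto_eq_intros | simp)+
    then have "((\<lambda>h. sq_pos h / h) \<longlongrightarrow> 0) (at 0)"
      by (rule Lim_null_comparison[rotated])
        (auto simp: sq_pos_def max_def power2_eq_square)
    then show ?thesis
      using 2 by (simp add: DERIV_def sq_pos_def)
  next
    case 3
    have "\<forall>\<^sub>F y in nhds s. y > 0"
      using 3 by (intro eventually_nhds[THEN iffD2] exI[of _ "{0<..}"]) auto
    then have "\<forall>\<^sub>F y in nhds s. sq_pos y = y\<^sup>2"
      by eventually_elim (auto simp: sq_pos_def)
    then show ?thesis
      using 3 by (subst DERIV_cong_ev[where g = "\<lambda>s. s\<^sup>2" and y = s])
        (auto intro!: derivative_eq_intros)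
  qed
qed

definition step_deriv :: "real \<Rightarrow> real" where
  "step_deriv s = 4 * max 0 (1 - sq_pos s) * max 0 s"

lemma has_real_derivative_step_fun: "(step_fun has_real_derivative step_deriv s) (at s)"
proof -
  have "((\<lambda>s. 1 - sq_pos s) has_real_derivative - (2 * max 0 s)) (at s)"
    using DERIV_diff[OF DERIV_const[of 1] has_real_derivative_sq_pos] by simp
  from DERIV_diff[OF DERIV_const[of 1] DERIV_chain2[OF has_real_derivative_sq_pos this]]
  show ?thesis
    by (simp add: step_fun_def[abs_def] step_deriv_def mult.assoc)
qed

lemma continuous_on_sq_pos: "continuous_on S sq_pos"
  unfolding sq_pos_def by (intro continuous_intros)

lemma continuous_on_step_deriv: "continuous_on S step_deriv"
  unfolding step_deriv_def by (intro continuous_intros continuous_on_sq_pos)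

lemma step_deriv_bounds: "0 \<le> step_deriv s" "step_deriv s \<le> 4"
proof -
  show "0 \<le> step_deriv s"
    by (simp add: step_deriv_def)
  show "step_deriv s \<le> 4"
  proof (cases "0 < s \<and> s < 1")
    case True
    have "max 0 (1 - sq_pos s) * max 0 s \<le> 1 * 1"
      using True by (intro mult_mono) (auto simp: sq_pos_def)
    then show ?thesis by (simp add: step_deriv_def)
  next
    case False
    then have "s \<le> 0 \<or> sq_pos s \<ge> 1"
      by (auto simp: sq_pos_def max_def)
    then show ?thesis by (auto simp: step_deriv_def max_def)
  qed
qed

lemma step_fun_bounds: "0 \<le> step_fun s" "step_fun s \<le> 1"
proof -
  have "(max 0 (1 - sq_pos s))\<^sup>2 \<le> 1"
    by (intro power_le_one) (auto simp: sq_pos_def)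
  then show "0 \<le> step_fun s" "step_fun s \<le> 1"
    by (auto simp: step_fun_def sq_pos_def)
qed

lemma step_fun_eq_0: "s \<le> 0 \<Longrightarrow> step_fun s = 0"
  by (auto simp: step_fun_def sq_pos_def)

lemma step_fun_eq_1:
  assumes "s \<ge> 1"
  shows "step_fun s = 1"
proof -
  have "s\<^sup>2 \<ge> 1" using assms by auto
  then show ?thesis using assms by (auto simp: step_fun_def sq_pos_def)
qed

text \<open>For 0 \<le> r < R it is 1 on the closed ball of radius r and 0 off the open ball of
  radius R. The squared norm is used because the norm itself is not differentiable at the
  centre.\<close>

definition bump :: "'a::euclidean_space \<Rightarrow> real \<Rightarrow> real \<Rightarrow> 'a \<Rightarrow> real" where
  "bump c r R x = step_fun ((R\<^sup>2 - (norm (x - c))\<^sup>2) / (R\<^sup>2 - r\<^sup>2))"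

lemma bump_has_derivative:
  "(bump c r R has_derivative
     (\<lambda>h. step_deriv ((R\<^sup>2 - (norm (x - c))\<^sup>2) / (R\<^sup>2 - r\<^sup>2)) * (- 2 * ((x - c) \<bullet> h) / (R\<^sup>2 - r\<^sup>2)))) (at x)"
proof -
  have "((\<lambda>x. (R\<^sup>2 - (x - c) \<bullet> (x - c)) * inverse (R\<^sup>2 - r\<^sup>2)) has_derivative
      (\<lambda>h. - 2 * ((x - c) \<bullet> h) * inverse (R\<^sup>2 - r\<^sup>2))) (at x)"
    by (rule derivative_eq_intros refl | simp add: inner_commute)+
  then have "((\<lambda>x. (R\<^sup>2 - (norm (x - c))\<^sup>2) / (R\<^sup>2 - r\<^sup>2)) has_derivative
      (\<lambda>h. - 2 * ((x - c) \<bullet> h) / (R\<^sup>2 - r\<^sup>2))) (at x)"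
    by (simp add: power2_norm_eq_inner divide_inverse)
  from has_derivative_compose[OF this has_real_derivative_step_fun[unfolded has_field_derivative_def]]
  show ?thesis
    by (simp add: bump_def[abs_def])
qed

lemma Ck_1_bump: "Ck 1 (bump c r R)"
proof (rule Ck_1I[OF bump_has_derivative])
  fix b :: 'a
  have "continuous_on UNIV (\<lambda>x. (R\<^sup>2 - (norm (x - c))\<^sup>2) * inverse (R\<^sup>2 - r\<^sup>2))"
    by (intro continuous_intros)
  then have "continuous_on UNIV (\<lambda>x. step_deriv ((R\<^sup>2 - (norm (x - c))\<^sup>2) * inverse (R\<^sup>2 - r\<^sup>2)))"
    by (rule continuous_on_compose2[OF continuous_on_step_deriv[of UNIV]]) simp
  then show "continuous_on UNIV (\<lambda>x. step_deriv ((R\<^sup>2 - (norm (x - c))\<^sup>2) / (R\<^sup>2 - r\<^sup>2)) *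
      (- 2 * ((x - c) \<bullet> b) / (R\<^sup>2 - r\<^sup>2)))"
    unfolding divide_inverse by (intro continuous_intros)
qed

lemma bump_bounds: "0 \<le> bump c r R x" "bump c r R x \<le> 1"
  by (auto simp: bump_def step_fun_bounds)

lemma bump_eq_1:
  assumes "0 \<le> r" "r < R" "x \<in> cball c r"
  shows "bump c r R x = 1"
proof -
  have "r\<^sup>2 < R\<^sup>2" "(norm (x - c))\<^sup>2 \<le> r\<^sup>2"
    using assms by (auto simp: dist_norm norm_minus_commute power_strict_mono)
  then show ?thesis
    unfolding bump_def by (intro step_fun_eq_1) (simp add: field_simps)
qed

lemma bump_eq_0:
  assumes "0 \<le> r" "r < R" "x \<notin> ball c R"
  shows "bump c r R x = 0"
proof -
  have "r\<^sup>2 < R\<^sup>2" "R\<^sup>2 \<le> (norm (x - c))\<^sup>2"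
    using assms by (auto simp: dist_norm norm_minus_commute power_strict_mono intro!: power_mono)
  then show ?thesis
    unfolding bump_def by (intro step_fun_eq_0) (simp add: field_simps)
qed

lemma bump_Ckc:
  assumes "0 \<le> r" "r < R" "cball c R \<subseteq> A"
  shows "bump c r R \<in> Ckc 1 A"
proof (rule Ckc_supportI[OF Ck_1_bump compact_cball _ assms(3)])
  show "{x. bump c r R x \<noteq> 0} \<subseteq> cball c R"
    using bump_eq_0[OF assms(1,2)] ball_subset_cball[of c R] by blast
qed

text \<open>The constant is 4 from \<open>step_deriv_bounds\<close> times 2 R / (R^2 - r^2), where R
  / (R + r) is at most 1. Outside the ball the argument of \<open>step_deriv\<close> is nonpositive,
  where it vanishes.\<close>

lemma norm_grad_bump:
  assumes "0 \<le> r" "r < R"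
  shows "norm (grad (bump c r R) x) \<le> 8 / (R - r)" and "x \<notin> ball c R \<Longrightarrow> grad (bump c r R) x = 0"
proof -
  let ?s = "(R\<^sup>2 - (norm (x - c))\<^sup>2) / (R\<^sup>2 - r\<^sup>2)"
  let ?k = "step_deriv ?s * (- 2 / (R\<^sup>2 - r\<^sup>2))"
  have pos: "R\<^sup>2 - r\<^sup>2 > 0"
    using assms by (auto simp: power_strict_mono)
  have "grad (bump c r R) x = (\<Sum>b\<in>Basis. (?k * ((x - c) \<bullet> b)) *\<^sub>R b)"
    unfolding grad_def frechet_derivative_at[OF bump_has_derivative, symmetric]
    by (simp add: mult_ac)
  also have "\<dots> = ?k *\<^sub>R (\<Sum>b\<in>Basis. ((x - c) \<bullet> b) *\<^sub>R b)"
    by (simp add: scaleR_sum_right)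
  finally have g: "grad (bump c r R) x = ?k *\<^sub>R (x - c)"
    by (simp add: euclidean_representation)
  show z: "grad (bump c r R) x = 0" if "x \<notin> ball c R"
  proof -
    have "R\<^sup>2 \<le> (norm (x - c))\<^sup>2"
      using assms that by (auto simp: dist_norm norm_minus_commute intro!: power_mono)
    then have "?s \<le> 0" using pos by (simp add: divide_nonpos_pos)
    then show ?thesis by (simp add: g step_deriv_def max_def)
  qed
  show "norm (grad (bump c r R) x) \<le> 8 / (R - r)"
  proof (cases "x \<in> ball c R")
    case True
    then have n: "norm (x - c) \<le> R" by (simp add: dist_norm norm_minus_commute)
    have "norm (grad (bump c r R) x) = step_deriv ?s * (2 / (R\<^sup>2 - r\<^sup>2)) * norm (x - c)"
      using pos step_deriv_bounds(1)[of ?s] by (simp add: g abs_mult)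
    also have "\<dots> \<le> 4 * (2 / (R\<^sup>2 - r\<^sup>2)) * R"
      using pos n step_deriv_bounds[of ?s] assms by (intro mult_mono) auto
    also have "\<dots> = 8 / (R - r) * (R / (R + r))"
      using assms by (simp add: power2_eq_square field_simps)
    also have "\<dots> \<le> 8 / (R - r) * 1"
      using assms by (intro mult_left_mono) auto
    finally show ?thesis by simp
  next
    case False
    then show ?thesis using z assms by simp
  qed
qed

text \<open>Finitely many bumps cover K by compactness. The value 1 is reached on a whole
  neighbourhood W, so that multiplying a field by 1 - h moves its support away from K.\<close>

lemma C1_Urysohn:
  fixes K :: "'a::euclidean_space set"
  assumes "compact K" "open A" "K \<subseteq> A"
  obtains h where "h \<in> Ckc 1 A" "\<And>x. 0 \<le> h x" "\<And>x. h x \<le> (1::real)"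
    "\<exists>W. open W \<and> K \<subseteq> W \<and> (\<forall>x\<in>W. h x = 1)"
proof -
  define P where "P (W :: 'a set) \<longleftrightarrow> (\<exists>h. h \<in> Ckc 1 A \<and> (\<forall>x. 0 \<le> h x \<and> h x \<le> (1::real)) \<and> (\<forall>x\<in>W. h x = 1))" for W
  have empty: "P {}"
    unfolding P_def by (rule exI[of _ "\<lambda>x. 0"]) (simp add: Ckc_zero)
  have un: "P (V \<union> W)" if "P V" "P W" for V W
  proof -
    obtain f g :: "'a \<Rightarrow> real" where f: "f \<in> Ckc 1 A" "\<forall>x. 0 \<le> f x \<and> f x \<le> 1" "\<forall>x\<in>V. f x = 1"
      and g: "g \<in> Ckc 1 A" "\<forall>x. 0 \<le> g x \<and> g x \<le> 1" "\<forall>x\<in>W. g x = 1"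
      using \<open>P V\<close> \<open>P W\<close> unfolding P_def by blast
    \<comment> \<open>A C1 substitute for the maximum: it stays in [0, 1], is 1 where either
      function is 1, and vanishes where both vanish.\<close>
    define h where "h x = 1 - (1 - f x) * (1 - g x)" for x
    have "Ck 1 h"
      unfolding h_def using CkcD(1)[OF f(1)] CkcD(1)[OF g(1)]
      by (intro Ck_1_diff Ck_1_mult Ck_1_const)
    then have "h \<in> Ckc 1 A"
    proof (rule Ckc_supportI)
      show "compact (closure {x. f x \<noteq> 0} \<union> closure {x. g x \<noteq> 0})"
        using CkcD f g by blast
      show "{x. h x \<noteq> 0} \<subseteq> closure {x. f x \<noteq> 0} \<union> closure {x. g x \<noteq> 0}"
      proof
        fix x assume "x \<in> {x. h x \<noteq> 0}"
        then have "f x \<noteq> 0 \<or> g x \<noteq> 0" by (auto simp: h_def)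
        then show "x \<in> closure {x. f x \<noteq> 0} \<union> closure {x. g x \<noteq> 0}"
          using closure_subset[of "{x. f x \<noteq> 0}"] closure_subset[of "{x. g x \<noteq> 0}"] by blast
      qed
      show "closure {x. f x \<noteq> 0} \<union> closure {x. g x \<noteq> 0} \<subseteq> A"
        using CkcD f g by blast
    qed
    moreover have "0 \<le> h x \<and> h x \<le> 1" for x
    proof -
      have "(1 - f x) * (1 - g x) \<le> 1 * 1"
        using f g by (intro mult_mono) (auto simp: algebra_simps)
      then show ?thesis
        using f g by (auto simp: h_def)
    qed
    ultimately show ?thesis
      unfolding P_def using f g by (intro exI[of _ h]) (auto simp: h_def)
  qed
  have "\<exists>r>0. cball x (2 * r) \<subseteq> A" if "x \<in> K" for x
  proof -
    obtain e where "e > 0" "cball x e \<subseteq> A"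
      using bspec[OF assms(2)[unfolded open_contains_cball], of x] assms(3) \<open>x \<in> K\<close> by auto
    then show ?thesis by (intro exI[of _ "e / 2"]) simp
  qed
  then have "\<exists>r. \<forall>x\<in>K. r x > 0 \<and> cball x (2 * r x) \<subseteq> A"
    by (intro bchoice ballI)
  then obtain r where r: "\<And>x. x \<in> K \<Longrightarrow> r x > 0 \<and> cball x (2 * r x) \<subseteq> A"
    by blast
  have "K \<subseteq> (\<Union>x\<in>K. ball x (r x))"
  proof
    fix x assume "x \<in> K"
    then have "x \<in> ball x (r x)" using r[of x] by simp
    then show "x \<in> (\<Union>x\<in>K. ball x (r x))" using \<open>x \<in> K\<close> by blast
  qed
  then obtain D where D: "D \<subseteq> K" "finite D" "K \<subseteq> (\<Union>x\<in>D. ball x (r x))"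
    by (rule compactE_image[OF assms(1) open_ball])
  have "P (\<Union>x\<in>D. ball x (r x))"
    using D(2,1)
  proof (induction D rule: finite_induct)
    case empty
    then show ?case using \<open>P {}\<close> by simp
  next
    case (insert x F)
    then have "r x > 0" "cball x (2 * r x) \<subseteq> A" using r[of x] by blast+
    then have "P (ball x (r x))"
      unfolding P_def
      by (intro exI[of _ "bump x (r x) (2 * r x)"])
        (auto intro!: bump_Ckc bump_bounds bump_eq_1)
    moreover have "P (\<Union>x\<in>F. ball x (r x))"
      using insert by blast
    ultimately show ?case
      using un by simp
  qed
  then obtain h :: "'a \<Rightarrow> real" where "h \<in> Ckc 1 A" "\<forall>x. 0 \<le> h x \<and> h x \<le> 1" "\<forall>x\<in>(\<Union>x\<in>D. ball x (r x)). h x = 1"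
    unfolding P_def by blast
  moreover have "open (\<Union>x\<in>D. ball x (r x))"
    by blast
  ultimately show thesis
    using D(3) that by blast
qed

section \<open>The total variation measure\<close>

lemma total_variation_upper:
  assumes "f \<in> Ckc 1 A" "\<And>x. norm (f x) \<le> 1"
  shows "ennreal (LINT x:A|lebesgue. v x * diverg f x) \<le> total_variation v A"
  unfolding total_variation_def using assms by (intro SUP_upper) auto

lemma total_variation_least:
  assumes "\<And>f. f \<in> Ckc 1 A \<Longrightarrow> (\<And>x. norm (f x) \<le> 1) \<Longrightarrow>
      ennreal (LINT x:A|lebesgue. v x * diverg f x) \<le> C"
  shows "total_variation v A \<le> C"
  unfolding total_variation_def using assms by (intro SUP_least) auto

lemma Ckc_mono: "f \<in> Ckc k A \<Longrightarrow> A \<subseteq> B \<Longrightarrow> f \<in> Ckc k B"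
  by (auto simp: Ckc_def)

lemma total_variation_mono:
  fixes v :: "'a::euclidean_space \<Rightarrow> real"
  assumes "A \<subseteq> B"
  shows "total_variation v A \<le> total_variation v B"
proof (rule total_variation_least)
  fix f :: "'a \<Rightarrow> 'a" assume "f \<in> Ckc 1 A" "\<And>x. norm (f x) \<le> 1"
  then show "ennreal (LINT x:A|lebesgue. v x * diverg f x) \<le> total_variation v B"
    using total_variation_upper[of f B v] Ckc_mono[of f 1 A B] assms
    by (simp add: LINT_mult_diverg_cong)
qed

lemma total_variation_empty [simp]: "total_variation v {} = 0"
  using total_variation_least[of "{}" v 0] by (simp add: set_lebesgue_integral_def)

lemma ennreal_add_le: "ennreal (a + b) \<le> ennreal a + ennreal b"
  by (cases "0 \<le> a"; cases "0 \<le> b") (auto simp: ennreal_neg ennreal_leI simp flip: ennreal_plus)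

lemma LINT_mult_diverg_add:
  assumes "set_integrable lebesgue A v" "f \<in> Ckc 1 B" "g \<in> Ckc 1 C"
  shows "(LINT x:A|lebesgue. v x * diverg (\<lambda>x. f x + g x) x)
    = (LINT x:A|lebesgue. v x * diverg f x) + (LINT x:A|lebesgue. v x * diverg g x)"
proof -
  have "diverg (\<lambda>x. f x + g x) x = diverg f x + diverg g x" for x
    using assms by (intro diverg_add CkcD)
  then show ?thesis
    using integrable_mult_diverg[OF assms(1,2)] integrable_mult_diverg[OF assms(1,3)]
    by (simp add: distrib_left set_integral_add(2))
qed

text \<open>A competitor in A - K has support disjoint from that of f, so the sum of the two fields
  still has norm at most 1 and competes in A. This is superadditivity, phrased for one fixed field f
  so that it can be used inside a supremum.\<close>

lemma LINT_diverg_add_total_variation_le: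
  assumes v: "set_integrable lebesgue A v"
    and f: "f \<in> Ckc 1 A" "\<And>x. norm (f x) \<le> 1"
  defines "K \<equiv> closure {x. f x \<noteq> 0}"
  shows "ennreal (LINT x:A|lebesgue. v x * diverg f x) + total_variation v (A - K)
    \<le> total_variation v A"
proof -
  let ?I = "\<lambda>g. LINT x:A|lebesgue. v x * diverg g x"
  have "ennreal (?I f) + ennreal (LINT x:A-K|lebesgue. v x * diverg g x) \<le> total_variation v A"
    if g: "g \<in> Ckc 1 (A - K)" "\<And>x. norm (g x) \<le> 1" for g
  proof -
    have eq: "(LINT x:A-K|lebesgue. v x * diverg g x) = ?I g"
      using g by (intro LINT_mult_diverg_cong) auto
    have gA: "g \<in> Ckc 1 A"
      using g Ckc_mono by blast
    \<comment> \<open>\<open>ennreal\<close> sends negative numbers to 0, so it is additive only on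
      nonnegative values. If one integral is nonpositive, the other field alone is a sufficient
      competitor.\<close>
    consider "?I f \<le> 0" | "?I g \<le> 0" | "?I f \<ge> 0" "?I g \<ge> 0" by linarith
    then show ?thesis
    proof cases
      case 1
      then show ?thesis
        unfolding eq using total_variation_upper[OF gA g(2)] by (simp add: ennreal_neg)
    next
      case 2
      then show ?thesis
        unfolding eq using total_variation_upper[OF f] by (simp add: ennreal_neg)
    next
      case 3
      have "(\<lambda>x. f x + g x) \<in> Ckc 1 A"
      proof (rule Ckc_supportI)
        show "Ck 1 (\<lambda>x. f x + g x)"
          using f g by (intro Ck_1_add CkcD)
        show "compact (K \<union> closure {x. g x \<noteq> 0})"
          using f(1) g(1) unfolding K_def by (intro compact_Un CkcD)
        have "x \<in> K \<union> closure {x. g x \<noteq> 0}" if "f x + g x \<noteq> 0" for x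
        proof -
          have "f x \<noteq> 0 \<or> g x \<noteq> 0" using that by auto
          then show ?thesis
            unfolding K_def
            using closure_subset[of "{x. f x \<noteq> 0}"] closure_subset[of "{x. g x \<noteq> 0}"] by blast
        qed
        then show "{x. f x + g x \<noteq> 0} \<subseteq> K \<union> closure {x. g x \<noteq> 0}" by blast
        show "K \<union> closure {x. g x \<noteq> 0} \<subseteq> A"
          using CkcD(3)[OF f(1)] CkcD(3)[OF gA] unfolding K_def by blast
      qed
      moreover have "norm (f x + g x) \<le> 1" for x
      proof -
        have "f x = 0 \<or> g x = 0"
          using CkcD(3)[OF g(1)] closure_subset[of "{x. f x \<noteq> 0}"] closure_subset[of "{x. g x \<noteq> 0}"]
          unfolding K_def by blast
        then show ?thesis using f(2)[of x] g(2)[of x] by auto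
      qed
      ultimately have "ennreal (?I (\<lambda>x. f x + g x)) \<le> total_variation v A"
        by (rule total_variation_upper)
      then show ?thesis
        unfolding eq using LINT_mult_diverg_add[OF v f(1) gA] 3 by simp
    qed
  qed
  then show ?thesis
    unfolding total_variation_def[of v "A - K"]
    by (subst ennreal_SUP_add_right)
      (auto intro!: SUP_least Ckc_zero exI[of _ "\<lambda>x. 0"])
qed

text \<open>A competitor f in the union splits as h f + (1 - h) f, with one summand supported in A
  and the other in B. Both factors lie in [0, 1], so the norm bound survives.\<close>

lemma total_variation_Un_le:
  fixes v :: "'a::euclidean_space \<Rightarrow> real"
  assumes "open A" "open B" and v: "set_integrable lebesgue (A \<union> B) v"
  shows "total_variation v (A \<union> B) \<le> total_variation v A + total_variation v B"
proof (rule total_variation_least)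
  fix f :: "'a \<Rightarrow> 'a" assume f: "f \<in> Ckc 1 (A \<union> B)" "\<And>x. norm (f x) \<le> 1"
  let ?K = "closure {x. f x \<noteq> 0}"
  \<comment> \<open>The part of the support that B misses is compact in A. Setting h = 1 near it
    pushes the support of (1 - h) f into B.\<close>
  have "compact (?K - B)"
    using CkcD(2)[OF f(1)] assms(2) by (rule compact_diff)
  moreover have "?K - B \<subseteq> A"
    using CkcD(3)[OF f(1)] by blast
  ultimately obtain h W where h: "h \<in> Ckc 1 A" "\<And>x. 0 \<le> h x" "\<And>x. h x \<le> (1::real)"
    and W: "open W" "?K - B \<subseteq> W" "\<And>x. x \<in> W \<Longrightarrow> h x = 1"
    using C1_Urysohn[OF _ assms(1)] by metis
  let ?f = "\<lambda>x. h x *\<^sub>R f x" and ?g = "\<lambda>x. (1 - h x) *\<^sub>R f x"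
  have f1: "?f \<in> Ckc 1 A"
  proof (rule Ckc_supportI)
    show "Ck 1 ?f" by (intro Ck_1_scaleR CkcD(1)[OF h(1)] CkcD(1)[OF f(1)])
    show "compact (closure {x. h x \<noteq> 0})" "closure {x. h x \<noteq> 0} \<subseteq> A"
      using CkcD[OF h(1)] by auto
    show "{x. h x *\<^sub>R f x \<noteq> 0} \<subseteq> closure {x. h x \<noteq> 0}"
      using closure_subset[of "{x. h x \<noteq> 0}"] by auto
  qed
  have g1: "?g \<in> Ckc 1 B"
  proof (rule Ckc_supportI)
    show "Ck 1 ?g" by (intro Ck_1_scaleR Ck_1_diff Ck_1_const CkcD(1)[OF h(1)] CkcD(1)[OF f(1)])
    show "compact (?K - W)" using CkcD(2)[OF f(1)] W(1) by (rule compact_diff)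
    show "?K - W \<subseteq> B" using W(2) by blast
    show "{x. (1 - h x) *\<^sub>R f x \<noteq> 0} \<subseteq> ?K - W"
      using W(3) closure_subset[of "{x. f x \<noteq> 0}"] by auto
  qed
  have n: "norm (?f x) \<le> 1" "norm (?g x) \<le> 1" for x
    using h(2,3)[of x] f(2)[of x] by (auto intro!: mult_le_one)
  have eq: "(\<lambda>x. ?f x + ?g x) = f"
    by (auto simp: algebra_simps)
  have "(LINT x:A\<union>B|lebesgue. v x * diverg f x)
      = (LINT x:A\<union>B|lebesgue. v x * diverg ?f x) + (LINT x:A\<union>B|lebesgue. v x * diverg ?g x)"
    using LINT_mult_diverg_add[OF v f1 g1] by (simp only: eq)
  also have "\<dots> = (LINT x:A|lebesgue. v x * diverg ?f x) + (LINT x:B|lebesgue. v x * diverg ?g x)"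
    using LINT_mult_diverg_cong[OF f1, of "A \<union> B" v] LINT_mult_diverg_cong[OF g1, of "A \<union> B" v] by simp
  finally have "ennreal (LINT x:A\<union>B|lebesgue. v x * diverg f x)
      = ennreal ((LINT x:A|lebesgue. v x * diverg ?f x) + (LINT x:B|lebesgue. v x * diverg ?g x))"
    by simp
  also have "\<dots> \<le> ennreal (LINT x:A|lebesgue. v x * diverg ?f x) + ennreal (LINT x:B|lebesgue. v x * diverg ?g x)"
    by (rule ennreal_add_le)
  also have "\<dots> \<le> total_variation v A + total_variation v B"
    using n by (intro add_mono total_variation_upper f1 g1)
  finally show "ennreal (LINT x:A\<union>B|lebesgue. v x * diverg f x) \<le> total_variation v A + total_variation v B" .
qed

text \<open>The compact support of a competitor meets only finitely many of the sets essentially: a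
  finite subcover reduces the claim to \<open>total_variation_Un_le\<close>.\<close>

lemma total_variation_UN_le:
  fixes A :: "nat \<Rightarrow> 'a::euclidean_space set"
  assumes "\<And>i. open (A i)" and v: "set_integrable lebesgue E v" and E: "\<And>i. A i \<subseteq> E"
  shows "total_variation v (\<Union>i. A i) \<le> (\<Sum>i. total_variation v (A i))"
proof (rule total_variation_least)
  fix f :: "'a \<Rightarrow> 'a" assume f: "f \<in> Ckc 1 (\<Union>i. A i)" "\<And>x. norm (f x) \<le> 1"
  obtain D where D: "D \<subseteq> UNIV" "finite D" "closure {x. f x \<noteq> 0} \<subseteq> (\<Union>i\<in>D. A i)"
    using compactE_image[OF CkcD(2)[OF f(1)] assms(1) CkcD(3)[OF f(1)]] by blast
  have fD: "f \<in> Ckc 1 (\<Union>i\<in>D. A i)"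
    using f(1) D(3) by (auto simp: Ckc_def)
  have "ennreal (LINT x:(\<Union>i. A i)|lebesgue. v x * diverg f x)
      = ennreal (LINT x:(\<Union>i\<in>D. A i)|lebesgue. v x * diverg f x)"
    using LINT_mult_diverg_cong[OF fD, of "\<Union>i. A i" v] by (simp add: UN_mono)
  also have "\<dots> \<le> total_variation v (\<Union>i\<in>D. A i)"
    by (rule total_variation_upper[OF fD f(2)])
  also have "\<dots> \<le> (\<Sum>i\<in>D. total_variation v (A i))"
    using D(2)
  proof (induction D)
    case (insert i F)
    have "set_integrable lebesgue (A i \<union> (\<Union>i\<in>F. A i)) v"
      using E by (intro set_integrable_subset[OF v]) (auto intro!: borel_open assms(1) open_Un open_UN)
    then have "total_variation v (A i \<union> (\<Union>i\<in>F. A i)) \<le> total_variation v (A i) + total_variation v (\<Union>i\<in>F. A i)"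
      by (intro total_variation_Un_le assms(1) open_UN ballI)
    also have "\<dots> \<le> total_variation v (A i) + (\<Sum>i\<in>F. total_variation v (A i))"
      using insert by (intro add_left_mono)
    finally show ?case
      using insert by simp
  qed simp
  also have "\<dots> \<le> (\<Sum>i. total_variation v (A i))"
    using D(2) by (intro sum_le_suminf) auto
  finally show "ennreal (LINT x:(\<Union>i. A i)|lebesgue. v x * diverg f x) \<le> (\<Sum>i. total_variation v (A i))" .
qed

section \<open>Caratheodory extension of the total variation to Borel sets\<close>

definition tv_outer :: "'a::euclidean_space set \<Rightarrow> ('a \<Rightarrow> real) \<Rightarrow> 'a set \<Rightarrow> ennreal" where
  "tv_outer E v B = (INF A\<in>{A. open A \<and> B \<subseteq> A \<and> A \<subseteq> E}. total_variation v A)"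

lemma tv_outer_open:
  assumes "open B" "B \<subseteq> E"
  shows "tv_outer E v B = total_variation v B"
  unfolding tv_outer_def
  by (rule antisym[OF INF_lower INF_greatest]) (use assms in \<open>auto intro: total_variation_mono\<close>)

lemma tv_outer_mono: "B \<subseteq> C \<Longrightarrow> tv_outer E v B \<le> tv_outer E v C"
  unfolding tv_outer_def by (rule INF_superset_mono) auto

lemma tv_outer_le: "open A \<Longrightarrow> B \<subseteq> A \<Longrightarrow> A \<subseteq> E \<Longrightarrow> tv_outer E v B \<le> total_variation v A"
  unfolding tv_outer_def by (rule INF_lower) auto

text \<open>Each set is enclosed in an open one with excess e / 2^(i + 1); countable subadditivity
  on open sets then passes to arbitrary sets.\<close>

lemma outer_measure_space_tv_outer:
  fixes E :: "'a::euclidean_space set"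
  assumes "open E" and v: "set_integrable lebesgue E v"
  shows "outer_measure_space (Pow E) (tv_outer E v)"
  unfolding outer_measure_space_def
proof (intro conjI)
  show "positive (Pow E) (tv_outer E v)"
    by (simp add: positive_def tv_outer_open)
  show "increasing (Pow E) (tv_outer E v)"
    by (auto simp: increasing_def intro: tv_outer_mono)
  show "countably_subadditive (Pow E) (tv_outer E v)"
    unfolding countably_subadditive_def
  proof (intro allI impI)
    fix A :: "nat \<Rightarrow> 'a set" assume A: "range A \<subseteq> Pow E"
    show "tv_outer E v (\<Union>i. A i) \<le> (\<Sum>i. tv_outer E v (A i))"
    proof (rule ennreal_le_epsilon)
      fix e :: real assume fin: "(\<Sum>i. tv_outer E v (A i)) < top" and e: "0 < e"
      have "\<exists>B. open B \<and> A i \<subseteq> B \<and> B \<subseteq> E \<and>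
          total_variation v B \<le> tv_outer E v (A i) + ennreal (e * (1 / 2) ^ Suc i)" for i
      proof -
        have "tv_outer E v (A i) < top"
          using fin ennreal_suminf_lessD by blast
        then have "tv_outer E v (A i) < tv_outer E v (A i) + ennreal (e * (1 / 2) ^ Suc i)"
          using e by (cases "tv_outer E v (A i)") (auto simp: ennreal_less_iff simp flip: ennreal_plus)
        then show ?thesis
          unfolding tv_outer_def INF_less_iff by (force intro: less_imp_le)
      qed
      then obtain B where B: "\<And>i. open (B i)" "\<And>i. A i \<subseteq> B i" "\<And>i. B i \<subseteq> E"
        "\<And>i. total_variation v (B i) \<le> tv_outer E v (A i) + ennreal (e * (1 / 2) ^ Suc i)"
        by metis
      have "tv_outer E v (\<Union>i. A i) \<le> total_variation v (\<Union>i. B i)"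
        using B by (intro tv_outer_le) (blast intro: open_UN)+
      also have "\<dots> \<le> (\<Sum>i. total_variation v (B i))"
        by (rule total_variation_UN_le[OF B(1) v B(3)])
      also have "\<dots> \<le> (\<Sum>i. tv_outer E v (A i) + ennreal (e * (1 / 2) ^ Suc i))"
        by (intro suminf_le B(4)) auto
      also have "\<dots> = (\<Sum>i. tv_outer E v (A i)) + (\<Sum>i. ennreal (e * (1 / 2) ^ Suc i))"
        by (intro suminf_add[symmetric]) auto
      also have "(\<Sum>i. ennreal (e * (1 / 2) ^ Suc i)) = ennreal e"
        using e sums_mult[OF power_half_series, of e] by (intro suminf_ennreal_eq) auto
      finally show "tv_outer E v (\<Union>i. A i) \<le> (\<Sum>i. tv_outer E v (A i)) + ennreal e" .
    qed
  qed
qed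

text \<open>Caratheodory's criterion for open U. For an open G around X, the variation on the
  intersection of G and U is a supremum over fields f; the support of f lies in U, so X - U is
  inside the open set G minus that support, and the superadditivity lemma applies to f.\<close>

lemma open_in_lambda_system_tv_outer:
  fixes E :: "'a::euclidean_space set"
  assumes "open E" and v: "set_integrable lebesgue E v" and U: "open U" "U \<subseteq> E"
  shows "U \<in> lambda_system E (Pow E) (tv_outer E v)"
proof -
  interpret sigma_algebra E "Pow E" by (rule sigma_algebra_Pow)
  have sub: "tv_outer E v X \<le> tv_outer E v (X \<inter> U) + tv_outer E v (X - U)" if "X \<subseteq> E" for X
  proof -
    \<comment> \<open>Padding with empty sets extracts binary subadditivity from the countable
      form.\<close>
    let ?A = "\<lambda>i::nat. if i = 0 then X \<inter> U else if i = 1 then X - U else {}"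
    have "disjoint_family ?A"
      by (auto simp: disjoint_family_on_def)
    moreover have "range ?A \<subseteq> Pow E" "(\<Union>i. ?A i) \<in> Pow E" using that by auto
    ultimately have "tv_outer E v (\<Union>i. ?A i) \<le> (\<Sum>i. tv_outer E v (?A i))"
      using outer_measure_space_tv_outer[OF assms(1,2)]
      unfolding outer_measure_space_def countably_subadditive_def by blast
    also have "(\<Union>i. ?A i) = X" by (auto split: if_splits)
    also have "(\<Sum>i. tv_outer E v (?A i)) = (\<Sum>i\<in>{0,1}. tv_outer E v (?A i))"
      by (rule suminf_finite) (auto simp: tv_outer_open)
    finally show ?thesis by simp
  qed
  have sup: "tv_outer E v (X \<inter> U) + tv_outer E v (X - U) \<le> tv_outer E v X" if "X \<subseteq> E" for X
  proof -
    have "tv_outer E v (X \<inter> U) + tv_outer E v (X - U) \<le> total_variation v G"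
      if G: "open G" "X \<subseteq> G" "G \<subseteq> E" for G
    proof -
      have GU: "open (G \<inter> U)" using G U by auto
      have int: "set_integrable lebesgue G v"
        by (rule set_integrable_subset[OF v _ G(3)]) (use G in auto)
      have "tv_outer E v (X \<inter> U) + tv_outer E v (X - U)
          \<le> total_variation v (G \<inter> U) + tv_outer E v (X - U)"
        using G GU by (intro add_right_mono tv_outer_le) auto
      also have "\<dots> \<le> total_variation v G"
        unfolding total_variation_def[of v "G \<inter> U"]
      proof (subst ennreal_SUP_add_left[symmetric], goal_cases)
        case 1
        show ?case by (auto intro!: Ckc_zero exI[of _ "\<lambda>x. 0"])
      next
        case 2
        show ?case
        proof (rule SUP_least)
          fix f :: "'a \<Rightarrow> 'a" assume "f \<in> {f \<in> Ckc 1 (G \<inter> U). \<forall>x. norm (f x) \<le> 1}"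
          then have f: "f \<in> Ckc 1 (G \<inter> U)" "\<And>x. norm (f x) \<le> 1" by auto
          then have fG: "f \<in> Ckc 1 G" using Ckc_mono by blast
          let ?K = "closure {x. f x \<noteq> 0}"
          have "tv_outer E v (X - U) \<le> total_variation v (G - ?K)"
            using G CkcD(3)[OF f(1)] by (intro tv_outer_le open_Diff) auto
          then have "ennreal (LINT x:G|lebesgue. v x * diverg f x) + tv_outer E v (X - U)
              \<le> ennreal (LINT x:G|lebesgue. v x * diverg f x) + total_variation v (G - ?K)"
            by (rule add_left_mono)
          also have "\<dots> \<le> total_variation v G"
            by (rule LINT_diverg_add_total_variation_le[OF int fG f(2)])
          finally show "ennreal (LINT x:G\<inter>U|lebesgue. v x * diverg f x) + tv_outer E v (X - U)
              \<le> total_variation v G"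
            using LINT_mult_diverg_cong[OF f(1), of G v] by simp
        qed
      qed
      finally show ?thesis .
    qed
    then show ?thesis
      unfolding tv_outer_def[of E v X] by (intro INF_greatest) auto
  qed
  show ?thesis
    unfolding lambda_system_eq using sub sup U by (auto intro!: antisym)
qed

text \<open>The sets satisfying Caratheodory's criterion form a sigma-algebra containing the open
  subsets of E, hence all its Borel subsets. So \<open>tv_outer\<close> is countably additive there
  and \<open>measure_of\<close> keeps it instead of falling back to the zero measure.\<close>

lemma emeasure_tv_measure_open:
  fixes E :: "'a::euclidean_space set"
  assumes E: "open E" and v: "set_integrable lebesgue E v" and U: "open U" "U \<subseteq> E"
  shows "emeasure (tv_measure E v) U = total_variation v U"
proof -
  interpret P: sigma_algebra E "Pow E" by (rule sigma_algebra_Pow)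
  let ?R = "restrict_space borel E"
  let ?L = "lambda_system E (Pow E) (tv_outer E v)"
  have ms: "measure_space E ?L (tv_outer E v)"
    by (rule P.caratheodory_lemma[OF outer_measure_space_tv_outer[OF E v]])
  then interpret L: sigma_algebra E ?L
    by (simp add: measure_space_def)
  have "E \<inter> B \<in> ?L" if "B \<in> sets borel" for B
  proof -
    have "B \<in> sigma_sets UNIV {S. open S}"
      using that by (simp add: borel_def)
    then show ?thesis
    proof induction
      case (Basic a)
      then show ?case
        using E by (intro open_in_lambda_system_tv_outer[OF E v]) auto
    next
      case (Compl a)
      have "E \<inter> (UNIV - a) = E - E \<inter> a" by blast
      then show ?case using L.compl_sets[OF Compl.IH] by simp
    next
      case (Union a)
      have "E \<inter> (\<Union>i. a i) = (\<Union>i. E \<inter> a i)" by blast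
      then show ?case using L.countable_UN[of "\<lambda>i. E \<inter> a i" UNIV] Union.IH by auto
    qed auto
  qed
  then have RL: "sets ?R \<subseteq> ?L"
    by (auto simp: sets_restrict_space)
  have tv: "tv_measure E v = measure_of E (sets ?R) (tv_outer E v)"
    unfolding tv_measure_def tv_outer_def ..
  have sp: "space ?R = E" by (simp add: space_restrict_space)
  have sets: "sets (tv_measure E v) = sets ?R"
    unfolding tv using sets.sets_measure_of_eq[of ?R] sp by simp
  have "emeasure (tv_measure E v) U = tv_outer E v U"
  proof (rule emeasure_measure_of[OF tv])
    show "sets ?R \<subseteq> Pow E" using sets.space_closed[of ?R] sp by simp
    show "positive (sets (tv_measure E v)) (tv_outer E v)"
      by (simp add: positive_def tv_outer_open)
    show "countably_additive (sets (tv_measure E v)) (tv_outer E v)"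
      unfolding countably_additive_def sets
    proof (intro allI impI)
      fix A :: "nat \<Rightarrow> 'a set"
      assume A: "range A \<subseteq> sets ?R" "disjoint_family A" "(\<Union>i. A i) \<in> sets ?R"
      then show "(\<Sum>i. tv_outer E v (A i)) = tv_outer E v (\<Union>i. A i)"
        using ms RL unfolding measure_space_def countably_additive_def by blast
    qed
    show "U \<in> sets (tv_measure E v)"
      unfolding sets using E U by (subst sets_restrict_space) (auto intro!: image_eqI[of _ _ U])
  qed
  then show ?thesis
    using U by (simp add: tv_outer_open)
qed

lemma sets_tv_measure: "sets (tv_measure E v) = sets (restrict_space borel E)"
proof -
  have "space (restrict_space borel E) = E" by (simp add: space_restrict_space)
  then show ?thesis
    unfolding tv_measure_def using sets.sets_measure_of_eq[of "restrict_space borel E"] by simp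
qed

text \<open>How the energy inequality is read: the cutoff is 1 on a smaller ball U, and the
  variation term then dominates the variation on U.\<close>

lemma total_variation_le_nn_integral:
  assumes E: "open E" and v: "set_integrable lebesgue E v" and U: "open U" "U \<subseteq> E"
    and z: "\<And>x. x \<in> U \<Longrightarrow> 1 \<le> z x"
  shows "total_variation v U \<le> (\<integral>\<^sup>+x. ennreal (z x) \<partial>tv_measure E v)"
proof -
  have "U \<in> sets (tv_measure E v)"
    unfolding sets_tv_measure sets_restrict_space using E U by (auto intro!: image_eqI[of _ _ U])
  then have "total_variation v U = (\<integral>\<^sup>+x. indicator U x \<partial>tv_measure E v)"
    using emeasure_tv_measure_open[OF E v U] by simp
  also have "\<dots> \<le> (\<integral>\<^sup>+x. ennreal (z x) \<partial>tv_measure E v)"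
    using z by (intro nn_integral_mono) (auto simp: indicator_def ennreal_1[symmetric] intro!: ennreal_leI simp del: ennreal_1)
  finally show ?thesis .
qed

section \<open>Translations\<close>

lemma nn_integral_lborel_shift:
  fixes f :: "'a::euclidean_space \<Rightarrow> ennreal"
  assumes "f \<in> borel_measurable borel"
  shows "(\<integral>\<^sup>+x. f (x + c) \<partial>lborel) = (\<integral>\<^sup>+x. f x \<partial>lborel)"
proof -
  have "(\<integral>\<^sup>+x. f x \<partial>lborel) = (\<integral>\<^sup>+x. f x \<partial>distr lborel borel ((+) c))"
    by (simp only: lborel_distr_plus)
  also have "\<dots> = (\<integral>\<^sup>+x. f (x + c) \<partial>lborel)"
    using assms by (subst nn_integral_distr) (auto simp: add.commute)
  finally show ?thesis ..
qed

lemma lborel_shift: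
  fixes f :: "'a::euclidean_space \<Rightarrow> real"
  assumes f: "integrable lborel f"
  shows "integrable lborel (\<lambda>x. f (x + c))" "(LINT x|lborel. f (x + c)) = (LINT x|lborel. f x)"
proof -
  have m: "f \<in> borel_measurable borel"
    using borel_measurable_integrable[OF f] by simp
  have "integrable (distr lborel borel ((+) c)) f"
    using f by (simp only: lborel_distr_plus)
  then show "integrable lborel (\<lambda>x. f (x + c))"
    using m by (subst (asm) integrable_distr_eq) (auto simp: add.commute)
  have "(LINT x|lborel. f x) = (LINT x|distr lborel borel ((+) c). f x)"
    by (simp only: lborel_distr_plus)
  also have "\<dots> = (LINT x|lborel. f (x + c))"
    using m by (subst integral_distr) (auto simp: add.commute)
  finally show "(LINT x|lborel. f (x + c)) = (LINT x|lborel. f x)" ..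
qed

lemma Ckc_bounded:
  fixes f :: "'a::euclidean_space \<Rightarrow> 'b::real_normed_vector"
  assumes "f \<in> Ckc 1 A"
  obtains B where "\<And>x. norm (f x) \<le> B" "B \<ge> 0"
proof -
  let ?K = "closure {x. f x \<noteq> 0}"
  have "compact (f ` ?K)"
    using assms by (intro compact_continuous_image Ck_1_continuous CkcD)
  then obtain B where B: "\<forall>x\<in>?K. norm (f x) \<le> B"
    using compact_imp_bounded[of "f ` ?K"] by (auto simp: bounded_iff)
  have "norm (f x) \<le> \<bar>B\<bar>" for x
    using B closure_subset[of "{x. f x \<noteq> 0}"] by (cases "f x = 0") force+
  then show thesis
    using that[of "\<bar>B\<bar>"] by simp
qed

lemma Ckc_integrable:
  fixes f :: "'a::euclidean_space \<Rightarrow> real"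
  assumes "f \<in> Ckc 1 A"
  shows "integrable lborel f"
proof -
  obtain B where B: "\<And>x. norm (f x) \<le> B" "B \<ge> 0"
    using Ckc_bounded[OF assms] by blast
  let ?K = "closure {x. f x \<noteq> 0}"
  have m: "f \<in> borel_measurable lborel"
    using borel_measurable_continuous_onI[OF Ck_1_continuous[OF CkcD(1)[OF assms]]] by simp
  have le: "norm (f x) \<le> norm (B * indicator ?K x)" for x
    using B(1)[of x] B(2) closure_subset[of "{x. f x \<noteq> 0}"]
    by (cases "f x = 0") (auto simp: indicator_def)
  have "integrable lborel (\<lambda>x. B * indicator ?K x)"
    using CkcD(2)[OF assms] emeasure_compact_finite[OF CkcD(2)[OF assms]]
    by (intro integrable_mult_right integrable_real_indicator) (auto intro: borel_compact)
  then show ?thesis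
    by (rule Bochner_Integration.integrable_bound[OF _ m AE_I2[OF le]])
qed

text \<open>Averaging f over the segment from x - y to x turns the difference f x - f (x - y) into a
  derivative in direction y, by the fundamental theorem of calculus. The average keeps the sup bound
  of f.\<close>

lemma segment_average:
  fixes f :: "'a::euclidean_space \<Rightarrow> real" and y :: 'a
  assumes f: "Ck 1 f"
  defines "g \<equiv> \<lambda>x. integral {0..1} (\<lambda>s. f (x - s *\<^sub>R y))"
  shows "Ck 1 g" and "\<exists>g'. (g has_derivative g') (at x) \<and> g' y = f x - f (x - y)"
proof -
  \<comment> \<open>Differentiation under the integral wants a continuous family of bounded
    operators; in finite dimension continuity on basis vectors gives it.\<close>
  define D where "D z = Blinfun (frechet_derivative f (at z))" for z
  have D: "blinfun_apply (D z) = frechet_derivative f (at z)" for z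
    unfolding D_def using Ck_1D(1)[OF f] by (intro bounded_linear_Blinfun_apply has_derivative_bounded_linear)
  have fD: "(f has_derivative blinfun_apply (D z)) (at z)" for z
    unfolding D using Ck_1D(1)[OF f] .
  have contD: "continuous_on UNIV D"
    by (rule continuous_on_blinfun_componentwise) (auto simp: D intro: Ck_1D(2)[OF f])
  have contD2: "continuous_on S (\<lambda>w. D (fst w - snd w *\<^sub>R y))" for S
    by (rule continuous_on_compose2[OF contD]) (auto intro!: continuous_intros)
  have "((\<lambda>x. integral (cbox 0 1) (\<lambda>s. f (x - s *\<^sub>R y))) has_derivative
      blinfun_apply (integral (cbox 0 1) (\<lambda>s. D (x - s *\<^sub>R y)))) (at x within UNIV)" for x
  proof (rule leibniz_rule)
    fix x s
    have "((\<lambda>x. x - s *\<^sub>R y) has_derivative (\<lambda>h. h)) (at x)"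
      by (auto intro!: derivative_eq_intros)
    from has_derivative_compose[OF this fD]
    show "((\<lambda>x. f (x - s *\<^sub>R y)) has_derivative blinfun_apply (D (x - s *\<^sub>R y))) (at x within UNIV)"
      by simp
  next
    fix x
    show "(\<lambda>s. f (x - s *\<^sub>R y)) integrable_on cbox 0 1"
      by (intro integrable_continuous continuous_on_compose2[OF Ck_1_continuous[OF f, of UNIV]] continuous_intros) auto
  next
    show "continuous_on (UNIV \<times> cbox 0 1) (\<lambda>(x, s). D (x - s *\<^sub>R y))"
      using contD2 by (simp add: case_prod_unfold)
  qed auto
  then have gD: "(g has_derivative blinfun_apply (integral {0..1} (\<lambda>s. D (x - s *\<^sub>R y)))) (at x)" for x
    by (simp add: g_def)
  have contx: "continuous_on {0..1} (\<lambda>s. D (x - s *\<^sub>R y))" for x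
    by (rule continuous_on_compose2[OF contD]) (auto intro!: continuous_intros)
  have appl: "blinfun_apply (integral {0..1} (\<lambda>s. D (x - s *\<^sub>R y))) h
      = integral {0..1} (\<lambda>s. frechet_derivative f (at (x - s *\<^sub>R y)) h)" for x h
    using integrable_continuous_real[OF contx]
    by (subst blinfun_apply_integral) (auto simp: D)
  have contint: "continuous_on UNIV (\<lambda>x. integral {0..1} (\<lambda>s. D (x - s *\<^sub>R y)))"
    using integral_continuous_on_param[of UNIV "0::real" 1 "\<lambda>x s. D (x - s *\<^sub>R y)"] contD2
    by (simp add: case_prod_unfold)
  show "Ck 1 g"
    by (rule Ck_1I[OF gD]) (intro continuous_intros contint)
  show "\<exists>g'. (g has_derivative g') (at x) \<and> g' y = f x - f (x - y)"
  proof (intro exI conjI)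
    show "(g has_derivative blinfun_apply (integral {0..1} (\<lambda>s. D (x - s *\<^sub>R y)))) (at x)"
      by (rule gD)
    have "((\<lambda>s. frechet_derivative f (at (x - s *\<^sub>R y)) y) has_integral
        (- f (x - 1 *\<^sub>R y)) - (- f (x - 0 *\<^sub>R y))) {0..1}"
    proof (rule fundamental_theorem_of_calculus)
      fix s :: real
      have "((\<lambda>s. x - s *\<^sub>R y) has_derivative (\<lambda>h. - h *\<^sub>R y)) (at s within {0..1})"
        by (auto intro!: derivative_eq_intros)
      from has_derivative_minus[OF has_derivative_compose[OF this Ck_1D(1)[OF f]]]
      show "((\<lambda>s. - f (x - s *\<^sub>R y)) has_vector_derivative
          frechet_derivative f (at (x - s *\<^sub>R y)) y) (at s within {0..1})"
        using linear_cmul[OF has_derivative_linear[OF Ck_1D(1)[OF f]], of "x - s *\<^sub>R y"]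
          linear_neg[OF has_derivative_linear[OF Ck_1D(1)[OF f]], of "x - s *\<^sub>R y"]
        by (simp add: has_vector_derivative_def)
    qed simp
    then show "blinfun_apply (integral {0..1} (\<lambda>s. D (x - s *\<^sub>R y))) y = f x - f (x - y)"
      unfolding appl by (simp add: has_integral_iff)
  qed
qed

text \<open>Shifting the integral moves the difference from v to f: the left side is the integral of
  v x * (f (x - y) - f x). The last factor is norm y times the divergence of F, the segment average
  of f times the unit vector -y / norm y, and F is a competitor for the variation of v in A.\<close>

lemma translation_duality:
  fixes v :: "'a::euclidean_space \<Rightarrow> real"
  assumes v: "v \<in> borel_measurable borel" "set_integrable lborel A v"
    and K: "\<And>x s. x \<in> K \<Longrightarrow> s \<in> {0..1} \<Longrightarrow> x + s *\<^sub>R y \<in> A"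
    and f: "f \<in> Ckc 1 K" "\<And>x. \<bar>f x\<bar> \<le> 1"
  shows "ennreal (LINT x:K|lborel. (v (x + y) - v x) * f x) \<le> ennreal (norm y) * total_variation v A"
proof (cases "y = 0")
  case True
  then show ?thesis by (simp add: set_lebesgue_integral_def)
next
  case False
  let ?S = "closure {x. f x \<noteq> 0}"
  define g where "g x = integral {0..1} (\<lambda>s. f (x - s *\<^sub>R y))" for x
  define F where "F x = g x *\<^sub>R (- inverse (norm y) *\<^sub>R y)" for x
  have C1f: "Ck 1 f" using CkcD(1)[OF f(1)] .
  have contf: "continuous_on {0..1} (\<lambda>s. f (x - s *\<^sub>R y))" for x
    by (intro continuous_on_compose2[OF Ck_1_continuous[OF C1f, of UNIV]] continuous_intros) auto
  have g1: "\<bar>g x\<bar> \<le> 1" for x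
  proof -
    have "norm (integral {0..1} (\<lambda>s. f (x - s *\<^sub>R y))) \<le> 1 * (1 - 0)"
      using f(2) by (intro integral_bound contf) auto
    then show ?thesis by (simp add: g_def)
  qed
  have C1g: "Ck 1 g" and g': "\<exists>g'. (g has_derivative g') (at x) \<and> g' y = f x - f (x - y)" for x
    using segment_average[OF C1f, of y] unfolding g_def[abs_def] by auto
  have C1F: "Ck 1 F"
    unfolding F_def by (intro Ck_1_scaleR C1g Ck_1_const)
  have divF: "norm y * diverg F x = f (x - y) - f x" for x
  proof -
    obtain g' where g': "(g has_derivative g') (at x)" "g' y = f x - f (x - y)"
      using g' by blast
    have "diverg F x = g' (- inverse (norm y) *\<^sub>R y)"
      unfolding F_def by (rule diverg_scaleR_const[OF g'(1)])
    also have "\<dots> = - inverse (norm y) * g' y"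
      using linear_cmul[OF has_derivative_linear[OF g'(1)], of "- inverse (norm y)" y] by simp
    finally show ?thesis using g'(2) False by (simp add: mult.assoc[symmetric])
  qed
  \<comment> \<open>The support of F lies in the set swept by the support of f along y. It is
    compact, and the assumption on K puts it inside A.\<close>
  let ?L = "(\<lambda>(z, s). z + s *\<^sub>R y) ` (?S \<times> {0..1})"
  have Fc: "F \<in> Ckc 1 A"
  proof (rule Ckc_supportI[OF C1F])
    have "continuous_on (?S \<times> {0..1}) (\<lambda>(z, s). z + s *\<^sub>R y)"
      unfolding case_prod_unfold by (intro continuous_intros)
    then show "compact ?L"
      by (rule compact_continuous_image) (intro compact_Times CkcD(2)[OF f(1)] compact_Icc)
    show "?L \<subseteq> A"
    proof (clarsimp)
      fix z and s :: real assume "z \<in> ?S" "0 \<le> s" "s \<le> 1"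
      moreover have "z \<in> K" using \<open>z \<in> ?S\<close> CkcD(3)[OF f(1)] by blast
      ultimately show "z + s *\<^sub>R y \<in> A" by (intro K) auto
    qed
    show "{x. F x \<noteq> 0} \<subseteq> ?L"
    proof
      fix x assume "x \<in> {x. F x \<noteq> 0}"
      then have "g x \<noteq> 0" by (auto simp: F_def)
      then have "\<exists>s\<in>{0..1}. f (x - s *\<^sub>R y) \<noteq> 0"
      proof (rule contrapos_np)
        assume "\<not> (\<exists>s\<in>{0..1}. f (x - s *\<^sub>R y) \<noteq> 0)"
        then have "g x = integral {0..1} (\<lambda>s::real. 0)"
          unfolding g_def by (intro Henstock_Kurzweil_Integration.integral_cong) auto
        then show "g x = 0" by simp
      qed
      then obtain s where s: "s \<in> {0..1}" "f (x - s *\<^sub>R y) \<noteq> 0" by blast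
      then have "x - s *\<^sub>R y \<in> ?S"
        using closure_subset[of "{x. f x \<noteq> 0}"] by auto
      then show "x \<in> ?L"
        by (intro image_eqI[of x _ "(x - s *\<^sub>R y, s)"]) (use s in simp_all)
    qed
  qed
  have F1: "norm (F x) \<le> 1" for x
    using g1[of x] False by (simp add: F_def abs_mult mult.assoc)
  obtain B where B: "\<And>x. norm (f x) \<le> B" "B \<ge> 0"
    using Ckc_bounded[OF f(1)] by blast
  have mf: "f \<in> borel_measurable borel"
    by (intro borel_measurable_continuous_onI Ck_1_continuous C1f)
  let ?v = "\<lambda>x. indicator A x * v x"
  have vi: "integrable lborel ?v"
    using v(2) by (simp add: set_integrable_def)
  have ii: "integrable lborel (\<lambda>x. ?v x * f (x - c))" for c
  proof (rule Bochner_Integration.integrable_bound[of lborel "\<lambda>x. B * ?v x"])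
    show "(\<lambda>x. ?v x * f (x - c)) \<in> borel_measurable lborel"
      using borel_measurable_integrable[OF vi] mf by measurable
    show "AE x in lborel. norm (?v x * f (x - c)) \<le> norm (B * ?v x)"
      using B by (intro AE_I2) (auto simp: abs_mult mult.commute intro!: mult_right_mono)
  qed (use vi in simp)
  have shift: "(LINT x|lborel. ?v x * f (x - y)) = (LINT x|lborel. ?v (x + y) * f x)"
    and shifti: "integrable lborel (\<lambda>x. ?v (x + y) * f x)"
    using lborel_shift[OF ii[of y], of y] by simp_all
  have supp: "x \<in> K" if "f x \<noteq> 0" for x
    using that CkcD(3)[OF f(1)] closure_subset[of "{x. f x \<noteq> 0}"] by blast
  have "(LINT x:K|lborel. (v (x + y) - v x) * f x) = (LINT x|lborel. ?v (x + y) * f x - ?v x * f x)"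
    unfolding set_lebesgue_integral_def
  proof (rule Bochner_Integration.integral_cong)
    fix x
    show "indicator K x *\<^sub>R ((v (x + y) - v x) * f x) = ?v (x + y) * f x - ?v x * f x"
      using supp[of x] K[of x 1] K[of x 0] by (cases "f x = 0") (auto simp: algebra_simps)
  qed simp
  also have "\<dots> = (LINT x|lborel. ?v (x + y) * f x) - (LINT x|lborel. ?v x * f x)"
    using shifti ii[of 0] by (intro Bochner_Integration.integral_diff) auto
  also have "\<dots> = (LINT x|lborel. ?v x * f (x - y) - ?v x * f x)"
    unfolding shift[symmetric] using ii[of y] ii[of 0]
    by (intro Bochner_Integration.integral_diff[symmetric]) auto
  also have "\<dots> = (LINT x|lborel. norm y * (?v x * diverg F x))"
  proof -
    have "?v x * f (x - y) - ?v x * f x = norm y * (?v x * diverg F x)" for x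
      using divF[of x] by (metis mult.left_commute right_diff_distrib)
    then show ?thesis by simp
  qed
  also have "\<dots> = norm y * (LINT x|lborel. indicator A x *\<^sub>R (v x * diverg F x))"
    by (simp add: mult.assoc)
  also have "(LINT x|lborel. indicator A x *\<^sub>R (v x * diverg F x)) = (LINT x:A|lebesgue. v x * diverg F x)"
  proof -
    have "(\<lambda>x. indicator A x *\<^sub>R (v x * diverg F x)) \<in> borel_measurable lborel"
      using borel_measurable_integrable[OF vi] borel_measurable_diverg[OF C1F]
      by (simp add: mult.assoc[symmetric])
    then show ?thesis
      unfolding set_lebesgue_integral_def by (simp add: integral_completion)
  qed
  finally have "ennreal (LINT x:K|lborel. (v (x + y) - v x) * f x)
      = ennreal (norm y) * ennreal (LINT x:A|lebesgue. v x * diverg F x)"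
    by (simp add: ennreal_mult')
  also have "\<dots> \<le> ennreal (norm y) * total_variation v A"
    by (intro mult_left_mono total_variation_upper Fc F1) auto
  finally show ?thesis .
qed

text \<open>The ideal test function sign g is not C1. By inner regularity of the finite measure with
  density |g| it is replaced by a C1 function equal to 1 and -1 on compact parts of the two sign
  sets that carry nearly all the mass.\<close>

lemma nn_integral_abs_duality:
  fixes g :: "'a::euclidean_space \<Rightarrow> real"
  assumes K: "open K" and g: "g \<in> borel_measurable borel" "set_integrable lborel K g"
    and C: "\<And>f. f \<in> Ckc 1 K \<Longrightarrow> (\<And>x. \<bar>f x\<bar> \<le> 1) \<Longrightarrow> ennreal (LINT x:K|lborel. g x * f x) \<le> C"
  shows "(\<integral>\<^sup>+x\<in>K. ennreal \<bar>g x\<bar> \<partial>lborel) \<le> C"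
proof -
  let ?w = "\<lambda>x. \<bar>g x\<bar> * indicator K x"
  have Kb [measurable]: "K \<in> sets borel" using K by simp
  note g(1)[measurable]
  have wi: "integrable lborel ?w"
    using g(2) unfolding set_integrable_def
    by (rule Bochner_Integration.integrable_bound) (auto simp: indicator_def)
  define M where "M = density lborel (\<lambda>x. ennreal (?w x))"
  have sM: "sets M = sets borel" by (simp add: M_def)
  have emM: "emeasure M B = ennreal (LINT x:B|lborel. ?w x)"
    and intB: "set_integrable lborel B ?w" if [measurable]: "B \<in> sets borel" for B
  proof -
    show int: "set_integrable lborel B ?w"
      unfolding set_integrable_def using wi by (intro integrable_mult_indicator) auto
    have "emeasure M B = (\<integral>\<^sup>+x. ennreal (indicator B x *\<^sub>R ?w x) \<partial>lborel)"
      unfolding M_def by (subst emeasure_density) (auto simp: indicator_def intro!: nn_integral_cong)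
    also have "\<dots> = ennreal (LINT x:B|lborel. ?w x)"
      unfolding set_lebesgue_integral_def using int
      by (intro nn_integral_eq_integral) (auto simp: set_integrable_def)
    finally show "emeasure M B = ennreal (LINT x:B|lborel. ?w x)" .
  qed
  have finM: "emeasure M (space M) \<noteq> \<infinity>"
    using emM[of UNIV] by (simp add: M_def)
  interpret M: finite_measure M by (rule finite_measureI) (use finM in simp)
  have inner: "\<exists>D. D \<subseteq> B \<and> compact D \<and> measure M B < measure M D + e"
    if "B \<in> sets borel" "e > 0" for B and e :: real
  proof (cases "measure M B < e")
    case True
    then show ?thesis by (intro exI[of _ "{}"]) auto
  next
    case False
    have "ennreal (measure M B - e) < emeasure M B"
      using False that(2) by (simp add: M.emeasure_eq_measure ennreal_less_iff)
    also have "emeasure M B = (SUP D\<in>{D. D \<subseteq> B \<and> compact D}. emeasure M D)"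
      by (rule inner_regular[OF sM finM that(1)])
    finally obtain D where D: "D \<subseteq> B" "compact D" "ennreal (measure M B - e) < emeasure M D"
      unfolding less_SUP_iff by blast
    then have "measure M B - e < measure M D"
      using False by (simp add: M.emeasure_eq_measure ennreal_less_iff)
    then show ?thesis using D by (intro exI[of _ D]) auto
  qed
  \<comment> \<open>Each compact set loses less than e of its sign set. The losses count twice in 2
    M(D1) + 2 M(D2) - M(K), which makes 4 e.\<close>
  have bound: "ennreal (measure M K - 4 * e) \<le> C" if e: "e > 0" for e :: real
  proof -
    let ?P = "{x\<in>K. g x > 0}" and ?N = "{x\<in>K. g x < 0}" and ?Z = "{x\<in>K. g x = 0}"
    have Pm [measurable]: "?P \<in> sets borel" and Nm [measurable]: "?N \<in> sets borel" and "?Z \<in> sets borel"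
      by measurable
    obtain D1 where D1: "D1 \<subseteq> ?P" "compact D1" "measure M ?P < measure M D1 + e"
      using inner[OF Pm e] by blast
    obtain D2 where D2: "D2 \<subseteq> ?N" "compact D2" "measure M ?N < measure M D2 + e"
      using inner[OF Nm e] by blast
    have D12: "D1 \<inter> D2 = {}" using D1 D2 by force
    obtain U V where UV: "open U" "open V" "D1 \<subseteq> U" "D2 \<subseteq> V" "U \<inter> V = {}"
      using separation_normal[OF compact_imp_closed[OF D1(2)] compact_imp_closed[OF D2(2)] D12] by metis
    obtain h1 where h1: "h1 \<in> Ckc 1 (K \<inter> U)" "\<And>x. 0 \<le> h1 x" "\<And>x. h1 x \<le> (1::real)"
        "\<exists>W. open W \<and> D1 \<subseteq> W \<and> (\<forall>x\<in>W. h1 x = 1)"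
      using C1_Urysohn[OF D1(2), of "K \<inter> U"] D1(1) UV K by blast
    obtain h2 where h2: "h2 \<in> Ckc 1 (K \<inter> V)" "\<And>x. 0 \<le> h2 x" "\<And>x. h2 x \<le> (1::real)"
        "\<exists>W. open W \<and> D2 \<subseteq> W \<and> (\<forall>x\<in>W. h2 x = 1)"
      using C1_Urysohn[OF D2(2), of "K \<inter> V"] D2(1) UV K by blast
    define f where "f x = h1 x - h2 x" for x
    have fc: "f \<in> Ckc 1 K"
    proof (rule Ckc_supportI)
      show "Ck 1 f" unfolding f_def by (intro Ck_1_diff CkcD(1)[OF h1(1)] CkcD(1)[OF h2(1)])
      show "compact (closure {x. h1 x \<noteq> 0} \<union> closure {x. h2 x \<noteq> 0})"
        by (intro compact_Un CkcD(2)[OF h1(1)] CkcD(2)[OF h2(1)])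
      show "closure {x. h1 x \<noteq> 0} \<union> closure {x. h2 x \<noteq> 0} \<subseteq> K"
        using CkcD(3)[OF h1(1)] CkcD(3)[OF h2(1)] by blast
      show "{x. f x \<noteq> 0} \<subseteq> closure {x. h1 x \<noteq> 0} \<union> closure {x. h2 x \<noteq> 0}"
      proof
        fix x assume "x \<in> {x. f x \<noteq> 0}"
        then have "h1 x \<noteq> 0 \<or> h2 x \<noteq> 0" by (auto simp: f_def)
        then show "x \<in> closure {x. h1 x \<noteq> 0} \<union> closure {x. h2 x \<noteq> 0}"
          using closure_subset[of "{x. h1 x \<noteq> 0}"] closure_subset[of "{x. h2 x \<noteq> 0}"] by blast
      qed
    qed
    have f1: "\<bar>f x\<bar> \<le> 1" for x
      unfolding f_def using h1(2,3)[of x] h2(2,3)[of x] by linarith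
    have s1: "h1 x = 0" if "x \<notin> U" for x
      using that CkcD(3)[OF h1(1)] closure_subset[of "{x. h1 x \<noteq> 0}"] by blast
    have s2: "h2 x = 0" if "x \<notin> V" for x
      using that CkcD(3)[OF h2(1)] closure_subset[of "{x. h2 x \<noteq> 0}"] by blast
    have fD1: "f x = 1" if "x \<in> D1" for x
    proof -
      have "x \<notin> V" using that UV by blast
      then show ?thesis using h1(4) that s2[of x] by (auto simp: f_def)
    qed
    have fD2: "f x = -1" if "x \<in> D2" for x
    proof -
      have "x \<notin> U" using that UV by blast
      then show ?thesis using h2(4) that s1[of x] by (auto simp: f_def)
    qed
    have mf [measurable]: "f \<in> borel_measurable borel"
      by (intro borel_measurable_continuous_onI Ck_1_continuous CkcD(1)[OF fc])
    have Db [measurable]: "D1 \<in> sets borel" "D2 \<in> sets borel"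
      using D1 D2 by (auto intro: borel_compact)
    have i1: "set_integrable lborel D1 ?w" and i2: "set_integrable lborel D2 ?w"
      using intB Db by auto
    have mD: "measure M B = (LINT x:B|lborel. ?w x)" if "B \<in> sets borel" for B
      unfolding measure_def emM[OF that] set_lebesgue_integral_def
      by (intro enn2real_ennreal Bochner_Integration.integral_nonneg) auto
    define a b where "a x = indicator D1 x *\<^sub>R ?w x" and "b x = indicator D2 x *\<^sub>R ?w x" for x
    define w where "w x = ?w x" for x
    have abi: "integrable lborel a" "integrable lborel b" "integrable lborel w"
      using i1 i2 wi by (simp_all add: a_def[abs_def] b_def[abs_def] w_def[abs_def] set_integrable_def)
    have mab: "measure M D1 = integral\<^sup>L lborel a" "measure M D2 = integral\<^sup>L lborel b"
      using mD[OF Db(1)] mD[OF Db(2)] by (simp_all add: a_def[abs_def] b_def[abs_def] set_lebesgue_integral_def)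
    have "(\<lambda>x. indicator K x *\<^sub>R ?w x) = w"
      by (auto simp: w_def indicator_def)
    then have mK: "measure M K = integral\<^sup>L lborel w"
      using mD[OF Kb] by (simp only: set_lebesgue_integral_def)
    have "2 * measure M D1 + 2 * measure M D2 - measure M K
        = (LINT x|lborel. 2 * a x + 2 * b x - w x)"
      unfolding mab mK using abi by simp
    \<comment> \<open>On D1 and D2 the product g f is |g|; elsewhere in K it is at least -|g|. Both
      cases are 2 a + 2 b - w.\<close>
    also have "\<dots> \<le> (LINT x|lborel. indicator K x *\<^sub>R (g x * f x))"
    proof (rule integral_mono)
      show "integrable lborel (\<lambda>x. 2 * a x + 2 * b x - w x)"
        using abi by simp
      have gf: "\<bar>g x * f x\<bar> \<le> \<bar>g x\<bar>" for x
        using mult_left_mono[OF f1[of x], of "\<bar>g x\<bar>"] by (simp add: abs_mult)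
      show "integrable lborel (\<lambda>x. indicator K x *\<^sub>R (g x * f x))"
      proof (rule Bochner_Integration.integrable_bound[OF wi])
        show "AE x in lborel. norm (indicator K x *\<^sub>R (g x * f x)) \<le> norm (\<bar>g x\<bar> * indicator K x)"
          using gf by (intro AE_I2) (simp add: indicator_def)
      qed measurable
      fix x
      have "x \<in> D1 \<Longrightarrow> x \<notin> D2 \<and> x \<in> K \<and> g x > 0" "x \<in> D2 \<Longrightarrow> x \<notin> D1 \<and> x \<in> K \<and> g x < 0"
        using D1(1) D2(1) D12 by auto
      then show "2 * a x + 2 * b x - w x \<le> indicator K x *\<^sub>R (g x * f x)"
        using fD1[of x] fD2[of x] gf[of x] unfolding a_def b_def w_def indicator_def by auto
    qed
    finally have "2 * measure M D1 + 2 * measure M D2 - measure M K \<le> (LINT x:K|lborel. g x * f x)"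
      unfolding set_lebesgue_integral_def .
    moreover have "measure M K \<le> measure M ?P + measure M ?N"
    proof -
      have "measure M ?Z = 0"
        unfolding mD[OF \<open>?Z \<in> sets borel\<close>] set_lebesgue_integral_def
        by (rule integral_eq_zero_AE) (auto simp: indicator_def)
      moreover have "measure M K = measure M ((?P \<union> ?N) \<union> ?Z)"
        by (rule arg_cong[of K]) auto
      moreover have "measure M ((?P \<union> ?N) \<union> ?Z) \<le> measure M (?P \<union> ?N) + measure M ?Z"
        by (intro measure_Un_le) (auto simp: sM)
      moreover have "measure M (?P \<union> ?N) \<le> measure M ?P + measure M ?N"
        by (intro measure_Un_le) (auto simp: sM)
      ultimately show ?thesis by linarith
    qed
    ultimately have "measure M K - 4 * e \<le> (LINT x:K|lborel. g x * f x)"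
      using D1(3) D2(3) by linarith
    then have "ennreal (measure M K - 4 * e) \<le> ennreal (LINT x:K|lborel. g x * f x)"
      by (rule ennreal_leI)
    also have "\<dots> \<le> C" by (rule C[OF fc f1])
    finally show ?thesis .
  qed
  have "(\<integral>\<^sup>+x\<in>K. ennreal \<bar>g x\<bar> \<partial>lborel) = emeasure M K"
    unfolding M_def by (subst emeasure_density) (auto simp: indicator_def intro!: nn_integral_cong)
  also have "\<dots> = ennreal (measure M K)"
    by (simp add: M.emeasure_eq_measure)
  also have "\<dots> \<le> C"
  proof (rule ennreal_le_epsilon)
    fix e :: real assume e: "0 < e"
    have "ennreal (measure M K) = ennreal ((measure M K - 4 * (e / 4)) + e)" by simp
    also have "\<dots> \<le> ennreal (measure M K - 4 * (e / 4)) + ennreal e" by (rule ennreal_add_le)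
    also have "\<dots> \<le> C + ennreal e" using bound[of "e / 4"] e by (intro add_right_mono) auto
    finally show "ennreal (measure M K) \<le> C + ennreal e" .
  qed
  finally show ?thesis .
qed

lemma nn_integral_translation_le:
  fixes v :: "'a::euclidean_space \<Rightarrow> real"
  assumes v: "v \<in> borel_measurable borel" "set_integrable lborel A v"
    and K: "open K" "\<And>x s. x \<in> K \<Longrightarrow> s \<in> {0..1} \<Longrightarrow> x + s *\<^sub>R y \<in> A"
  shows "(\<integral>\<^sup>+x\<in>K. ennreal \<bar>v (x + y) - v x\<bar> \<partial>lborel) \<le> ennreal (norm y) * total_variation v A"
proof (rule nn_integral_abs_duality[OF K(1)])
  note v(1)[measurable]
  have [measurable]: "K \<in> sets borel" using K(1) by simp
  show "(\<lambda>x. v (x + y) - v x) \<in> borel_measurable borel" by measurable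
  let ?v = "\<lambda>x. indicator A x * v x"
  have vi: "integrable lborel ?v"
    using v(2) by (simp add: set_integrable_def)
  have "integrable lborel (\<lambda>x. indicator K x *\<^sub>R (?v (x + y) - ?v x))"
    using lborel_shift(1)[OF vi, of y] vi by (intro integrable_mult_indicator) auto
  moreover have "(\<lambda>x. indicator K x *\<^sub>R (?v (x + y) - ?v x)) = (\<lambda>x. indicator K x *\<^sub>R (v (x + y) - v x))"
    using K(2)[of _ 0] K(2)[of _ 1] by (auto simp: indicator_def fun_eq_iff)
  ultimately show "set_integrable lborel K (\<lambda>x. v (x + y) - v x)"
    by (simp only: set_integrable_def)
qed (rule translation_duality[OF v K(2)], auto)

section \<open>Level sets and means of functions of bounded variation\<close>

lemma emeasure_lborel_ball_finite:
  "emeasure lborel (ball c r) < top" "emeasure lborel (cball c r) < top"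
  using emeasure_bounded_finite[OF bounded_ball, of c r] emeasure_bounded_finite[OF bounded_cball, of c r] by simp_all

lemma dist_add_le: "dist c (x + z) \<le> dist c x + norm z"
  for c :: "'a::euclidean_space"
  by norm

text \<open>The integral of f (x + b) - f x is 0 by translation invariance. Writing the difference
  as the integral of the derivative along the segment and exchanging integrals, every parameter s
  contributes the same integral of the derivative.\<close>

lemma integral_directional_derivative_eq_0:
  fixes f :: "'a::euclidean_space \<Rightarrow> real"
  assumes f: "f \<in> Ckc 1 A" and b: "b \<in> Basis"
  shows "integrable lborel (\<lambda>x. frechet_derivative f (at x) b)"
    and "(LINT x|lborel. frechet_derivative f (at x) b) = 0"
proof -
  let ?D = "\<lambda>x. frechet_derivative f (at x) b"
  let ?K = "closure {x. f x \<noteq> 0}"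
  note C1 = CkcD(1)[OF f]
  have cont: "continuous_on S ?D" for S
    using Ck_1D(2)[OF C1 b] continuous_on_subset by blast
  have mD [measurable]: "?D \<in> borel_measurable borel"
    by (intro borel_measurable_continuous_onI cont)
  have D0: "?D x = 0" if "x \<notin> ?K" for x
    using that by (simp add: frechet_derivative_at[OF has_derivative_0_outside_support, symmetric])
  have "compact (?D ` ?K)"
    by (intro compact_continuous_image cont CkcD(2)[OF f])
  then obtain B where B: "\<forall>x\<in>?K. norm (?D x) \<le> B"
    using compact_imp_bounded[of "?D ` ?K"] by (auto simp: bounded_iff)
  obtain R where R: "\<forall>x\<in>?K. norm x \<le> R"
    using compact_imp_bounded[OF CkcD(2)[OF f]] by (auto simp: bounded_iff)
  have le: "\<bar>?D x\<bar> \<le> \<bar>B\<bar> * indicator (cball 0 R) x" for x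
    using D0[of x] B R by (cases "x \<in> ?K") (auto simp: indicator_def)
  show Di: "integrable lborel ?D"
  proof (rule Bochner_Integration.integrable_bound)
    show "integrable lborel (\<lambda>x::'a. \<bar>B\<bar> * indicator (cball 0 R) x)"
      by (intro integrable_mult_right integrable_real_indicator) (auto simp: emeasure_lborel_ball_finite)
    show "AE x in lborel. norm (?D x) \<le> norm (\<bar>B\<bar> * indicator (cball 0 R) x)"
      using le by (intro AE_I2) (simp add: abs_mult)
  qed measurable
  let ?G = "\<lambda>x s. indicator {0..1::real} s * ?D (x + s *\<^sub>R b)"
  \<comment> \<open>Room for shifts s b with s in [0, 1], since b is a unit vector.\<close>
  let ?R = "R + 1"
  have Gi: "integrable (lborel \<Otimes>\<^sub>M lborel) (case_prod ?G)"
  proof (rule Bochner_Integration.integrable_bound)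
    have "emeasure lborel (cball 0 ?R \<times> {0..1} :: ('a \<times> real) set) < \<infinity>"
      by (intro emeasure_compact_finite compact_Times compact_cball compact_Icc)
    then show "integrable (lborel \<Otimes>\<^sub>M lborel) (\<lambda>w :: 'a \<times> real. \<bar>B\<bar> * indicator (cball 0 ?R \<times> {0..1}) w)"
      unfolding lborel_prod
      by (intro integrable_mult_right integrable_real_indicator) (auto intro!: borel_closed closed_Times)
    show "case_prod ?G \<in> borel_measurable (lborel \<Otimes>\<^sub>M lborel)"
      by measurable
    have "norm (?G x s) \<le> \<bar>B\<bar> * indicator (cball 0 ?R \<times> {0..1}) (x, s)" for x s
    proof (cases "s \<in> {0..1} \<and> x + s *\<^sub>R b \<in> cball 0 R")
      case True
      have "norm x \<le> norm (x + s *\<^sub>R b) + norm (s *\<^sub>R b)"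
        using norm_triangle_ineq4[of "x + s *\<^sub>R b" "s *\<^sub>R b"] by simp
      then have "x \<in> cball 0 ?R" using True b by simp
      then show ?thesis using True le[of "x + s *\<^sub>R b"] by (simp add: indicator_def)
    next
      case False
      then have "?G x s = 0" using le[of "x + s *\<^sub>R b"] by (auto simp: indicator_def)
      show ?thesis unfolding \<open>?G x s = 0\<close> by (simp add: indicator_def)
    qed
    then show "AE w in lborel \<Otimes>\<^sub>M lborel. norm (case_prod ?G w)
        \<le> norm (\<bar>B\<bar> * indicator (cball 0 ?R \<times> {0..1}) w)"
      by (intro AE_I2) (auto simp: abs_mult split: prod.split)
  qed
  have "(LINT s|lborel. LINT x|lborel. ?G x s) = (LINT x|lborel. LINT s|lborel. ?G x s)"
    by (rule lborel_pair.Fubini_integral[OF Gi])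
  also have "(LINT x|lborel. LINT s|lborel. ?G x s) = (LINT x|lborel. f (x + b) - f x)"
  proof (rule Bochner_Integration.integral_cong)
    fix x
    have "(LINT s|lborel. indicator {0..1} s *\<^sub>R ?D (x + s *\<^sub>R b)) = f (x + 1 *\<^sub>R b) - f (x + 0 *\<^sub>R b)"
    proof (rule integral_FTC_atLeastAtMost)
      fix s :: real
      have "((\<lambda>s. x + s *\<^sub>R b) has_derivative (\<lambda>h. h *\<^sub>R b)) (at s within {0..1})"
        by (auto intro!: derivative_eq_intros)
      from has_derivative_compose[OF this Ck_1D(1)[OF C1]]
      show "((\<lambda>s. f (x + s *\<^sub>R b)) has_vector_derivative ?D (x + s *\<^sub>R b)) (at s within {0..1})"
        using linear_cmul[OF has_derivative_linear[OF Ck_1D(1)[OF C1]], of "x + s *\<^sub>R b"]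
        by (simp add: has_vector_derivative_def)
    qed (auto intro!: continuous_on_compose2[OF cont[of UNIV]] continuous_intros)
    then show "(LINT s|lborel. ?G x s) = f (x + b) - f x" by simp
  qed simp
  also have "\<dots> = 0"
    using Ckc_integrable[OF f] lborel_shift[OF Ckc_integrable[OF f], of b] by simp
  also have "(LINT s|lborel. LINT x|lborel. ?G x s) = (LINT s|lborel. indicator {0..1::real} s * (LINT x|lborel. ?D x))"
    using lborel_shift(2)[OF Di] by simp
  finally show "(LINT x|lborel. ?D x) = 0"
    by simp
qed

lemma LINT_diverg_eq_0:
  fixes A :: "'a::euclidean_space set"
  assumes f: "f \<in> Ckc 1 A"
  shows "(LINT x:A|lebesgue. diverg f x) = 0"
proof -
  have comp: "(\<lambda>x. f x \<bullet> b) \<in> Ckc 1 A \<and> frechet_derivative f (at x) b \<bullet> b = frechet_derivative (\<lambda>x. f x \<bullet> b) (at x) b"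
    if b: "b \<in> Basis" for b x
  proof
    have d: "((\<lambda>x. f x \<bullet> b) has_derivative (\<lambda>h. frechet_derivative f (at x) h \<bullet> b)) (at x)" for x
      by (intro has_derivative_inner_left Ck_1D(1) CkcD(1)[OF f])
    show "(\<lambda>x. f x \<bullet> b) \<in> Ckc 1 A"
    proof (rule Ckc_supportI)
      show "Ck 1 (\<lambda>x. f x \<bullet> b)"
        by (rule Ck_1I[OF d]) (intro continuous_intros Ck_1D(2) CkcD(1)[OF f]; assumption)
      show "{x. f x \<bullet> b \<noteq> 0} \<subseteq> closure {x. f x \<noteq> 0}"
        using closure_subset[of "{x. f x \<noteq> 0}"] by force
    qed (use CkcD[OF f] in auto)
    show "frechet_derivative f (at x) b \<bullet> b = frechet_derivative (\<lambda>x. f x \<bullet> b) (at x) b"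
      by (simp add: frechet_derivative_at[OF d, symmetric])
  qed
  have "(LINT x:A|lebesgue. diverg f x) = (LINT x:UNIV|lebesgue. diverg f x)"
    using LINT_mult_diverg_cong[OF f, of UNIV "\<lambda>x. 1"] by simp
  also have "\<dots> = (LINT x|lborel. diverg f x)"
    unfolding set_lebesgue_integral_def
    using integral_completion[of "diverg f" lborel] borel_measurable_diverg[OF CkcD(1)[OF f]] by simp
  also have "\<dots> = (LINT x|lborel. (\<Sum>b\<in>Basis. frechet_derivative (\<lambda>x. f x \<bullet> b) (at x) b))"
    unfolding diverg_def using comp by (intro Bochner_Integration.integral_cong sum.cong) auto
  also have "\<dots> = (\<Sum>b\<in>Basis. LINT x|lborel. frechet_derivative (\<lambda>x. f x \<bullet> b) (at x) b)"
    using comp integral_directional_derivative_eq_0(1) by (intro Bochner_Integration.integral_sum) blast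
  also have "\<dots> = 0"
    using comp integral_directional_derivative_eq_0(2) by (intro sum.neutral) blast
  finally show ?thesis .
qed

text \<open>The additive constant integrates to 0 against a divergence with compact support. Used to
  return from a normalised ramp of u to u itself.\<close>

lemma total_variation_affine_le:
  fixes w :: "'a::euclidean_space \<Rightarrow> real"
  assumes w: "set_integrable lebesgue A w" and A: "set_integrable lebesgue A (\<lambda>x. 1 :: real)" and d: "d \<ge> 0"
  shows "total_variation (\<lambda>x. d * w x + l) A \<le> ennreal d * total_variation w A"
proof (rule total_variation_least)
  fix f :: "'a \<Rightarrow> 'a" assume f: "f \<in> Ckc 1 A" "\<And>x. norm (f x) \<le> 1"
  have "(LINT x:A|lebesgue. (d * w x + l) * diverg f x)
      = (LINT x:A|lebesgue. d * (w x * diverg f x) + l * (1 * diverg f x))"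
    by (simp add: algebra_simps)
  also have "\<dots> = d * (LINT x:A|lebesgue. w x * diverg f x) + l * (LINT x:A|lebesgue. diverg f x)"
    using integrable_mult_diverg[OF w f(1)] integrable_mult_diverg[OF A f(1)]
    by (subst set_integral_add(2)) auto
  finally have "(LINT x:A|lebesgue. (d * w x + l) * diverg f x) = d * (LINT x:A|lebesgue. w x * diverg f x)"
    using LINT_diverg_eq_0[OF f(1)] by simp
  then have "ennreal (LINT x:A|lebesgue. (d * w x + l) * diverg f x)
      = ennreal d * ennreal (LINT x:A|lebesgue. w x * diverg f x)"
    using d by (simp add: ennreal_mult')
  also have "\<dots> \<le> ennreal d * total_variation w A"
    by (intro mult_left_mono total_variation_upper f) auto
  finally show "ennreal (LINT x:A|lebesgue. (d * w x + l) * diverg f x) \<le> ennreal d * total_variation w A" .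
qed

lemma total_variation_cong_AE:
  fixes v w :: "'a::euclidean_space \<Rightarrow> real"
  assumes v: "set_borel_measurable lebesgue A v" and w: "set_borel_measurable lebesgue A w"
    and ae: "AE x in lborel. x \<in> A \<longrightarrow> v x = w x"
  shows "total_variation v A = total_variation w A"
proof -
  have "(LINT x:A|lebesgue. v x * diverg f x) = (LINT x:A|lebesgue. w x * diverg f x)"
    if f: "f \<in> Ckc 1 A" for f
    unfolding set_lebesgue_integral_def
  proof (rule integral_cong_AE)
    have m: "diverg f \<in> borel_measurable lebesgue"
      using borel_measurable_diverg[OF CkcD(1)[OF f]] by (simp add: measurable_completion)
    have "(\<lambda>x. (indicator A x *\<^sub>R v x) * diverg f x) \<in> borel_measurable lebesgue"
      "(\<lambda>x. (indicator A x *\<^sub>R w x) * diverg f x) \<in> borel_measurable lebesgue"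
      using v w m unfolding set_borel_measurable_def by (auto intro!: borel_measurable_times)
    then show "(\<lambda>x. indicator A x *\<^sub>R (v x * diverg f x)) \<in> borel_measurable lebesgue"
      "(\<lambda>x. indicator A x *\<^sub>R (w x * diverg f x)) \<in> borel_measurable lebesgue"
      by (simp_all add: mult.assoc)
    show "AE x in lebesgue. indicator A x *\<^sub>R (v x * diverg f x) = indicator A x *\<^sub>R (w x * diverg f x)"
      by (rule AE_completion) (use ae in \<open>auto elim!: eventually_mono simp: indicator_def\<close>)
  qed
  then show ?thesis
    unfolding total_variation_def by (intro SUP_cong) auto
qed

lemma set_borel_measurable_lebesgue:
  fixes w :: "'a::euclidean_space \<Rightarrow> real"
  assumes [measurable]: "w \<in> borel_measurable borel" and A: "open A"
  shows "set_borel_measurable lebesgue A w"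
proof -
  have [measurable]: "A \<in> sets borel" using A by simp
  have "(\<lambda>x. indicator A x *\<^sub>R w x) \<in> borel_measurable borel" by measurable
  then show ?thesis
    unfolding set_borel_measurable_def by (intro measurable_completion) simp
qed

lemma total_variation_borel_representative:
  fixes v w :: "'a::euclidean_space \<Rightarrow> real"
  assumes v: "set_integrable lebesgue E v" and w: "w \<in> borel_measurable borel"
    and A: "open A" "A \<subseteq> E" and ae: "AE x in lborel. x \<in> A \<longrightarrow> v x = w x"
  shows "total_variation v A = total_variation w A"
proof (rule total_variation_cong_AE)
  have "set_integrable lebesgue A v"
    by (rule set_integrable_subset[OF v _ A(2)]) (use A(1) in auto)
  then show "set_borel_measurable lebesgue A v"
    unfolding set_borel_measurable_def set_integrable_def by auto
qed (rule set_borel_measurable_lebesgue[OF w A(1)] ae)+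

lemma total_variation_uminus:
  fixes v :: "'a::euclidean_space \<Rightarrow> real"
  shows "total_variation (\<lambda>x. - v x) A = total_variation v A"
proof -
  have le: "total_variation (\<lambda>x. - w x) A \<le> total_variation w A" for w :: "'a \<Rightarrow> real"
  proof (rule total_variation_least)
    fix f :: "'a \<Rightarrow> 'a" assume f: "f \<in> Ckc 1 A" "\<And>x. norm (f x) \<le> 1"
    have "(\<lambda>x. - f x) \<in> Ckc 1 A"
      using f(1) Ck_1_minus[of f] by (simp add: Ckc_def)
    then have "ennreal (LINT x:A|lebesgue. w x * diverg (\<lambda>x. - f x) x) \<le> total_variation w A"
      using f(2) by (intro total_variation_upper) auto
    then show "ennreal (LINT x:A|lebesgue. - w x * diverg f x) \<le> total_variation w A"
      using diverg_minus[OF CkcD(1)[OF f(1)]] by simp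
  qed
  from le[of v] le[of "\<lambda>x. - v x"] show ?thesis by simp
qed

lemma emeasure_lborel_ball_pos: "r > 0 \<Longrightarrow> emeasure lborel (ball c r) > 0"
  for c :: "'a::euclidean_space"
  by (simp add: emeasure_ball)

text \<open>
  This estimate replaces the Sobolev embedding in the iteration: on the set where v = 1, the mean of
  v over balls of radius r is at most 1/2, because v is small in the mean square.
\<close>

lemma measure_level_set_le_total_variation:
  fixes v :: "'a::euclidean_space \<Rightarrow> real"
  assumes v: "v \<in> borel_measurable borel" "\<And>x. 0 \<le> v x" "\<And>x. v x \<le> 1"
    and r: "0 < r" "s + r \<le> s'"
    and small: "(\<integral>\<^sup>+x\<in>ball c s'. ennreal ((v x)\<^sup>2) \<partial>lborel) \<le> ennreal (1/4) * emeasure lborel (ball (0::'a) r)"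
  shows "emeasure lborel {x\<in>ball c s. v x \<ge> 1} \<le> ennreal (2 * r) * total_variation v (ball c s')"
proof -
  let ?A = "ball c s'" and ?B = "ball (0::'a) r" and ?S = "{x\<in>ball c s. v x \<ge> 1}"
  let ?V = "total_variation v ?A"
  note v(1)[measurable]
  have [measurable]: "?A \<in> sets borel" "?B \<in> sets borel" "ball c s \<in> sets borel" by auto
  have [measurable]: "?S \<in> sets borel" by measurable
  have vi: "set_integrable lborel ?A v"
    unfolding set_integrable_def
    by (rule integrableI_bounded_set_indicator[where B = 1]) (use v in \<open>auto simp: emeasure_lborel_ball_finite\<close>)
  have finS: "emeasure lborel ?S < top"
    using emeasure_lborel_ball_finite(1)[of c s] by (rule le_less_trans[rotated]) (auto intro!: emeasure_mono)
  have finB: "emeasure lborel ?B < top" by (rule emeasure_lborel_ball_finite)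
  have posB: "emeasure lborel ?B > 0" using r by (simp add: emeasure_lborel_ball_pos)
  \<comment> \<open>On \<open>?S\<close> one has 1 \<le> |v (x + y) - v x| + v (x + y). The first
    term is the translation estimate; the second becomes a mean of v once integrated over all shifts
    y in \<open>?B\<close>.\<close>
  have one: "emeasure lborel ?S \<le> ennreal r * ?V + (\<integral>\<^sup>+x\<in>?S. ennreal (v (x + y)) \<partial>lborel)" if y: "y \<in> ?B" for y
  proof -
    have K: "x + t *\<^sub>R y \<in> ?A" if "x \<in> ball c s" "t \<in> {0..1}" for x t
    proof -
      have "norm (t *\<^sub>R y) \<le> 1 * norm y" unfolding norm_scaleR using that by (intro mult_right_mono) auto
      then have "norm (t *\<^sub>R y) < r" using y by simp
      moreover have "dist c (x + t *\<^sub>R y) \<le> dist c x + norm (t *\<^sub>R y)"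
        by (rule dist_add_le)
      ultimately show ?thesis using that r by simp
    qed
    have "emeasure lborel ?S = (\<integral>\<^sup>+x\<in>?S. 1 \<partial>lborel)" by simp
    also have "\<dots> \<le> (\<integral>\<^sup>+x. ennreal \<bar>v (x + y) - v x\<bar> * indicator (ball c s) x + ennreal (v (x + y)) * indicator ?S x \<partial>lborel)"
    proof (rule nn_integral_mono)
      fix x
      show "1 * indicator ?S x \<le> ennreal \<bar>v (x + y) - v x\<bar> * indicator (ball c s) x + ennreal (v (x + y)) * indicator ?S x"
      proof (cases "x \<in> ?S")
        case True
        have "ennreal 1 \<le> ennreal (\<bar>v (x + y) - v x\<bar> + v (x + y))"
          using True by (intro ennreal_leI) auto
        also have "\<dots> = ennreal \<bar>v (x + y) - v x\<bar> + ennreal (v (x + y))"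
          using v by simp
        finally show ?thesis using True by simp
      qed simp
    qed
    also have "\<dots> = (\<integral>\<^sup>+x\<in>ball c s. ennreal \<bar>v (x + y) - v x\<bar> \<partial>lborel) + (\<integral>\<^sup>+x\<in>?S. ennreal (v (x + y)) \<partial>lborel)"
      by (rule nn_integral_add) measurable
    also have "(\<integral>\<^sup>+x\<in>ball c s. ennreal \<bar>v (x + y) - v x\<bar> \<partial>lborel) \<le> ennreal (norm y) * ?V"
      by (rule nn_integral_translation_le[OF v(1) vi open_ball K])
    also have "\<dots> \<le> ennreal r * ?V"
      using y by (intro mult_right_mono ennreal_leI) auto
    finally show ?thesis by (simp add: add_right_mono)
  qed
  have "emeasure lborel ?B * emeasure lborel ?S = (\<integral>\<^sup>+y\<in>?B. emeasure lborel ?S \<partial>lborel)"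
    by (subst nn_integral_cmult_indicator) (simp_all add: mult.commute)
  also have "\<dots> \<le> (\<integral>\<^sup>+y. (ennreal r * ?V) * indicator ?B y + (\<integral>\<^sup>+x\<in>?S. ennreal (v (x + y)) \<partial>lborel) * indicator ?B y \<partial>lborel)"
    by (rule nn_integral_mono) (use one in \<open>auto simp: indicator_def\<close>)
  also have "\<dots> = (ennreal r * ?V) * emeasure lborel ?B + (\<integral>\<^sup>+y. (\<integral>\<^sup>+x\<in>?S. ennreal (v (x + y)) \<partial>lborel) * indicator ?B y \<partial>lborel)"
    by (subst nn_integral_add) (auto simp: nn_integral_cmult_indicator)
  also have "(\<integral>\<^sup>+y. (\<integral>\<^sup>+x\<in>?S. ennreal (v (x + y)) \<partial>lborel) * indicator ?B y \<partial>lborel)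
      = (\<integral>\<^sup>+y. (\<integral>\<^sup>+x. ennreal (v (x + y)) * indicator ?S x * indicator ?B y \<partial>lborel) \<partial>lborel)"
    by (intro nn_integral_cong) (simp add: nn_integral_multc)
  also have "\<dots> = (\<integral>\<^sup>+x. (\<integral>\<^sup>+y. ennreal (v (x + y)) * indicator ?S x * indicator ?B y \<partial>lborel) \<partial>lborel)"
    by (rule lborel_pair.Fubini') measurable
  also have "\<dots> \<le> (\<integral>\<^sup>+x. (ennreal (1/2) * emeasure lborel ?B) * indicator ?S x \<partial>lborel)"
  proof (rule nn_integral_mono)
    fix x
    show "(\<integral>\<^sup>+y. ennreal (v (x + y)) * indicator ?S x * indicator ?B y \<partial>lborel)
        \<le> (ennreal (1/2) * emeasure lborel ?B) * indicator ?S x"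
    proof (cases "x \<in> ?S")
      case True
      have sub: "x + y \<in> ?A" if "y \<in> ?B" for y
      proof -
        have "dist c (x + y) \<le> dist c x + norm y" by norm
        then show ?thesis using that True r by simp
      qed
      have "(\<integral>\<^sup>+y. ennreal (v (x + y)) * indicator ?S x * indicator ?B y \<partial>lborel)
          \<le> (\<integral>\<^sup>+y. ennreal (1/4) * indicator ?B y + ennreal ((v (y + x))\<^sup>2) * indicator ?A (y + x) \<partial>lborel)"
      proof (rule nn_integral_mono)
        fix y
        \<comment> \<open>From (v - 1/2)^2 \<ge> 0. With the bound 1/4 on the mean square, the mean
          of v over the ball is at most 1/2.\<close>
        have "v (x + y) \<le> 1/4 + (v (x + y))\<^sup>2"
          using zero_le_power2[of "v (x + y) - 1/2"] by (simp add: power2_eq_square algebra_simps)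
        then have "ennreal (v (x + y)) \<le> ennreal (1/4 + (v (x + y))\<^sup>2)"
          by (rule ennreal_leI)
        also have "\<dots> = ennreal (1/4) + ennreal ((v (x + y))\<^sup>2)"
          by (intro ennreal_plus) auto
        finally show "ennreal (v (x + y)) * indicator ?S x * indicator ?B y
            \<le> ennreal (1/4) * indicator ?B y + ennreal ((v (y + x))\<^sup>2) * indicator ?A (y + x)"
          using sub[of y] True by (cases "y \<in> ?B") (simp_all add: add.commute)
      qed
      also have "\<dots> = ennreal (1/4) * emeasure lborel ?B + (\<integral>\<^sup>+y. ennreal ((v (y + x))\<^sup>2) * indicator ?A (y + x) \<partial>lborel)"
        by (subst nn_integral_add) (auto simp: nn_integral_cmult_indicator)
      also have "(\<integral>\<^sup>+y. ennreal ((v (y + x))\<^sup>2) * indicator ?A (y + x) \<partial>lborel) = (\<integral>\<^sup>+y\<in>?A. ennreal ((v y)\<^sup>2) \<partial>lborel)"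
        by (rule nn_integral_lborel_shift[where f = "\<lambda>y. ennreal ((v y)\<^sup>2) * indicator ?A y"]) measurable
      also have "\<dots> \<le> ennreal (1/4) * emeasure lborel ?B" by (rule small)
      also have "ennreal (1/4) * emeasure lborel ?B + ennreal (1/4) * emeasure lborel ?B
          = ennreal (1/2) * emeasure lborel ?B"
        by (simp add: distrib_right[symmetric] ennreal_plus[symmetric] del: ennreal_plus)
      finally show ?thesis using True by (simp add: add_left_mono)
    qed simp
  qed
  also have "\<dots> = (ennreal (1/2) * emeasure lborel ?B) * emeasure lborel ?S"
    by (simp add: nn_integral_cmult_indicator)
  finally have main: "emeasure lborel ?B * emeasure lborel ?S
      \<le> (ennreal r * ?V) * emeasure lborel ?B + (ennreal (1/2) * emeasure lborel ?B) * emeasure lborel ?S"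
    by (simp add: add_left_mono)
  \<comment> \<open>Half of the measure of \<open>?S\<close> sits on the right of
    \<open>main\<close> and is absorbed on the left, which is legitimate because all quantities are
    finite once the variation is.\<close>
  show ?thesis
  proof (cases "?V = top")
    case True
    then show ?thesis using r by (simp add: ennreal_mult_top)
  next
    case False
    define b where "b = measure lborel ?B"
    define \<sigma> where "\<sigma> = measure lborel ?S"
    define V where "V = enn2real ?V"
    have eB: "emeasure lborel ?B = ennreal b" and eS: "emeasure lborel ?S = ennreal \<sigma>" and eV: "?V = ennreal V"
      using finB finS False by (auto simp: b_def \<sigma>_def V_def emeasure_eq_ennreal_measure less_top)
    have nn: "0 \<le> b" "0 \<le> \<sigma>" "0 \<le> V" by (auto simp: b_def \<sigma>_def V_def)
    have "b > 0" using posB eB nn by simp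
    have "ennreal (b * \<sigma>) \<le> ennreal (r * V * b + 1/2 * b * \<sigma>)"
    proof -
      have "ennreal (b * \<sigma>) = ennreal b * ennreal \<sigma>"
        using nn by (intro ennreal_mult)
      also have "\<dots> \<le> (ennreal r * ennreal V) * ennreal b + (ennreal (1/2) * ennreal b) * ennreal \<sigma>"
        using main unfolding eB eS eV .
      also have "\<dots> = ennreal (r * V * b) + ennreal (1/2 * b * \<sigma>)"
        using nn r ennreal_mult[of "r * V" b] ennreal_mult[of r V] ennreal_mult[of "1/2 * b" \<sigma>] ennreal_mult[of "1/2" b]
        by simp
      also have "\<dots> = ennreal (r * V * b + 1/2 * b * \<sigma>)"
        using nn r by (intro ennreal_plus[symmetric]) auto
      finally show ?thesis .
    qed
    then have "b * \<sigma> \<le> r * V * b + 1/2 * b * \<sigma>"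
      using nn r by (subst (asm) ennreal_le_iff) auto
    then have "b * \<sigma> \<le> b * (2 * r * V)" by (simp add: algebra_simps)
    then have "\<sigma> \<le> 2 * r * V" using \<open>b > 0\<close> by simp
    then show ?thesis unfolding eS eV using nn r by (simp add: ennreal_mult[symmetric] ennreal_leI)
  qed
qed

text \<open>I |v x - h| is at most the integral of |v x - v y| over y in the ball. Putting y = x + w
  with norm w < 2 r and exchanging integrals leaves translation differences. The mean carries a
  weight because the energy inequality controls in time only integrals against C1 cutoffs.\<close>

lemma poincare_weighted_mean:
  fixes v \<phi> :: "'a::euclidean_space \<Rightarrow> real"
  assumes v: "v \<in> borel_measurable borel" and vb: "\<And>x. \<bar>v x\<bar> \<le> M"
    and \<phi>: "\<phi> \<in> borel_measurable borel" "\<And>x. 0 \<le> \<phi> x" "\<And>x. \<phi> x \<le> 1" "\<And>x. x \<notin> ball c r \<Longrightarrow> \<phi> x = 0"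
    and r: "0 < r"
    and I: "I = (LINT x|lborel. \<phi> x)"
    and h: "h * I = (LINT x|lborel. v x * \<phi> x)"
  shows "ennreal I * (\<integral>\<^sup>+x\<in>ball c r. ennreal \<bar>v x - h\<bar> \<partial>lborel)
    \<le> emeasure lborel (ball (0::'a) (2 * r)) * (ennreal (2 * r) * total_variation v (ball c (3 * r)))"
proof -
  let ?B = "ball c r" and ?A = "ball c (3 * r)" and ?W = "ball (0::'a) (2 * r)"
  note v[measurable] \<phi>(1)[measurable]
  have [measurable]: "?A \<in> sets borel" "?B \<in> sets borel" "?W \<in> sets borel" by auto
  have bint: "integrable lborel (\<lambda>x. g x * \<phi> x)"
    if [measurable]: "g \<in> borel_measurable borel" and g: "\<And>x. \<bar>g x\<bar> \<le> C" for g :: "'a \<Rightarrow> real" and C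
  proof (rule integrableI_bounded_set[where A = ?B and B = C])
    show "AE x in lborel. x \<in> ?B \<longrightarrow> norm (g x * \<phi> x) \<le> C"
    proof (intro AE_I2 impI)
      fix x
      have "\<bar>g x\<bar> * \<phi> x \<le> \<bar>g x\<bar> * 1" using \<phi> by (intro mult_left_mono) auto
      then show "norm (g x * \<phi> x) \<le> C" using \<phi>(2)[of x] g[of x] by (simp add: abs_mult)
    qed
  qed (auto simp: emeasure_lborel_ball_finite \<phi>(4))
  have I0: "0 \<le> I" unfolding I using \<phi> by (intro Bochner_Integration.integral_nonneg) auto
  have M0: "0 \<le> M" using vb[of undefined] by linarith
  have pt: "ennreal I * ennreal \<bar>v x - h\<bar> \<le> (\<integral>\<^sup>+y\<in>?B. ennreal \<bar>v x - v y\<bar> \<partial>lborel)" for x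
  proof -
    have i1: "integrable lborel (\<lambda>y. v x * \<phi> y)" using bint[of "\<lambda>_. v x" M] vb by simp
    have i2: "integrable lborel (\<lambda>y. v y * \<phi> y)" using bint[of v M] vb by simp
    have i3: "integrable lborel (\<lambda>y. \<bar>v x - v y\<bar> * \<phi> y)"
    proof (rule bint[of _ "2 * M"])
      show "\<bar>\<bar>v x - v y\<bar>\<bar> \<le> 2 * M" for y using vb[of x] vb[of y] by linarith
    qed measurable
    have "I * (v x - h) = (LINT y|lborel. v x * \<phi> y - v y * \<phi> y)"
      using i1 i2 h by (simp add: I algebra_simps)
    then have "\<bar>I * (v x - h)\<bar> = \<bar>LINT y|lborel. (v x - v y) * \<phi> y\<bar>"
      by (simp add: algebra_simps)
    also have "\<dots> \<le> (LINT y|lborel. \<bar>(v x - v y) * \<phi> y\<bar>)"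
      by (rule integral_abs_bound)
    also have "\<dots> = (LINT y|lborel. \<bar>v x - v y\<bar> * \<phi> y)"
      using \<phi> by (simp add: abs_mult)
    finally have "I * \<bar>v x - h\<bar> \<le> (LINT y|lborel. \<bar>v x - v y\<bar> * \<phi> y)"
      using I0 by (simp add: abs_mult)
    then have "ennreal (I * \<bar>v x - h\<bar>) \<le> ennreal (LINT y|lborel. \<bar>v x - v y\<bar> * \<phi> y)"
      by (rule ennreal_leI)
    also have "\<dots> = (\<integral>\<^sup>+y. ennreal (\<bar>v x - v y\<bar> * \<phi> y) \<partial>lborel)"
      using i3 \<phi> by (intro nn_integral_eq_integral[symmetric]) auto
    also have "\<dots> \<le> (\<integral>\<^sup>+y\<in>?B. ennreal \<bar>v x - v y\<bar> \<partial>lborel)"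
    proof (rule nn_integral_mono)
      fix y
      show "ennreal (\<bar>v x - v y\<bar> * \<phi> y) \<le> ennreal \<bar>v x - v y\<bar> * indicator ?B y"
        using \<phi>(2,3)[of y] \<phi>(4)[of y]
        by (cases "y \<in> ?B") (auto intro!: ennreal_leI mult_left_le)
    qed
    finally show ?thesis using I0 by (simp add: ennreal_mult)
  qed
  have vi: "set_integrable lborel ?A v"
    unfolding set_integrable_def
    by (rule integrableI_bounded_set_indicator[where B = M]) (use vb in \<open>auto simp: emeasure_lborel_ball_finite\<close>)
  have "ennreal I * (\<integral>\<^sup>+x\<in>?B. ennreal \<bar>v x - h\<bar> \<partial>lborel) = (\<integral>\<^sup>+x. ennreal I * (ennreal \<bar>v x - h\<bar> * indicator ?B x) \<partial>lborel)"
    by (rule nn_integral_cmult[symmetric]) measurable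
  also have "\<dots> \<le> (\<integral>\<^sup>+x. (\<integral>\<^sup>+w. ennreal \<bar>v (x + w) - v x\<bar> * indicator ?B x * indicator ?W w \<partial>lborel) \<partial>lborel)"
  proof (rule nn_integral_mono)
    fix x
    show "ennreal I * (ennreal \<bar>v x - h\<bar> * indicator ?B x)
        \<le> (\<integral>\<^sup>+w. ennreal \<bar>v (x + w) - v x\<bar> * indicator ?B x * indicator ?W w \<partial>lborel)"
    proof (cases "x \<in> ?B")
      case True
      have "ennreal I * ennreal \<bar>v x - h\<bar> \<le> (\<integral>\<^sup>+y\<in>?B. ennreal \<bar>v x - v y\<bar> \<partial>lborel)" by (rule pt)
      also have "\<dots> = (\<integral>\<^sup>+w. ennreal \<bar>v x - v (w + x)\<bar> * indicator ?B (w + x) \<partial>lborel)"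
        by (rule nn_integral_lborel_shift[symmetric, where f = "\<lambda>y. ennreal \<bar>v x - v y\<bar> * indicator ?B y"]) measurable
      also have "\<dots> \<le> (\<integral>\<^sup>+w. ennreal \<bar>v (x + w) - v x\<bar> * indicator ?B x * indicator ?W w \<partial>lborel)"
      proof (rule nn_integral_mono)
        fix w
        have "w \<in> ?W" if "w + x \<in> ?B"
        proof -
          have "norm w \<le> dist c (w + x) + dist c x" by norm
          then show ?thesis using that True by simp
        qed
        then show "ennreal \<bar>v x - v (w + x)\<bar> * indicator ?B (w + x)
            \<le> ennreal \<bar>v (x + w) - v x\<bar> * indicator ?B x * indicator ?W w"
          using True by (cases "w + x \<in> ?B") (simp_all add: abs_minus_commute add.commute)
      qed
      finally show ?thesis using True by simp
    qed simp
  qed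
  also have "\<dots> = (\<integral>\<^sup>+w. (\<integral>\<^sup>+x. ennreal \<bar>v (x + w) - v x\<bar> * indicator ?B x * indicator ?W w \<partial>lborel) \<partial>lborel)"
    by (rule lborel_pair.Fubini') measurable
  also have "\<dots> \<le> (\<integral>\<^sup>+w. (ennreal (2 * r) * total_variation v ?A) * indicator ?W w \<partial>lborel)"
  proof (rule nn_integral_mono)
    fix w
    show "(\<integral>\<^sup>+x. ennreal \<bar>v (x + w) - v x\<bar> * indicator ?B x * indicator ?W w \<partial>lborel)
        \<le> (ennreal (2 * r) * total_variation v ?A) * indicator ?W w"
    proof (cases "w \<in> ?W")
      case True
      have K: "x + t *\<^sub>R w \<in> ?A" if "x \<in> ?B" "t \<in> {0..1}" for x t
      proof -
        have "norm (t *\<^sub>R w) \<le> 1 * norm w" unfolding norm_scaleR using that by (intro mult_right_mono) auto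
        then have "norm (t *\<^sub>R w) < 2 * r" using True by simp
        moreover have "dist c (x + t *\<^sub>R w) \<le> dist c x + norm (t *\<^sub>R w)" by (rule dist_add_le)
        ultimately show ?thesis using that r by simp
      qed
      have "(\<integral>\<^sup>+x\<in>?B. ennreal \<bar>v (x + w) - v x\<bar> \<partial>lborel) \<le> ennreal (norm w) * total_variation v ?A"
        by (rule nn_integral_translation_le[OF v vi open_ball K])
      also have "\<dots> \<le> ennreal (2 * r) * total_variation v ?A"
        using True by (intro mult_right_mono ennreal_leI) auto
      finally show ?thesis using True by simp
    qed simp
  qed
  also have "\<dots> = emeasure lborel ?W * (ennreal (2 * r) * total_variation v ?A)"
    by (subst nn_integral_cmult_indicator) (simp_all add: mult.commute)
  finally show ?thesis .
qed

section \<open>De Giorgi's iteration\<close>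

text \<open>
  The total variation on a ball is not known to depend measurably on time, hence no measurability
  of f is assumed.
\<close>

lemma nn_integral_cmult_nonmeasurable:
  assumes "c > 0"
  shows "(\<integral>\<^sup>+x. ennreal c * f x \<partial>M) = ennreal c * (\<integral>\<^sup>+x. f x \<partial>M)"
proof -
  have le: "(\<integral>\<^sup>+x. ennreal c * f x \<partial>M) \<le> ennreal c * (\<integral>\<^sup>+x. f x \<partial>M)" if "c > 0" for c and f :: "'a \<Rightarrow> ennreal"
  proof -
    have cc: "ennreal c * (ennreal (1 / c) * x) = x" "ennreal (1 / c) * (ennreal c * x) = x" for x
      using that by (simp_all add: mult.assoc[symmetric] ennreal_mult[symmetric])
    show ?thesis
      unfolding nn_integral_def[of M "\<lambda>x. ennreal c * f x"]
    proof (rule SUP_least)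
      fix g assume "g \<in> {g. simple_function M g \<and> g \<le> (\<lambda>x. ennreal c * f x)}"
      then have g: "simple_function M g" "\<And>x. g x \<le> ennreal c * f x"
        by (auto simp: le_fun_def)
      note borel_measurable_simple_function[OF g(1), measurable]
      have "ennreal (1 / c) * g x \<le> f x" for x
        using mult_left_mono[OF g(2), of "ennreal (1 / c)" x] cc by simp
      then have "(\<integral>\<^sup>+x. ennreal (1 / c) * g x \<partial>M) \<le> (\<integral>\<^sup>+x. f x \<partial>M)"
        by (intro nn_integral_mono)
      then have "ennreal (1 / c) * (\<integral>\<^sup>+x. g x \<partial>M) \<le> (\<integral>\<^sup>+x. f x \<partial>M)"
        by (simp add: nn_integral_cmult)
      from mult_left_mono[OF this, of "ennreal c"]
      show "integral\<^sup>S M g \<le> ennreal c * (\<integral>\<^sup>+x. f x \<partial>M)"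
        using nn_integral_eq_simple_integral[OF g(1)] cc by simp
    qed
  qed
  have cc: "ennreal c * (ennreal (1 / c) * x) = x" "ennreal (1 / c) * (ennreal c * x) = x" for x
    using assms by (simp_all add: mult.assoc[symmetric] ennreal_mult[symmetric])
  have "(\<integral>\<^sup>+x. f x \<partial>M) \<le> ennreal (1 / c) * (\<integral>\<^sup>+x. ennreal c * f x \<partial>M)"
    using le[of "1 / c" "\<lambda>x. ennreal c * f x"] assms cc by simp
  from mult_left_mono[OF this, of "ennreal c"]
  show ?thesis using le[OF assms, of f] cc by (intro antisym) simp_all
qed

text \<open>The positive part, truncated at height d and normalised to 1. The truncation makes the
  derivative compactly supported, as \<open>classP\<close> demands.\<close>

definition ramp :: "real \<Rightarrow> real \<Rightarrow> real" where
  "ramp d s = max 0 (min 1 (s / d))"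

lemma ramp_bounds: "0 \<le> ramp d s" "ramp d s \<le> 1"
  by (auto simp: ramp_def)

lemma borel_measurable_ramp [measurable]: "ramp d \<in> borel_measurable borel"
  unfolding ramp_def by measurable

text \<open>Separates the iteration from the equation. The 4 bounds the slope of the time cutoff and
  the 8 that of the space cutoff; M bounds the primitive of the ramp; 2 / d undoes the d / 2 in
  \<open>primitive_ramp_bounds\<close>. \<open>K\<close> only abbreviates the common right-hand
  side.\<close>

definition caccioppoli :: "'a::euclidean_space \<Rightarrow> real \<Rightarrow> real \<Rightarrow> real \<Rightarrow> ('a \<times> real \<Rightarrow> real) \<Rightarrow> bool" where
  "caccioppoli c \<rho> s1 s2 U \<longleftrightarrow>
    (\<forall>k d r R a1 a2 b M K.
      0 < d \<longrightarrow> 0 < r \<longrightarrow> r < R \<longrightarrow> R \<le> \<rho> \<longrightarrow> s1 \<le> a1 \<longrightarrow> a1 < a2 \<longrightarrow> a2 < b \<longrightarrow> b \<le> s2 \<longrightarrow> 0 \<le> M \<longrightarrow>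
      (AE w in lborel. w \<in> ball c R \<times> {a1<..<b} \<longrightarrow> U w - k \<le> M) \<longrightarrow>
      K = ennreal (4 * M / (a2 - a1) + 8 / (R - r)) * emeasure lborel {w \<in> ball c R \<times> {a1<..<b}. U w > k} \<longrightarrow>
      (AE t in lborel. t \<in> {a2<..<b} \<longrightarrow>
        (\<integral>\<^sup>+x\<in>ball c r. ennreal ((ramp d (U (x, t) - k))\<^sup>2) \<partial>lborel) \<le> ennreal (2 / d) * K) \<and>
      (\<integral>\<^sup>+t\<in>{a2<..<b}. total_variation (\<lambda>x. ramp d (U (x, t) - k)) (ball c r) \<partial>lborel) \<le> K)"

lemma emeasure_lborel_slices:
  assumes "A \<in> sets (borel :: ('a::euclidean_space \<times> real) measure)"
  shows "emeasure lborel A = (\<integral>\<^sup>+t. emeasure lborel {x. (x, t) \<in> A} \<partial>lborel)"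
proof -
  have "emeasure (lborel \<Otimes>\<^sub>M lborel) A = (\<integral>\<^sup>+t. emeasure lborel ((\<lambda>x. (x, t)) -` A) \<partial>lborel)"
    using assms by (intro lborel_pair.emeasure_pair_measure_alt2)
      (simp only: sets_pair_measure_cong[OF sets_lborel sets_lborel] borel_prod)
  then show ?thesis
    by (simp add: lborel_prod vimage_def)
qed

text \<open>Where U > k + d the ramp is 1, so \<open>measure_level_set_le_total_variation\<close>
  applies on almost every slice. The gap from R to m pays for the Caccioppoli inequality, the gap
  from m to r for translations shorter than h. The bound is linear in K: the whole gain is the
  factor h.\<close>

lemma de_giorgi_step:
  fixes U :: "'a::euclidean_space \<times> real \<Rightarrow> real"
  assumes U [measurable]: "U \<in> borel_measurable borel"
    and cac: "caccioppoli c \<rho> s1 s2 U"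
    and d: "0 < d" and rad: "0 < r" "r < m" "m < R" "R \<le> \<rho>"
    and t: "s1 \<le> a1" "a1 < a2" "a2 < b" "b \<le> s2" and M: "0 \<le> M"
      "AE w in lborel. w \<in> ball c R \<times> {a1<..<b} \<longrightarrow> U w - k \<le> M"
    and K: "K = ennreal (4 * M / (a2 - a1) + 8 / (R - m)) * emeasure lborel {w \<in> ball c R \<times> {a1<..<b}. U w > k}"
    and h: "0 < h" "r + h \<le> m"
    and small: "ennreal (2 / d) * K \<le> ennreal (1/4) * emeasure lborel (ball (0::'a) h)"
  shows "emeasure lborel {w \<in> ball c r \<times> {a2<..<b}. U w > k + d} \<le> ennreal (2 * h) * K"
proof -
  have [measurable]: "ball c r \<times> {a2<..<b} \<in> sets borel"
    by (intro borel_open open_Times) auto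
  let ?A = "{w \<in> ball c r \<times> {a2<..<b}. U w > k + d}"
  let ?v = "\<lambda>t x. ramp d (U (x, t) - k)"
  have c1: "AE t in lborel. t \<in> {a2<..<b} \<longrightarrow> (\<integral>\<^sup>+x\<in>ball c m. ennreal ((?v t x)\<^sup>2) \<partial>lborel) \<le> ennreal (2 / d) * K"
    and c2: "(\<integral>\<^sup>+t\<in>{a2<..<b}. total_variation (?v t) (ball c m) \<partial>lborel) \<le> K"
    using cac[unfolded caccioppoli_def, rule_format, OF d _ rad(3,4) t M K] rad by auto
  have "emeasure lborel ?A = (\<integral>\<^sup>+t. emeasure lborel {x. (x, t) \<in> ?A} \<partial>lborel)"
    by (rule emeasure_lborel_slices) measurable
  also have "\<dots> \<le> (\<integral>\<^sup>+t. ennreal (2 * h) * (total_variation (?v t) (ball c m) * indicator {a2<..<b} t) \<partial>lborel)"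
  proof (rule nn_integral_mono_AE, use c1 in eventually_elim)
    fix t assume c1: "t \<in> {a2<..<b} \<longrightarrow> (\<integral>\<^sup>+x\<in>ball c m. ennreal ((?v t x)\<^sup>2) \<partial>lborel) \<le> ennreal (2 / d) * K"
    show "emeasure lborel {x. (x, t) \<in> ?A} \<le> ennreal (2 * h) * (total_variation (?v t) (ball c m) * indicator {a2<..<b} t)"
    proof (cases "t \<in> {a2<..<b}")
      case True
      have [measurable]: "?v t \<in> borel_measurable borel" by measurable
      have [measurable]: "ball c r \<in> sets borel" by simp
      have "emeasure lborel {x. (x, t) \<in> ?A} \<le> emeasure lborel {x\<in>ball c r. ?v t x \<ge> 1}"
      proof (rule emeasure_mono)
        show "{x. (x, t) \<in> ?A} \<subseteq> {x\<in>ball c r. ?v t x \<ge> 1}"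
          using d by (auto simp: ramp_def field_simps)
      qed measurable
      also have "\<dots> \<le> ennreal (2 * h) * total_variation (?v t) (ball c m)"
      proof (rule measure_level_set_le_total_variation)
        show "(\<integral>\<^sup>+x\<in>ball c m. ennreal ((?v t x)\<^sup>2) \<partial>lborel) \<le> ennreal (1/4) * emeasure lborel (ball (0::'a) h)"
          using c1 True small by (auto intro: order_trans)
      qed (use h ramp_bounds in auto)
      finally show ?thesis using True by simp
    next
      case False
      then have "{x. (x, t) \<in> ?A} = {}" by auto
      then show ?thesis by (simp only: emeasure_empty zero_le)
    qed
  qed
  also have "\<dots> = ennreal (2 * h) * (\<integral>\<^sup>+t\<in>{a2<..<b}. total_variation (?v t) (ball c m) \<partial>lborel)"
    using h by (intro nn_integral_cmult_nonmeasurable) auto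
  also have "\<dots> \<le> ennreal (2 * h) * K"
    by (intro mult_left_mono c2) auto
  finally show ?thesis .
qed

text \<open>Levels rise to k + \<delta>, radii fall to \<rho> / 2 and starting times rise to a +
  \<epsilon> \<rho> / 2, with gaps proportional to 2^-n. The end time b never moves, so the bound
  reaches the top of the cylinder. The threshold depends only on \<epsilon>, \<delta>, M and the
  dimension.\<close>

lemma de_giorgi:
  fixes \<epsilon> \<delta> M :: real
  assumes pos: "0 < \<epsilon>" "0 < \<delta>" "0 \<le> M"
  obtains \<nu> where "0 < \<nu>"
    and "\<And>(c :: 'a::euclidean_space) U \<rho> a b k.
      \<lbrakk>U \<in> borel_measurable borel; caccioppoli c \<rho> a b U; 0 < \<rho>; a + \<epsilon> * \<rho> \<le> b;
       AE w in lborel. w \<in> ball c \<rho> \<times> {a<..<b} \<longrightarrow> U w - k \<le> M;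
       emeasure lborel {w \<in> ball c \<rho> \<times> {a<..<b}. U w > k} \<le> ennreal (\<nu> * \<rho> ^ Suc DIM('a))\<rbrakk>
      \<Longrightarrow> AE w in lborel. w \<in> ball c (\<rho> / 2) \<times> {a + \<epsilon> * \<rho> / 2<..<b} \<longrightarrow> U w \<le> k + \<delta>"
proof -
  define N where "N = DIM('a)"
  \<comment> \<open>At stage n the time gap is \<epsilon> \<rho> q n / 4 and the spatial gap is
    \<rho> q n / 8, so the Caccioppoli factor is exactly C / (\<rho> q n).\<close>
  define C where "C = 16 * M / \<epsilon> + 64"
  \<comment> \<open>The decay rate that the smallness condition asks for: see \<open>qk\<close>
    below.\<close>
  define \<kappa> where "\<kappa> = (1/2 :: real) ^ (N + 2)"
  \<comment> \<open>The shift h0 q n \<rho> must fit into a gap \<rho> q n / 8, and one step, which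
    multiplies the measure by at most 2 h0 C, must contract by \<kappa>.\<close>
  define h0 where "h0 = min (1/8) (\<kappa> / (2 * C))"
  define V where "V = measure lborel (ball (0::'a) 1)"
  \<comment> \<open>Solves the smallness condition of \<open>de_giorgi_step\<close> with equality,
    for all n at once.\<close>
  define \<nu> where "\<nu> = V * h0 ^ N * \<delta> / (16 * C)"
  have C: "C > 0" unfolding C_def using pos by (intro add_nonneg_pos) auto
  have \<kappa>: "\<kappa> > 0" "\<kappa> < 1"
    using power_strict_decreasing[of 0 "N + 2" "1/2::real"] by (simp_all add: \<kappa>_def)
  have h0: "h0 > 0" "h0 \<le> 1/8" "2 * h0 * C \<le> \<kappa>"
    using C \<kappa> by (auto simp: h0_def min_def field_simps)
  have V: "V > 0" by (simp add: V_def content_ball)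
  have ball: "emeasure lborel (ball (0::'a) s) = ennreal (V * s ^ N)" if "s \<ge> 0" for s
    using that by (simp add: emeasure_ball V_def N_def content_ball)
  have \<nu>: "\<nu> > 0" unfolding \<nu>_def using V h0 C pos by simp
  show thesis
  proof (rule that[OF \<nu>])
    fix c :: 'a and U \<rho> a b k
    assume U [measurable]: "U \<in> borel_measurable borel" and cac: "caccioppoli c \<rho> a b U"
      and \<rho>: "0 < \<rho>" and ab: "a + \<epsilon> * \<rho> \<le> b"
      and bd: "AE w in lborel. w \<in> ball c \<rho> \<times> {a<..<b} \<longrightarrow> U w - k \<le> M"
      and init: "emeasure lborel {w \<in> ball c \<rho> \<times> {a<..<b}. U w > k} \<le> ennreal (\<nu> * \<rho> ^ Suc DIM('a))"
    define q where "q n = (1/2 :: real) ^ n" for n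
    have q: "q n > 0" "q n \<le> 1" "q (Suc n) = q n / 2" for n
      by (auto simp: q_def power_le_one)
    define R where "R n = \<rho> / 2 * (1 + q n)" for n
    define \<alpha> where "\<alpha> n = a + \<epsilon> * \<rho> / 2 * (1 - q n)" for n
    define k' where "k' n = k + \<delta> * (1 - q n)" for n
    define A where "A n = {w \<in> ball c (R n) \<times> {\<alpha> n<..<b}. U w > k' n}" for n
    have R: "0 < R n" "R n \<le> \<rho>" for n
      using \<rho> q[of n] by (auto simp: R_def field_simps intro!: add_nonneg_pos)
    have \<epsilon>\<rho>: "\<epsilon> * \<rho> > 0" using pos \<rho> by simp
    have \<alpha>: "a \<le> \<alpha> n" "\<alpha> n < b" for n
    proof -
      have "0 \<le> \<epsilon> * \<rho> / 2 * (1 - q n)" using \<epsilon>\<rho> q[of n] by (intro mult_nonneg_nonneg) auto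
      then show "a \<le> \<alpha> n" by (simp add: \<alpha>_def)
      have "\<epsilon> * \<rho> / 2 * (1 - q n) \<le> \<epsilon> * \<rho> / 2 * 1" using \<epsilon>\<rho> q(1)[of n] by (intro mult_left_mono) auto
      then show "\<alpha> n < b" using ab \<epsilon>\<rho> by (simp add: \<alpha>_def)
    qed
    have k': "k \<le> k' n" for n
      using pos q[of n] by (simp add: k'_def)
    have main: "emeasure lborel (A n) \<le> ennreal (\<nu> * \<kappa> ^ n * \<rho> ^ Suc N)" for n
    proof (induction n)
      case 0
      then show ?case using init by (simp add: A_def R_def \<alpha>_def k'_def q_def N_def)
    next
      case (Suc n)
      define h where "h = h0 * q n * \<rho>"
      \<comment> \<open>Midway between consecutive radii, whose distance is \<rho> q n / 4.\<close>
      define m where "m = R (Suc n) + \<rho> * q n / 8"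
      define K where "K = ennreal (4 * M / (\<alpha> (Suc n) - \<alpha> n) + 8 / (R n - m)) * emeasure lborel (A n)"
      define Y where "Y = \<nu> * \<kappa> ^ n * \<rho> ^ Suc N"
      have Y: "0 \<le> Y" unfolding Y_def using \<nu> \<kappa> \<rho> by auto
      have d\<alpha>: "\<alpha> (Suc n) - \<alpha> n = \<epsilon> * \<rho> * q n / 4"
        by (simp add: \<alpha>_def q(3) field_simps)
      have dR: "R n - m = \<rho> * q n / 8"
        by (simp add: m_def R_def q(3) field_simps)
      have dk: "k' (Suc n) = k' n + \<delta> * q n / 2"
        by (simp add: k'_def q(3) field_simps)
      have coef: "4 * M / (\<alpha> (Suc n) - \<alpha> n) + 8 / (R n - m) = C / (\<rho> * q n)"
        unfolding d\<alpha> dR C_def using pos \<rho> q(1)[of n] by (simp add: field_simps)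
      have "K \<le> ennreal (C / (\<rho> * q n)) * ennreal Y"
        unfolding K_def coef using Suc.IH unfolding Y_def by (intro mult_left_mono) auto
      also have "\<dots> = ennreal (C / (\<rho> * q n) * Y)"
        using C \<rho> q(1)[of n] Y by (intro ennreal_mult[symmetric]) auto
      finally have Kle: "K \<le> ennreal (C / (\<rho> * q n) * Y)" .
      \<comment> \<open>In the smallness condition one factor q n comes from the Caccioppoli
        constant, one from the level increment, and N from the volume of the ball of radius
        h.\<close>
      have qk: "\<kappa> ^ n = (q n)\<^sup>2 * q n ^ N"
      proof -
        have "(N + 2) * n = n * 2 + n * N" by (simp add: algebra_simps)
        then show ?thesis
          unfolding \<kappa>_def q_def power_mult[symmetric] power_add[symmetric] by (simp only:)
      qed
      have "emeasure lborel (A (Suc n)) \<le> ennreal (2 * h) * K"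
        unfolding A_def dk
      proof (rule de_giorgi_step[OF U cac, where R = "R n" and m = m and M = M])
        show "0 < \<delta> * q n / 2" using pos q(1)[of n] by simp
        show "0 < R (Suc n)" "R n \<le> \<rho>" using R by auto
        have "\<rho> * q n > 0" using \<rho> q(1)[of n] by simp
        then show "R (Suc n) < m" "m < R n" using dR by (auto simp: m_def)
        show "a \<le> \<alpha> n" "\<alpha> (Suc n) < b" using \<alpha> by auto
        show "\<alpha> n < \<alpha> (Suc n)" using d\<alpha> \<epsilon>\<rho> q(1)[of n] by (smt (verit) divide_pos_pos mult_pos_pos)
        show "AE w in lborel. w \<in> ball c (R n) \<times> {\<alpha> n<..<b} \<longrightarrow> U w - k' n \<le> M"
          using bd
        proof eventually_elim
          case (elim w)
          have "ball c (R n) \<subseteq> ball c \<rho>" using R by (intro subset_ball)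
          then show ?case using elim \<alpha>(1)[of n] k'[of n] by force
        qed
        show "K = ennreal (4 * M / (\<alpha> (Suc n) - \<alpha> n) + 8 / (R n - m)) *
            emeasure lborel {w \<in> ball c (R n) \<times> {\<alpha> n<..<b}. k' n < U w}"
          unfolding K_def A_def ..
        show h: "0 < h" using h0 q(1)[of n] \<rho> by (simp add: h_def)
        have "h0 * (q n * \<rho>) \<le> 1/8 * (q n * \<rho>)" using h0 q(1)[of n] \<rho> by (intro mult_right_mono) auto
        then show "R (Suc n) + h \<le> m" by (simp add: h_def m_def algebra_simps)
        have "2 / (\<delta> * q n / 2) * (C / (\<rho> * q n) * Y) = 1/4 * (V * h ^ N)"
        proof -
          have "2 / (\<delta> * q n / 2) * (C / (\<rho> * q n) * Y) = 4 * C * Y / (\<delta> * \<rho> * (q n)\<^sup>2)"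
            using pos \<rho> q(1)[of n] by (simp add: field_simps power2_eq_square)
          also have "\<dots> = 4 * C * \<nu> / \<delta> * q n ^ N * \<rho> ^ N"
            unfolding Y_def qk using pos \<rho> q(1)[of n] by (simp add: field_simps)
          also have "\<dots> = 1/4 * (V * h ^ N)"
            unfolding \<nu>_def h_def using pos C by (simp add: power_mult_distrib field_simps)
          finally show ?thesis .
        qed
        moreover have "ennreal (2 / (\<delta> * q n / 2)) * ennreal (C / (\<rho> * q n) * Y)
            = ennreal (2 / (\<delta> * q n / 2) * (C / (\<rho> * q n) * Y))"
          using pos q(1)[of n] C \<rho> Y by (intro ennreal_mult[symmetric]) auto
        moreover have "ennreal (1/4 * (V * h ^ N)) = ennreal (1/4) * ennreal (V * h ^ N)"
          using V h by (intro ennreal_mult) auto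
        ultimately have eq: "ennreal (2 / (\<delta> * q n / 2)) * ennreal (C / (\<rho> * q n) * Y)
            = ennreal (1/4) * ennreal (V * h ^ N)"
          by (simp only:)
        have "ennreal (2 / (\<delta> * q n / 2)) * K \<le> ennreal (2 / (\<delta> * q n / 2)) * ennreal (C / (\<rho> * q n) * Y)"
          by (intro mult_left_mono Kle) auto
        then show "ennreal (2 / (\<delta> * q n / 2)) * K \<le> ennreal (1/4) * emeasure lborel (ball (0::'a) h)"
          using eq h by (simp add: ball)
        show "0 \<le> M" "b \<le> b" using pos by auto
      qed
      also have "\<dots> \<le> ennreal (2 * h) * ennreal (C / (\<rho> * q n) * Y)"
        by (intro mult_left_mono Kle) auto
      also have "\<dots> = ennreal (2 * h * (C / (\<rho> * q n) * Y))"
        using h0 q(1)[of n] \<rho> C Y by (intro ennreal_mult[symmetric]) (auto simp: h_def)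
      also have "2 * h * (C / (\<rho> * q n) * Y) = (2 * h0 * C) * Y"
        unfolding h_def using \<rho> q(1)[of n] by (simp add: field_simps)
      also have "ennreal ((2 * h0 * C) * Y) \<le> ennreal (\<kappa> * Y)"
        using h0 Y by (intro ennreal_leI mult_right_mono) auto
      finally show ?case by (simp add: Y_def mult_ac)
    qed
    let ?Z = "{w \<in> ball c (\<rho> / 2) \<times> {a + \<epsilon> * \<rho> / 2<..<b}. U w > k + \<delta>}"
    have [measurable]: "ball c s \<times> {e<..<b} \<in> sets borel" for s e
      by (intro borel_open open_Times) auto
    have sub: "?Z \<subseteq> A n" for n
    proof
      fix w assume "w \<in> ?Z"
      then obtain x t where w: "w = (x, t)" "x \<in> ball c (\<rho> / 2)" "a + \<epsilon> * \<rho> / 2 < t" "t < b" "U w > k + \<delta>"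
        by auto
      have "\<rho> / 2 \<le> R n" using \<rho> q(1)[of n] by (simp add: R_def field_simps)
      moreover have "\<alpha> n \<le> a + \<epsilon> * \<rho> / 2"
        using mult_pos_pos[OF \<epsilon>\<rho> q(1)[of n]] by (simp add: \<alpha>_def field_simps)
      moreover have "k' n \<le> k + \<delta>" using pos q(1)[of n] by (simp add: k'_def field_simps)
      ultimately show "w \<in> A n" using w by (auto simp: A_def)
    qed
    have "(\<lambda>n. ennreal (\<nu> * \<kappa> ^ n * \<rho> ^ Suc N)) \<longlonglongrightarrow> ennreal (\<nu> * 0 * \<rho> ^ Suc N)"
      using \<kappa> by (intro tendsto_ennrealI tendsto_intros LIMSEQ_power_zero) auto
    then have "emeasure lborel ?Z \<le> ennreal (\<nu> * 0 * \<rho> ^ Suc N)"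
    proof (rule LIMSEQ_le_const)
      have "emeasure lborel ?Z \<le> emeasure lborel (A n)" for n
        by (rule emeasure_mono[OF sub]) (unfold A_def, measurable)
      then show "\<exists>n0. \<forall>n\<ge>n0. emeasure lborel ?Z \<le> ennreal (\<nu> * \<kappa> ^ n * \<rho> ^ Suc N)"
        using main order_trans by blast
    qed
    then have "emeasure lborel ?Z = 0" by simp
    then show "AE w in lborel. w \<in> ball c (\<rho> / 2) \<times> {a + \<epsilon> * \<rho> / 2<..<b} \<longrightarrow> U w \<le> k + \<delta>"
      by (intro AE_I[of _ _ ?Z]) auto
  qed
qed

section \<open>The energy inequality for cutoff functions\<close>

lemma has_real_derivative_ramp_primitive:
  assumes "d > 0"
  shows "((\<lambda>s. (sq_pos s - sq_pos (s - d)) / (2 * d)) has_real_derivative ramp d s) (at s)"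
proof -
  have 1: "((\<lambda>s. sq_pos (s - d)) has_real_derivative 2 * max 0 (s - d) * 1) (at s)"
    by (rule DERIV_chain2[OF has_real_derivative_sq_pos]) (auto intro!: derivative_eq_intros)
  have "((\<lambda>s. (sq_pos s - sq_pos (s - d)) / (2 * d)) has_real_derivative
      (2 * max 0 s - 2 * max 0 (s - d) * 1) / (2 * d)) (at s)"
    by (intro DERIV_cdivide DERIV_diff has_real_derivative_sq_pos 1)
  moreover have "(2 * max 0 s - 2 * max 0 (s - d) * 1) / (2 * d) = ramp d s"
    using assms by (auto simp: ramp_def max_def min_def field_simps)
  ultimately show ?thesis by simp
qed

lemma continuous_on_ramp: "continuous_on S (ramp d)"
  unfolding ramp_def divide_inverse by (intro continuous_intros)

lemma primitive_eq:
  assumes "continuous_on UNIV p" "\<And>s. (F has_real_derivative p s) (at s)"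
  shows "primitive p w = F w - F 0"
proof -
  have "(LBINT s=ereal 0..ereal w. p s) = F w - F 0"
    by (rule interval_integral_FTC_finite)
      (use assms in \<open>auto intro: continuous_on_subset has_vector_derivative_at_within
        simp: has_real_derivative_iff_has_vector_derivative\<close>)
  then show ?thesis by (simp add: primitive_def zero_ereal_def)
qed

lemma primitive_ramp:
  assumes "d > 0"
  shows "primitive (ramp d) w = (sq_pos w - sq_pos (w - d)) / (2 * d)"
  using primitive_eq[OF continuous_on_ramp has_real_derivative_ramp_primitive[OF assms]] assms
  by (simp add: sq_pos_def)

text \<open>The upper bound controls the source term by M on the set where u exceeds the level; the
  lower bound turns the energy at a fixed time into a mean square of the ramp.\<close>

lemma primitive_ramp_bounds:
  assumes d: "d > 0"
  shows "primitive (ramp d) w \<le> max 0 w" "d / 2 * (ramp d w)\<^sup>2 \<le> primitive (ramp d) w"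
proof -
  consider "w \<le> 0" | "0 < w" "w \<le> d" | "d < w" by linarith
  then have "primitive (ramp d) w \<le> max 0 w \<and> d / 2 * (ramp d w)\<^sup>2 \<le> primitive (ramp d) w"
  proof cases
    case 1
    then show ?thesis using d by (simp add: primitive_ramp sq_pos_def ramp_def divide_nonpos_pos)
  next
    case 2
    then have P: "primitive (ramp d) w = w\<^sup>2 / (2 * d)" using d by (simp add: primitive_ramp sq_pos_def)
    have "w * w \<le> w * (2 * d)" using 2 by (intro mult_left_mono) auto
    then have "primitive (ramp d) w \<le> w" unfolding P using d by (simp add: divide_le_eq power2_eq_square)
    moreover have "ramp d w = w / d" using 2 d by (simp add: ramp_def)
    then have "d / 2 * (ramp d w)\<^sup>2 = primitive (ramp d) w"
      unfolding P using d by (simp add: field_simps power2_eq_square)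
    ultimately show ?thesis using 2 by simp
  next
    case 3
    then have "primitive (ramp d) w = w - d / 2"
      using d by (simp add: primitive_ramp sq_pos_def field_simps power2_eq_square)
    moreover have "ramp d w = 1" using 3 d by (simp add: ramp_def)
    ultimately show ?thesis using 3 d by simp
  qed
  then show "primitive (ramp d) w \<le> max 0 w" "d / 2 * (ramp d w)\<^sup>2 \<le> primitive (ramp d) w" by auto
qed

lemma primitive_ramp_nonneg: "d > 0 \<Longrightarrow> 0 \<le> primitive (ramp d) w"
  using primitive_ramp_bounds(2)[of d w] zero_le_power2[of "ramp d w"]
  by (meson half_gt_zero less_imp_le mult_nonneg_nonneg order_trans)

lemma borel_measurable_primitive_ramp: "d > 0 \<Longrightarrow> primitive (ramp d) \<in> borel_measurable borel"
  using primitive_ramp[of d] by (simp add: sq_pos_def cong: measurable_cong)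

lemma primitive_const: "primitive (\<lambda>s. k) w = k * w"
  using primitive_eq[of "\<lambda>s. k" "\<lambda>s. k * s" w] by (auto intro!: derivative_eq_intros)

lemma classP_const: "(\<lambda>s. k) \<in> classP"
  unfolding classP_def by (auto intro!: exI[of _ 0] exI[of _ "{}"] lipschitz_onI mono_onI simp: mono_def)

lemma classP_ramp:
  assumes d: "d > 0"
  shows "ramp d \<in> classP"
proof -
  have "mono (ramp d)"
  proof (rule monoI)
    fix x y :: real assume "x \<le> y"
    then have "x / d \<le> y / d" using d by (simp add: divide_right_mono)
    then show "ramp d x \<le> ramp d y"
      unfolding ramp_def by (intro max.mono min.mono order_refl)
  qed
  moreover have "(1 / d)-lipschitz_on UNIV (ramp d)"
  proof (rule lipschitz_onI)
    fix x y :: real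
    have "\<bar>ramp d x - ramp d y\<bar> \<le> \<bar>x / d - y / d\<bar>"
      by (auto simp: ramp_def max_def min_def)
    also have "\<dots> = 1 / d * \<bar>x - y\<bar>"
      using d by (simp add: diff_divide_distrib[symmetric] abs_div)
    finally show "dist (ramp d x) (ramp d y) \<le> 1 / d * dist x y" by (simp add: dist_real_def)
  qed (use d in auto)
  moreover have "(ramp d has_real_derivative 0) (at s)" if "s \<notin> {0..d}" for s
  proof (cases "s < 0")
    case True
    have "((\<lambda>s. 0) has_real_derivative 0) (at s)" by simp
    then show ?thesis
      by (rule has_field_derivative_transform_within_open[of _ _ _ "{..<0}"])
        (use True d divide_neg_pos[OF _ d] in \<open>auto simp: ramp_def not_le[symmetric]\<close>)
  next
    case False
    then have "s > d" using that by auto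
    have "((\<lambda>s. 1) has_real_derivative 0) (at s)" by simp
    then show ?thesis
      by (rule has_field_derivative_transform_within_open[of _ _ _ "{d<..}"])
        (use \<open>s > d\<close> d in \<open>auto simp: ramp_def\<close>)
  qed
  ultimately show ?thesis
    unfolding classP_def by (auto intro!: exI[of _ "{0..d}"])
qed

text \<open>Carries the BV condition from p(u) to p(u - l). The exceptional null set moves with the
  translation.\<close>

lemma classP_shift:
  assumes "p \<in> classP"
  shows "(\<lambda>s. p (s - l)) \<in> classP"
proof -
  obtain L K where L: "L-lipschitz_on UNIV p" and m: "mono p" and K: "compact K"
    and ae: "AE s in lborel. s \<notin> K \<longrightarrow> (p has_real_derivative 0) (at s)"
    using assms unfolding classP_def by blast
  have "L-lipschitz_on UNIV (\<lambda>s. p (s - l))"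
    using L unfolding lipschitz_on_def by (auto simp: dist_real_def) (metis diff_diff_eq2 diff_add_cancel)
  moreover have "mono (\<lambda>s. p (s - l))" using m by (auto simp: mono_def)
  moreover have "compact ((+) l ` K)" using K by (rule compact_translation)
  moreover have "AE s in lborel. s \<notin> (+) l ` K \<longrightarrow> ((\<lambda>s. p (s - l)) has_real_derivative 0) (at s)"
  proof -
    have "AE s in distr lborel borel ((+) (- l)). s \<notin> K \<longrightarrow> (p has_real_derivative 0) (at s)"
      unfolding lborel_distr_plus by (rule ae)
    then have "AE s in lborel. (- l + s) \<notin> K \<longrightarrow> (p has_real_derivative 0) (at (- l + s))"
      by (rule AE_distrD[rotated]) simp
    then show ?thesis
    proof eventually_elim
      case (elim s)
      show ?case
      proof
        assume "s \<notin> (+) l ` K"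
        then have "- l + s \<notin> K" by (auto simp: image_iff)
        then have "(p has_real_derivative 0) (at (s - l))" using elim by simp
        moreover have "((\<lambda>s. s - l) has_real_derivative 1) (at s)" by (auto intro!: derivative_eq_intros)
        ultimately show "((\<lambda>s. p (s - l)) has_real_derivative 0) (at s)"
          using DERIV_chain2[of p 0 "\<lambda>s. s - l" s 1 UNIV] by simp
      qed
    qed
  qed
  ultimately show ?thesis unfolding classP_def by blast
qed

text \<open>Q need not be measurable, so its exceptional set is enlarged to a Borel null set before
  the order of the quantifiers is exchanged.\<close>

lemma AE_lborel_slices:
  fixes Q :: "'a::euclidean_space \<times> real \<Rightarrow> bool"
  assumes "AE w in lborel. Q w"
  shows "AE t in lborel. AE x in lborel. Q (x, t)"
proof -
  obtain N where N: "{w. \<not> Q w} \<subseteq> N" "emeasure lborel N = 0" "N \<in> sets borel"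
    using assms by (auto elim!: AE_E)
  have [measurable]: "N \<in> sets (borel \<Otimes>\<^sub>M borel)" using N(3) by (simp only: borel_prod)
  have "AE w in lborel \<Otimes>\<^sub>M lborel. w \<notin> N"
    unfolding lborel_prod using N by (intro AE_I[of _ _ N]) auto
  then have "AE x in lborel. AE t in lborel. (x, t) \<notin> N"
    by (rule lborel_pair.AE_pair)
  then have "AE t in lborel. AE x in lborel. (x, t) \<notin> N"
    by (subst (asm) lborel_pair.AE_commute) measurable
  then show ?thesis
  proof eventually_elim
    case (elim t)
    then show ?case
      by eventually_elim (use N(1) in auto)
  qed
qed

lemma grad_mult_const: "grad (\<lambda>y. f y * k) x = k *\<^sub>R grad f x" if "f differentiable (at x)"
  for f :: "'a::euclidean_space \<Rightarrow> real"
proof -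
  have "(f has_derivative frechet_derivative f (at x)) (at x)"
    using that by (simp add: frechet_derivative_works)
  then have "((\<lambda>y. f y * k) has_derivative (\<lambda>h. frechet_derivative f (at x) h * k)) (at x)"
    by (rule has_derivative_mult_left)
  then have "frechet_derivative (\<lambda>y. f y * k) (at x) = (\<lambda>h. frechet_derivative f (at x) h * k)"
    by (rule frechet_derivative_at[symmetric])
  then show ?thesis
    by (simp add: grad_def scaleR_sum_right mult.commute)
qed

section \<open>Energy estimates for solutions with product cutoffs\<close>

locale one_laplacian =
  fixes E :: "'a::euclidean_space set" and T :: real
    and u :: "'a \<times> real \<Rightarrow> real" and z :: "'a \<times> real \<Rightarrow> 'a"
  assumes E: "open E"
    and u_loc: "u \<in> Linf_loc (E \<times> {0<..<T})"
    and u_int: "\<And>t. t \<in> {0<..<T} \<Longrightarrow> set_integrable lebesgue E (\<lambda>x. u (x, t))"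
    and u_BV: "\<And>p t. p \<in> classP \<Longrightarrow> t \<in> {0<..<T} \<Longrightarrow> (\<lambda>x. p (u (x, t))) \<in> BV E"
    and z_meas: "set_borel_measurable lebesgue (E \<times> {0<..<T}) z"
    and z_le: "AE w in lebesgue. w \<in> E \<times> {0<..<T} \<longrightarrow> norm (z w) \<le> 1"
    and energy: "energy_ineq T E u z"
begin

lemma slice_BV: "p \<in> classP \<Longrightarrow> t \<in> {0<..<T} \<Longrightarrow> (\<lambda>x. p (u (x, t) - l)) \<in> BV E"
  using u_BV[OF classP_shift[of p l]] by simp

lemma Times_sets: "A \<in> sets borel \<Longrightarrow> B \<in> sets borel \<Longrightarrow> (A \<times> B :: ('a \<times> real) set) \<in> sets lebesgue"
  using borel_Times[of A B] by (simp add: sets_completionI_sets)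

text \<open>The integrability premises of \<open>energy_ineq\<close> are discharged here once: u is
  essentially bounded on the compact support of the cutoff within the time interval, and p, z and
  the cutoff are bounded. The time factor is non-decreasing because \<open>classC\<close> wants a
  nonnegative time derivative.\<close>

lemma energy_cutoff:
  fixes l :: real
  assumes p: "p \<in> classP" "p \<in> borel_measurable borel" "\<And>s. \<bar>p s\<bar> \<le> 1"
      "primitive p \<in> borel_measurable borel" "\<And>s. \<bar>primitive p s\<bar> \<le> \<bar>s\<bar>"
    and R: "0 < r" "r < R" "cball c R \<subseteq> E" and t: "0 < t1" "t1 \<le> t2" "t2 < T"
    and th: "\<And>t. (\<theta> has_real_derivative \<theta>' t) (at t)" "\<And>t. 0 \<le> \<theta>' t" "\<And>t. \<theta>' t \<le> \<Theta>"
      "\<And>t. 0 \<le> \<theta> t" "\<And>t. \<theta> t \<le> 1" "\<theta>' \<in> borel_measurable borel"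
  defines "F1 \<equiv> \<lambda>w. primitive p (u w - l) * (bump c r R (fst w) * \<theta>' (snd w))"
    and "F2 \<equiv> \<lambda>w. (z w \<bullet> (\<theta> (snd w) *\<^sub>R grad (bump c r R) (fst w))) * p (u w - l)"
  shows "set_integrable lebesgue (E \<times> {t1..t2}) F1" and "set_integrable lebesgue (E \<times> {t1..t2}) F2"
    and "ereal (LINT x:E|lebesgue. primitive p (u (x, t2) - l) * (bump c r R x * \<theta> t2))
        + enn2ereal (\<integral>\<^sup>+t\<in>{t1..t2}. (\<integral>\<^sup>+x. ennreal (bump c r R x * \<theta> t) \<partial>tv_measure E (\<lambda>x. p (u (x, t) - l))) \<partial>lebesgue)
      \<le> ereal ((LINT x:E|lebesgue. primitive p (u (x, t1) - l) * (bump c r R x * \<theta> t1))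
        + (LINT w:E \<times> {t1..t2}|lebesgue. F1 w) - (LINT w:E \<times> {t1..t2}|lebesgue. F2 w))"
proof -
  let ?\<phi> = "bump c r R"
  define \<zeta> where "\<zeta> w = ?\<phi> (fst w) * \<theta> (snd w)" for w
  note mp[measurable] = p(2,4) th(6)
  let ?\<Omega> = "E \<times> {0<..<T}" and ?W = "cball c R \<times> {t1..t2}" and ?G = "E \<times> {t1..t2}"
  have "continuous_on UNIV \<theta>"
    using th(1) by (intro continuous_at_imp_continuous_on ballI DERIV_isCont)
  then have m\<theta> [measurable]: "\<theta> \<in> borel_measurable borel" by (rule borel_measurable_continuous_onI)
  have m\<phi> [measurable]: "?\<phi> \<in> borel_measurable borel"
    by (intro borel_measurable_continuous_onI Ck_1_continuous Ck_1_bump)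
  have mg [measurable]: "grad ?\<phi> \<in> borel_measurable borel"
    unfolding grad_def
    by (intro borel_measurable_continuous_onI continuous_intros Ck_1D(2)[OF Ck_1_bump]) auto
  have WO: "?W \<subseteq> ?\<Omega>" using R t by auto
  have compW: "compact ?W" by (intro compact_Times) auto
  obtain M where M: "AE w in lebesgue. w \<in> ?W \<longrightarrow> \<bar>u w\<bar> \<le> M"
    using u_loc WO compW unfolding Linf_loc_def by blast
  \<comment> \<open>u and z are measurable only relative to \<open>?\<Omega>\<close>; their
    extensions by 0 are measurable everywhere and agree with them on \<open>?G\<close>.\<close>
  define u0 where "u0 w = indicator ?\<Omega> w *\<^sub>R u w" for w
  define z0 where "z0 w = indicator ?\<Omega> w *\<^sub>R z w" for w
  have u0 [measurable]: "u0 \<in> borel_measurable lebesgue"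
    using u_loc by (simp add: Linf_loc_def set_borel_measurable_def u0_def[abs_def])
  have z0 [measurable]: "z0 \<in> borel_measurable lebesgue"
    using z_meas by (simp add: set_borel_measurable_def z0_def[abs_def])
  have Gm [measurable]: "?G \<in> sets lebesgue" using E by (intro Times_sets) auto
  have fstm [measurable]: "fst \<in> borel_measurable (lebesgue :: ('a \<times> real) measure)"
    and sndm [measurable]: "snd \<in> borel_measurable (lebesgue :: ('a \<times> real) measure)"
    by (auto intro!: measurable_completion borel_measurable_continuous_onI continuous_intros)
  have GO: "w \<in> ?\<Omega>" if "w \<in> ?G" for w using that t by auto
  have Wi: "integrable lebesgue (\<lambda>w. k * indicator ?W w)" for k :: real
  proof -
    have "emeasure lborel ?W < \<infinity>" by (rule emeasure_compact_finite[OF compW])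
    moreover have "?W \<in> sets borel" using compW by (rule borel_compact)
    ultimately have "integrable lborel (\<lambda>w. k * indicator ?W w)"
      by (intro integrable_mult_right integrable_real_indicator) auto
    then show ?thesis
      using \<open>?W \<in> sets borel\<close> by (subst integrable_completion) auto
  qed
  have grad0: "grad ?\<phi> x = 0" if "x \<notin> cball c R" for x
    using norm_grad_bump(2)[of r R x c] R that by auto
  have \<phi>0: "?\<phi> x = 0" if "x \<notin> cball c R" for x
    using bump_eq_0[of r R x c] R that by auto
  show i1: "set_integrable lebesgue ?G F1"
    unfolding set_integrable_def
  proof (rule Bochner_Integration.integrable_bound[OF Wi[of "(\<bar>M\<bar> + \<bar>l\<bar>) * \<Theta>"]])
    have "(\<lambda>w. indicator ?G w *\<^sub>R (primitive p (u0 w - l) * (?\<phi> (fst w) * \<theta>' (snd w)))) \<in> borel_measurable lebesgue"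
      by measurable
    moreover have "indicator ?G w *\<^sub>R (primitive p (u0 w - l) * (?\<phi> (fst w) * \<theta>' (snd w))) = indicator ?G w *\<^sub>R F1 w" for w
      using GO[of w] by (auto simp: F1_def u0_def indicator_def)
    ultimately show "(\<lambda>w. indicator ?G w *\<^sub>R F1 w) \<in> borel_measurable lebesgue" by (simp only:)
    show "AE w in lebesgue. norm (indicator ?G w *\<^sub>R F1 w) \<le> norm ((\<bar>M\<bar> + \<bar>l\<bar>) * \<Theta> * indicator ?W w)"
      using M
    proof eventually_elim
      case (elim w)
      have "0 \<le> \<Theta>" using th(2,3)[of 0] by linarith
      show ?case
      proof (cases "w \<in> ?W")
        case True
        have "\<bar>primitive p (u w - l)\<bar> \<le> \<bar>M\<bar> + \<bar>l\<bar>" using p(5)[of "u w - l"] elim True by auto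
        moreover have "?\<phi> (fst w) * \<theta>' (snd w) \<le> \<Theta>"
          using mult_mono[OF bump_bounds(2)[of c r R "fst w"] th(3)[of "snd w"]] th(2) by simp
        moreover have "0 \<le> ?\<phi> (fst w) * \<theta>' (snd w)" using th(2) by (intro mult_nonneg_nonneg bump_bounds)
        ultimately have "\<bar>primitive p (u w - l)\<bar> * (?\<phi> (fst w) * \<theta>' (snd w)) \<le> (\<bar>M\<bar> + \<bar>l\<bar>) * \<Theta>"
          using \<open>0 \<le> \<Theta>\<close> by (intro mult_mono) simp_all
        then show ?thesis
          using True \<open>0 \<le> \<Theta>\<close> \<open>0 \<le> ?\<phi> (fst w) * \<theta>' (snd w)\<close> unfolding F1_def
            by (simp add: abs_mult indicator_def abs_of_nonneg[OF bump_bounds(1)] abs_of_nonneg[OF th(2)])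
      next
        case False
        then have "fst w \<notin> cball c R" if "w \<in> ?G"
          using that by (cases w) auto
        then have "indicator ?G w *\<^sub>R F1 w = 0"
          using \<phi>0[of "fst w"] by (cases "w \<in> ?G") (simp_all add: F1_def)
        then show ?thesis by (simp only: norm_zero norm_ge_zero)
      qed
    qed
  qed
  show i2: "set_integrable lebesgue ?G F2"
    unfolding set_integrable_def
  proof (rule Bochner_Integration.integrable_bound[OF Wi[of "8 / (R - r)"]])
    have "(\<lambda>w. indicator ?G w *\<^sub>R ((z0 w \<bullet> (\<theta> (snd w) *\<^sub>R grad ?\<phi> (fst w))) * p (u0 w - l))) \<in> borel_measurable lebesgue"
      by measurable
    moreover have "indicator ?G w *\<^sub>R ((z0 w \<bullet> (\<theta> (snd w) *\<^sub>R grad ?\<phi> (fst w))) * p (u0 w - l)) = indicator ?G w *\<^sub>R F2 w" for w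
      using GO[of w] by (auto simp: F2_def u0_def z0_def indicator_def)
    ultimately show "(\<lambda>w. indicator ?G w *\<^sub>R F2 w) \<in> borel_measurable lebesgue" by (simp only:)
    show "AE w in lebesgue. norm (indicator ?G w *\<^sub>R F2 w) \<le> norm (8 / (R - r) * indicator ?W w)"
      using z_le
    proof eventually_elim
      case (elim w)
      show ?case
      proof (cases "w \<in> ?W")
        case True
        then have "norm (z w) \<le> 1" using elim WO by blast
        have "\<bar>z w \<bullet> (\<theta> (snd w) *\<^sub>R grad ?\<phi> (fst w))\<bar> \<le> norm (z w) * norm (\<theta> (snd w) *\<^sub>R grad ?\<phi> (fst w))"
          by (rule Cauchy_Schwarz_ineq2)
        also have "\<dots> \<le> 1 * (1 * (8 / (R - r)))"
          unfolding norm_scaleR using \<open>norm (z w) \<le> 1\<close> th(4,5)[of "snd w"] R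
          by (intro mult_mono norm_grad_bump) auto
        finally have "\<bar>z w \<bullet> (\<theta> (snd w) *\<^sub>R grad ?\<phi> (fst w))\<bar> * \<bar>p (u w - l)\<bar> \<le> 8 / (R - r) * 1"
          using R by (intro mult_mono p(3)) auto
        then show ?thesis
          using True R unfolding F2_def by (simp add: abs_mult indicator_def)
      next
        case False
        then have "fst w \<notin> cball c R" if "w \<in> ?G"
          using that by (cases w) auto
        then have "indicator ?G w *\<^sub>R F2 w = 0"
          using grad0[of "fst w"] by (cases "w \<in> ?G") (simp_all add: F2_def)
        then show ?thesis by (simp only: norm_zero norm_ge_zero)
      qed
    qed
  qed
  have td: "time_deriv \<zeta> w = ?\<phi> (fst w) * \<theta>' (snd w)" for w
    unfolding time_deriv_def \<zeta>_def case_prod_unfold fst_conv snd_conv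
    by (rule DERIV_imp_deriv) (intro DERIV_cmult th(1))
  have sg: "space_grad \<zeta> w = \<theta> (snd w) *\<^sub>R grad ?\<phi> (fst w)" for w
    unfolding space_grad_def \<zeta>_def case_prod_unfold fst_conv snd_conv
    by (rule grad_mult_const) (rule differentiableI[OF bump_has_derivative])
  have \<zeta>C: "\<zeta> \<in> classC T E"
    unfolding classC_def
  proof (intro CollectI conjI ballI)
    show "0 \<le> \<zeta> w" for w unfolding \<zeta>_def by (intro mult_nonneg_nonneg bump_bounds th)
    show "(\<lambda>x. \<zeta> (x, t)) \<in> Ckc 1 E" for t
    proof (rule Ckc_supportI)
      show "Ck 1 (\<lambda>x. \<zeta> (x, t))" unfolding \<zeta>_def fst_conv snd_conv by (intro Ck_1_mult Ck_1_bump Ck_1_const)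
      show "{x. \<zeta> (x, t) \<noteq> 0} \<subseteq> cball c R"
      proof
        fix x assume "x \<in> {x. \<zeta> (x, t) \<noteq> 0}"
        then have "?\<phi> x \<noteq> 0" by (simp add: \<zeta>_def)
        then show "x \<in> cball c R" using \<phi>0[of x] by blast
      qed
    qed (use R in auto)
    show "\<exists>d\<ge>0. ((\<lambda>s. \<zeta> (x, s)) has_real_derivative d) (at t)" for x t
      unfolding \<zeta>_def fst_conv snd_conv
      by (intro exI[of _ "?\<phi> x * \<theta>' t"] conjI DERIV_cmult th(1) mult_nonneg_nonneg bump_bounds th(2))
  qed
  have F1eq: "primitive p (u w - l) * time_deriv \<zeta> w = F1 w"
    and F2eq: "(z w \<bullet> space_grad \<zeta> w) * p (u w - l) = F2 w" for w
    unfolding td sg F1_def F2_def by simp_all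
  have "0 < t1 \<and> t1 \<le> t2 \<and> t2 < T" using t by simp
  from energy[unfolded energy_ineq_def, rule_format, OF p(1) \<zeta>C this, of l] i1 i2
  show "ereal (LINT x:E|lebesgue. primitive p (u (x, t2) - l) * (bump c r R x * \<theta> t2))
        + enn2ereal (\<integral>\<^sup>+t\<in>{t1..t2}. (\<integral>\<^sup>+x. ennreal (bump c r R x * \<theta> t) \<partial>tv_measure E (\<lambda>x. p (u (x, t) - l))) \<partial>lebesgue)
      \<le> ereal ((LINT x:E|lebesgue. primitive p (u (x, t1) - l) * (bump c r R x * \<theta> t1))
        + (LINT w:E \<times> {t1..t2}|lebesgue. F1 w) - (LINT w:E \<times> {t1..t2}|lebesgue. F2 w))"
    unfolding F1eq F2eq by (simp add: \<zeta>_def)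
qed

end

text \<open>The energy inequality integrates over closed time intervals, the Caccioppoli inequality
  measures level sets over open ones; this removes the end time.\<close>

lemma AE_snd_neq: "AE w in (lborel :: ('a::euclidean_space \<times> real) measure). snd w \<noteq> b"
proof -
  have "emeasure (lborel \<Otimes>\<^sub>M lborel) (UNIV \<times> {b} :: ('a \<times> real) set)
      = emeasure lborel (UNIV :: 'a set) * emeasure lborel {b}"
    by (rule lborel.emeasure_pair_measure_Times) auto
  then have "emeasure lborel (UNIV \<times> {b} :: ('a \<times> real) set) = 0"
    by (simp add: lborel_prod)
  moreover have "(UNIV \<times> {b} :: ('a \<times> real) set) \<in> sets borel"
    by (intro borel_closed closed_Times) auto
  ultimately show ?thesis
    by (intro AE_I[of _ _ "UNIV \<times> {b}"]) auto
qed

text \<open>The ramp and its primitive vanish below the level, so the right-hand side lives on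
  \<open>?A\<close>, where its integrand is at most \<open>\<kappa>\<close>: M times the slope of
  the time cutoff plus the slope of the space cutoff.\<close>

lemma (in one_laplacian) caccioppoli_representative:
  assumes U [measurable]: "U \<in> borel_measurable borel"
    and s: "0 < s1" "s2 < T" and ball: "cball c \<rho> \<subseteq> E"
    and uU: "AE w in lborel. w \<in> ball c \<rho> \<times> {s1<..<s2} \<longrightarrow> u w = U w"
  shows "caccioppoli c \<rho> s1 s2 U"
  unfolding caccioppoli_def
proof (intro allI impI)
  fix k d r R a1 a2 b M :: real and K :: ennreal
  assume d: "0 < d" and r: "0 < r" "r < R" "R \<le> \<rho>" and t: "s1 \<le> a1" "a1 < a2" "a2 < b" "b \<le> s2"
    and M: "0 \<le> M" "AE w in lborel. w \<in> ball c R \<times> {a1<..<b} \<longrightarrow> U w - k \<le> M"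
    and K: "K = ennreal (4 * M / (a2 - a1) + 8 / (R - r)) * emeasure lborel {w \<in> ball c R \<times> {a1<..<b}. U w > k}"
  let ?p = "ramp d" and ?P = "primitive (ramp d)" and ?\<phi> = "bump c r R"
  \<comment> \<open>Zero at a1, so the initial term drops out; 1 from a2 on, so nothing is lost on
    the smaller cylinder.\<close>
  let ?\<theta> = "\<lambda>t. step_fun ((t - a1) / (a2 - a1))"
  let ?\<theta>' = "\<lambda>t. step_deriv ((t - a1) / (a2 - a1)) / (a2 - a1)"
  let ?A = "{w \<in> ball c R \<times> {a1<..<b}. U w > k}"
  define \<kappa> where "\<kappa> = 4 * M / (a2 - a1) + 8 / (R - r)"
  have \<kappa>0: "0 \<le> \<kappa>" unfolding \<kappa>_def using M t r by (intro add_nonneg_nonneg divide_nonneg_pos) auto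
  have cR: "cball c R \<subseteq> E" using subset_cball[OF r(3)] ball by blast
  have bR: "ball c R \<subseteq> ball c \<rho>" using r(3) by (rule subset_ball)
  have [measurable]: "ball c R \<times> {a1<..<b} \<in> sets borel" by (intro borel_open open_Times) auto
  have Am [measurable]: "?A \<in> sets borel" by measurable
  have "emeasure lborel ?A \<le> emeasure lborel (cball c R \<times> {a1..b})"
    by (intro emeasure_mono) (auto intro!: borel_closed closed_Times)
  also have "\<dots> < \<infinity>"
    by (intro emeasure_compact_finite compact_Times) auto
  finally have Afin: "emeasure lborel ?A < \<infinity>" .
  define \<mu> where "\<mu> = measure lborel ?A"
  have \<mu>: "emeasure lborel ?A = ennreal \<mu>" "0 \<le> \<mu>"
    using Afin by (auto simp: \<mu>_def emeasure_eq_ennreal_measure)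
  have Keq: "K = ennreal (\<kappa> * \<mu>)"
    unfolding K \<kappa>_def[symmetric] \<mu>(1) using \<kappa>0 \<mu>(2) by (simp add: ennreal_mult)
  have P_abs: "\<bar>?P s\<bar> \<le> \<bar>s\<bar>" for s
    using primitive_ramp_nonneg[OF d, of s] primitive_ramp_bounds(1)[OF d, of s] by auto
  have p_abs: "\<bar>?p s\<bar> \<le> 1" for s
    using ramp_bounds[of d s] by auto
  have th1: "(?\<theta> has_real_derivative ?\<theta>' t) (at t)" for t
  proof -
    have "((\<lambda>t. (t - a1) / (a2 - a1)) has_real_derivative 1 / (a2 - a1)) (at t)"
      using t(2) by (auto intro!: derivative_eq_intros)
    from DERIV_chain2[OF has_real_derivative_step_fun this] show ?thesis by simp
  qed
  have th2: "0 \<le> ?\<theta>' t" "?\<theta>' t \<le> 4 / (a2 - a1)" for t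
    using t(2) step_deriv_bounds by (auto intro!: divide_right_mono)
  have th3: "?\<theta>' \<in> borel_measurable borel"
    by (intro borel_measurable_continuous_onI continuous_intros continuous_on_compose2[OF continuous_on_step_deriv[of UNIV]])
      (use t in auto)
  note cutoff = energy_cutoff[where p = "ramp d" and l = k and c = c and r = r and R = R and \<theta> = ?\<theta> and \<theta>' = ?\<theta>'
      and \<Theta> = "4 / (a2 - a1)" and ?t1.0 = a1, OF classP_ramp[OF d] borel_measurable_ramp p_abs
      borel_measurable_primitive_ramp[OF d] P_abs r(1,2) cR _ _ _ th1 th2 step_fun_bounds th3]
  \<comment> \<open>The end time stays free: t2 = t gives the mean square at time t, and t2 = b
    gives the space-time variation.\<close>
  have main: "0 \<le> (LINT x:E|lebesgue. ?P (u (x, t2) - k) * (?\<phi> x * ?\<theta> t2))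
      \<and> (LINT x:E|lebesgue. ?P (u (x, t2) - k) * (?\<phi> x * ?\<theta> t2)) \<le> \<kappa> * \<mu>
      \<and> (\<integral>\<^sup>+t\<in>{a1..t2}. (\<integral>\<^sup>+x. ennreal (?\<phi> x * ?\<theta> t) \<partial>tv_measure E (\<lambda>x. ?p (u (x, t) - k))) \<partial>lebesgue)
        \<le> ennreal (\<kappa> * \<mu>)" (is "0 \<le> ?X \<and> ?X \<le> _ \<and> ?Y \<le> _")
    if t2: "a1 \<le> t2" "t2 \<le> b" for t2
  proof -
    let ?F1 = "\<lambda>w. ?P (u w - k) * (?\<phi> (fst w) * ?\<theta>' (snd w))"
    let ?F2 = "\<lambda>w. (z w \<bullet> (?\<theta> (snd w) *\<^sub>R grad ?\<phi> (fst w))) * ?p (u w - k)"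
    let ?G = "E \<times> {a1..t2}"
    have tt: "0 < a1" "a1 \<le> t2" "t2 < T" using s t t2 by auto
    note ct = cutoff[OF tt]
    have X0: "0 \<le> ?X"
      unfolding set_lebesgue_integral_def
      by (intro Bochner_Integration.integral_nonneg) (simp add: primitive_ramp_nonneg[OF d] bump_bounds step_fun_bounds)
    have start: "(LINT x:E|lebesgue. ?P (u (x, a1) - k) * (?\<phi> x * ?\<theta> a1)) = 0"
      by (simp add: step_fun_eq_0)
    have "(LINT w:?G|lebesgue. ?F1 w) - (LINT w:?G|lebesgue. ?F2 w)
        = (LINT w|lebesgue. indicator ?G w *\<^sub>R ?F1 w - indicator ?G w *\<^sub>R ?F2 w)"
      unfolding set_lebesgue_integral_def
      using ct(1,2) unfolding set_integrable_def by (rule Bochner_Integration.integral_diff[symmetric])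
    also have "\<dots> \<le> (LINT w|lebesgue. \<kappa> * indicator ?A w)"
    proof (rule integral_mono_AE)
      show "integrable lebesgue (\<lambda>w. indicator ?G w *\<^sub>R ?F1 w - indicator ?G w *\<^sub>R ?F2 w)"
        using ct(1,2) unfolding set_integrable_def by (rule Bochner_Integration.integrable_diff)
      show "integrable lebesgue (\<lambda>w. \<kappa> * indicator ?A w)"
        using Afin Am by (subst integrable_completion) auto
      have uU': "AE w in lebesgue. w \<in> ball c \<rho> \<times> {s1<..<s2} \<longrightarrow> u w = U w"
        using uU by (rule AE_completion)
      have M': "AE w in lebesgue. w \<in> ball c R \<times> {a1<..<b} \<longrightarrow> U w - k \<le> M"
        using M(2) by (rule AE_completion)
      have b': "AE w in lebesgue. snd w \<noteq> b"
        using AE_snd_neq by (rule AE_completion)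
      show "AE w in lebesgue. indicator ?G w *\<^sub>R ?F1 w - indicator ?G w *\<^sub>R ?F2 w \<le> \<kappa> * indicator ?A w"
        using uU' M' b' z_le
      proof eventually_elim
        case (elim w)
        have rhs: "0 \<le> \<kappa> * indicator ?A w" using \<kappa>0 by simp
        show ?case
        \<comment> \<open>At time a1 the time cutoff and its derivative both vanish, so that
          endpoint contributes nothing; b is excluded as a null set.\<close>
        proof (cases "w \<in> ?G \<and> fst w \<in> ball c R \<and> snd w \<noteq> a1")
          case False
          then consider "w \<notin> ?G" | "fst w \<notin> ball c R" | "snd w = a1" by blast
          then have "indicator ?G w *\<^sub>R ?F1 w = 0 \<and> indicator ?G w *\<^sub>R ?F2 w = 0"
          proof cases
            case 1 then show ?thesis by simp
          next
            case 2
            then show ?thesis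
              using bump_eq_0[of r R "fst w" c] norm_grad_bump(2)[of r R "fst w" c] r by simp
          next
            case 3
            then show ?thesis by (simp add: step_fun_eq_0 step_deriv_def)
          qed
          then show ?thesis using rhs by (elim conjE) (simp only: diff_self)
        next
          case True
          then have w: "w \<in> ball c R \<times> {a1<..<b}"
            using elim(3) t2 by (cases w) auto
          then have "w \<in> ball c \<rho> \<times> {s1<..<s2}" using bR t by (cases w) auto
          then have uw: "u w = U w" using elim(1) by blast
          show ?thesis
          proof (cases "U w > k")
            case False
            then have "?P (u w - k) = 0" "?p (u w - k) = 0"
              using primitive_ramp_nonneg[OF d, of "u w - k"] primitive_ramp_bounds(1)[OF d, of "u w - k"] d
              by (auto simp: uw ramp_def divide_nonpos_pos)
            then show ?thesis using rhs by simp
          next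
            case Uk: True
            then have wA: "w \<in> ?A" using w by simp
            have PM: "?P (u w - k) \<le> M"
              using primitive_ramp_bounds(1)[OF d, of "u w - k"] elim(2) w Uk by (auto simp: uw)
            have pt: "?\<phi> (fst w) * ?\<theta>' (snd w) \<le> 1 * (4 / (a2 - a1))"
              using th2[of "snd w"] by (intro mult_mono bump_bounds) auto
            have f1: "?F1 w \<le> M * (1 * (4 / (a2 - a1)))"
              using mult_mono[OF PM pt M(1) mult_nonneg_nonneg[OF bump_bounds(1) th2(1)]] .
            have f1': "M * (1 * (4 / (a2 - a1))) = 4 * M / (a2 - a1)" by simp
            have "norm (z w) \<le> 1"
              using elim(4) \<open>w \<in> ?G \<and> fst w \<in> ball c R \<and> snd w \<noteq> a1\<close> tt by (cases w) auto
            have "\<bar>z w \<bullet> (?\<theta> (snd w) *\<^sub>R grad ?\<phi> (fst w))\<bar> \<le> norm (z w) * norm (?\<theta> (snd w) *\<^sub>R grad ?\<phi> (fst w))"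
              by (rule Cauchy_Schwarz_ineq2)
            also have "\<dots> \<le> 1 * (1 * (8 / (R - r)))"
              unfolding norm_scaleR using \<open>norm (z w) \<le> 1\<close> step_fun_bounds r
              by (intro mult_mono norm_grad_bump) auto
            finally have "\<bar>z w \<bullet> (?\<theta> (snd w) *\<^sub>R grad ?\<phi> (fst w))\<bar> * \<bar>?p (u w - k)\<bar> \<le> 8 / (R - r) * 1"
              using r by (intro mult_mono p_abs) auto
            then have "\<bar>?F2 w\<bar> \<le> 8 / (R - r)" by (simp add: abs_mult)
            then have f2: "- ?F2 w \<le> 8 / (R - r)" by linarith
            have "?F1 w - ?F2 w \<le> \<kappa>" using add_mono[OF f1 f2] unfolding \<kappa>_def f1' by (simp only: add_uminus_conv_diff)
            then show ?thesis
              using True wA by (simp only: indicator_simps scaleR_one mult_1_right simp_thms)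
          qed
        qed
      qed
    qed
    also have "(LINT w|lebesgue. \<kappa> * indicator ?A w) = \<kappa> * \<mu>"
      using Am by (subst integral_completion) (auto simp: \<mu>_def)
    finally have le: "(LINT w:?G|lebesgue. ?F1 w) - (LINT w:?G|lebesgue. ?F2 w) \<le> \<kappa> * \<mu>" .
    have sum: "ereal ?X + enn2ereal ?Y \<le> ereal (\<kappa> * \<mu>)"
      using ct(3) le unfolding start by (elim order_trans) simp
    \<comment> \<open>Both summands on the left are nonnegative, so each alone obeys the
      bound.\<close>
    have e: "ereal ?X \<le> ereal (\<kappa> * \<mu>)" "enn2ereal ?Y \<le> ereal (\<kappa> * \<mu>)"
      using order_trans[OF add_increasing2[OF enn2ereal_nonneg order_refl] sum]
        order_trans[OF add_increasing[OF _ order_refl] sum] X0 by auto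
    have "?Y \<le> ennreal (\<kappa> * \<mu>)"
      using e(2) \<kappa>0 \<mu>(2) by (simp add: less_eq_ennreal.rep_eq)
    then show ?thesis using X0 e(1) by simp
  qed
  have slices: "AE t in lborel. AE x in lborel. (x, t) \<in> ball c \<rho> \<times> {s1<..<s2} \<longrightarrow> u (x, t) = U (x, t)"
    using uU by (rule AE_lborel_slices)
  have um: "(\<lambda>x. indicator E x *\<^sub>R u (x, t)) \<in> borel_measurable lebesgue" if "t \<in> {0<..<T}" for t
    using u_int[OF that] by (auto simp: set_integrable_def)
  show "(AE t in lborel. t \<in> {a2<..<b} \<longrightarrow>
        (\<integral>\<^sup>+x\<in>ball c r. ennreal ((ramp d (U (x, t) - k))\<^sup>2) \<partial>lborel) \<le> ennreal (2 / d) * K) \<and>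
      (\<integral>\<^sup>+t\<in>{a2<..<b}. total_variation (\<lambda>x. ramp d (U (x, t) - k)) (ball c r) \<partial>lborel) \<le> K"
  proof
    show "AE t in lborel. t \<in> {a2<..<b} \<longrightarrow>
        (\<integral>\<^sup>+x\<in>ball c r. ennreal ((ramp d (U (x, t) - k))\<^sup>2) \<partial>lborel) \<le> ennreal (2 / d) * K"
      using slices
    proof eventually_elim
      case (elim t0)
      show ?case
      proof
        assume t0: "t0 \<in> {a2<..<b}"
        then have T0: "t0 \<in> {0<..<T}" using s t by auto
        have \<theta>1: "?\<theta> t0 = 1" using t0 t by (intro step_fun_eq_1) (auto simp: field_simps)
        let ?f = "\<lambda>x. indicator E x *\<^sub>R (?P (u (x, t0) - k) * (?\<phi> x * 1))"
        have ui: "integrable lebesgue (\<lambda>x. indicator E x *\<^sub>R u (x, t0))"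
          using u_int[OF T0] by (simp add: set_integrable_def)
        have fi: "integrable lebesgue ?f"
        proof (rule Bochner_Integration.integrable_bound)
          have "integrable lborel (\<lambda>x. \<bar>k\<bar> * indicator (cball c R) x)"
            by (intro integrable_mult_right integrable_real_indicator) (auto simp: emeasure_lborel_ball_finite)
          then have "integrable lebesgue (\<lambda>x. \<bar>k\<bar> * indicator (cball c R) x)"
            by (subst integrable_completion) auto
          then show "integrable lebesgue (\<lambda>x. \<bar>indicator E x *\<^sub>R u (x, t0)\<bar> + \<bar>k\<bar> * indicator (cball c R) x)"
            using ui by (intro Bochner_Integration.integrable_add integrable_abs)
          have [measurable]: "(\<lambda>x. indicator E x *\<^sub>R u (x, t0)) \<in> borel_measurable lebesgue" by (rule um[OF T0])
          have [measurable]: "?\<phi> \<in> borel_measurable lebesgue"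
            by (intro measurable_completion) (simp, intro borel_measurable_continuous_onI Ck_1_continuous Ck_1_bump)
          have [measurable]: "E \<in> sets lebesgue" using E by simp
          note borel_measurable_primitive_ramp[OF d, measurable]
          have "(\<lambda>x. indicator E x *\<^sub>R (?P (indicator E x *\<^sub>R u (x, t0) - k) * (?\<phi> x * 1))) \<in> borel_measurable lebesgue"
            by measurable
          moreover have "(\<lambda>x. indicator E x *\<^sub>R (?P (indicator E x *\<^sub>R u (x, t0) - k) * (?\<phi> x * 1))) = ?f"
            by (auto simp: fun_eq_iff indicator_def)
          ultimately show "?f \<in> borel_measurable lebesgue" by (simp only:)
          have "norm (?f x) \<le> \<bar>indicator E x *\<^sub>R u (x, t0)\<bar> + \<bar>k\<bar> * indicator (cball c R) x" for x
          proof (cases "x \<in> E \<and> x \<in> ball c R")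
            case True
            have "\<bar>?P (u (x, t0) - k)\<bar> * ?\<phi> x \<le> (\<bar>u (x, t0)\<bar> + \<bar>k\<bar>) * 1"
              using P_abs[of "u (x, t0) - k"] by (intro mult_mono bump_bounds) auto
            then show ?thesis using True by (simp add: abs_mult abs_of_nonneg[OF bump_bounds(1)])
          next
            case False
            then have "?f x = 0" using bump_eq_0[of r R x c] r by (auto simp: indicator_def)
            then show ?thesis by (simp only: norm_zero) simp
          qed
          then show "AE x in lebesgue. norm (?f x) \<le> norm (\<bar>indicator E x *\<^sub>R u (x, t0)\<bar> + \<bar>k\<bar> * indicator (cball c R) x)"
            by (intro AE_I2) (auto intro: order_trans)
        qed
        have f0: "0 \<le> ?f x" for x
          by (simp add: primitive_ramp_nonneg[OF d] bump_bounds)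
        have "(\<integral>\<^sup>+x\<in>ball c r. ennreal ((ramp d (U (x, t0) - k))\<^sup>2) \<partial>lborel)
            \<le> (\<integral>\<^sup>+x. ennreal (2 / d) * ennreal (?f x) \<partial>lborel)"
        proof (rule nn_integral_mono_AE, use elim in eventually_elim)
          case (elim x)
          show ?case
          proof (cases "x \<in> ball c r")
            case True
            then have "x \<in> cball c R" "x \<in> ball c \<rho>" "x \<in> cball c r" using r by auto
            then have "x \<in> E" "u (x, t0) = U (x, t0)" using cR elim t0 t by auto
            moreover have "?\<phi> x = 1" using bump_eq_1[of r R x c] r \<open>x \<in> cball c r\<close> by simp
            moreover have "(ramp d (U (x, t0) - k))\<^sup>2 \<le> 2 / d * ?P (U (x, t0) - k)"
              using primitive_ramp_bounds(2)[OF d, of "U (x, t0) - k"] d by (simp add: field_simps)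
            ultimately show ?thesis
              using True d primitive_ramp_nonneg[OF d]
              by (simp add: ennreal_mult[symmetric] ennreal_leI del: times_divide_eq_left)
          qed simp
        qed
        also have "\<dots> = ennreal (2 / d) * (\<integral>\<^sup>+x. ennreal (?f x) \<partial>lborel)"
          using d by (intro nn_integral_cmult_nonmeasurable) simp
        also have "(\<integral>\<^sup>+x. ennreal (?f x) \<partial>lborel) = (\<integral>\<^sup>+x. ennreal (?f x) \<partial>lebesgue)"
          by (rule nn_integral_completion[symmetric])
        also have "\<dots> = ennreal (LINT x|lebesgue. ?f x)"
          using fi f0 by (intro nn_integral_eq_integral) auto
        also have "\<dots> \<le> K"
          using main[of t0] t0 t unfolding \<theta>1 set_lebesgue_integral_def Keq by (intro ennreal_leI) auto
        finally show "(\<integral>\<^sup>+x\<in>ball c r. ennreal ((ramp d (U (x, t0) - k))\<^sup>2) \<partial>lborel) \<le> ennreal (2 / d) * K"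
          by (simp add: mult_left_mono)
      qed
    qed
    have "(\<integral>\<^sup>+t\<in>{a2<..<b}. total_variation (\<lambda>x. ramp d (U (x, t) - k)) (ball c r) \<partial>lborel)
        \<le> (\<integral>\<^sup>+t\<in>{a1..b}. (\<integral>\<^sup>+x. ennreal (?\<phi> x * ?\<theta> t) \<partial>tv_measure E (\<lambda>x. ?p (u (x, t) - k))) \<partial>lborel)"
    proof (rule nn_integral_mono_AE, use slices in eventually_elim)
      case (elim t0)
      show ?case
      proof (cases "t0 \<in> {a2<..<b}")
        case t0: True
        then have T0: "t0 \<in> {0<..<T}" using s t by auto
        have \<theta>1: "?\<theta> t0 = 1" using t0 t by (intro step_fun_eq_1) (auto simp: field_simps)
        have br: "ball c r \<subseteq> E" using cR r by (auto simp: subset_eq)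
        have ri: "set_integrable lebesgue E (\<lambda>x. ramp d (u (x, t0) - k))"
          using slice_BV[OF classP_ramp[OF d] T0, of k] by (simp add: BV_def)
        have "AE x in lborel. x \<in> ball c r \<longrightarrow> ramp d (u (x, t0) - k) = ramp d (U (x, t0) - k)"
          using elim by eventually_elim (use t0 t r in auto)
        then have "total_variation (\<lambda>x. ramp d (U (x, t0) - k)) (ball c r) = total_variation (\<lambda>x. ramp d (u (x, t0) - k)) (ball c r)"
          by (intro total_variation_borel_representative[OF ri _ open_ball br, symmetric]) measurable
        also have "\<dots> \<le> (\<integral>\<^sup>+x. ennreal (?\<phi> x * ?\<theta> t0) \<partial>tv_measure E (\<lambda>x. ?p (u (x, t0) - k)))"
          unfolding \<theta>1
        proof (rule total_variation_le_nn_integral[OF E ri open_ball br])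
          show "1 \<le> ?\<phi> x * 1" if "x \<in> ball c r" for x
            using bump_eq_1[of r R x c] r that by simp
        qed
        finally show ?thesis using t0 t by simp
      qed simp
    qed
    also have "\<dots> \<le> K"
      using main[of b] t unfolding Keq nn_integral_completion by auto
    finally show "(\<integral>\<^sup>+t\<in>{a2<..<b}. total_variation (\<lambda>x. ramp d (U (x, t) - k)) (ball c r) \<partial>lborel) \<le> K" .
  qed
qed

text \<open>With constant p and a cutoff independent of time only the flux term remains, and it is
  at most the gradient bound times the measure of the cylinder.\<close>

lemma (in one_laplacian) mean_lipschitz:
  assumes r: "0 < r" "r < R" "cball c R \<subseteq> E" and t: "0 < t1" "t1 \<le> t2" "t2 < T"
  shows "\<bar>(LINT x:E|lebesgue. u (x, t2) * bump c r R x) - (LINT x:E|lebesgue. u (x, t1) * bump c r R x)\<bar>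
    \<le> 8 / (R - r) * measure lborel (ball c R) * (t2 - t1)"
proof -
  define m where "m t = (LINT x:E|lebesgue. u (x, t) * bump c r R x)" for t
  let ?W = "cball c R \<times> {t1..t2}"
  have W: "measure lborel ?W = measure lborel (ball c R) * (t2 - t1)"
  proof -
    have "emeasure (lborel \<Otimes>\<^sub>M lborel) ?W = emeasure lborel (cball c R) * emeasure lborel {t1..t2}"
      by (rule lborel.emeasure_pair_measure_Times) auto
    then show ?thesis
      using r t by (simp add: lborel_prod measure_def enn2real_mult content_cball content_ball emeasure_cball emeasure_ball)
  qed
  have Wm: "?W \<in> sets borel" by (intro borel_closed closed_Times) auto
  have Wf: "emeasure lborel ?W < \<infinity>" by (intro emeasure_compact_finite compact_Times) auto
  \<comment> \<open>The energy inequality is one-sided; the two signs of the constant give the two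
    directions.\<close>
  have *: "q * m t2 \<le> q * m t1 + 8 / (R - r) * measure lborel ?W" if q: "q = 1 \<or> q = -1" for q :: real
  proof -
    let ?F1 = "\<lambda>w::'a \<times> real. primitive (\<lambda>s. q) (u w - 0) * (bump c r R (fst w) * 0)"
    let ?F2 = "\<lambda>w. (z w \<bullet> (1 *\<^sub>R grad (bump c r R) (fst w))) * q"
    have ct: "set_integrable lebesgue (E \<times> {t1..t2}) ?F2"
      "ereal (LINT x:E|lebesgue. primitive (\<lambda>s. q) (u (x, t2) - 0) * (bump c r R x * 1))
        + enn2ereal (\<integral>\<^sup>+t\<in>{t1..t2}. (\<integral>\<^sup>+x. ennreal (bump c r R x * 1) \<partial>tv_measure E (\<lambda>x. q)) \<partial>lebesgue)
      \<le> ereal ((LINT x:E|lebesgue. primitive (\<lambda>s. q) (u (x, t1) - 0) * (bump c r R x * 1))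
        + (LINT w:E \<times> {t1..t2}|lebesgue. ?F1 w) - (LINT w:E \<times> {t1..t2}|lebesgue. ?F2 w))"
      by (rule energy_cutoff[where p = "\<lambda>s. q" and \<theta> = "\<lambda>t. 1" and \<theta>' = "\<lambda>t. 0" and \<Theta> = 0 and l = 0];
          use classP_const q r t in \<open>auto simp: primitive_const[abs_def]\<close>)+
    have "- (LINT w:E \<times> {t1..t2}|lebesgue. ?F2 w) = (LINT w|lebesgue. - (indicator (E \<times> {t1..t2}) w *\<^sub>R ?F2 w))"
      unfolding set_lebesgue_integral_def by (rule Bochner_Integration.integral_minus[symmetric])
    also have "\<dots> \<le> (LINT w|lebesgue. 8 / (R - r) * indicator ?W w)"
    proof (rule integral_mono_AE)
      show "integrable lebesgue (\<lambda>w. - (indicator (E \<times> {t1..t2}) w *\<^sub>R ?F2 w))"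
        using ct(1) unfolding set_integrable_def by (rule Bochner_Integration.integrable_minus)
      show "integrable lebesgue (\<lambda>w. 8 / (R - r) * indicator ?W w)"
        using Wm Wf by (subst integrable_completion) auto
      show "AE w in lebesgue. - (indicator (E \<times> {t1..t2}) w *\<^sub>R ?F2 w) \<le> 8 / (R - r) * indicator ?W w"
        using z_le
      proof eventually_elim
        case (elim w)
        show ?case
        proof (cases "w \<in> E \<times> {t1..t2} \<and> fst w \<in> ball c R")
          case True
          then have w: "w \<in> ?W" by (cases w) auto
          have "norm (z w) \<le> 1" using elim True t by (cases w) auto
          have "\<bar>z w \<bullet> grad (bump c r R) (fst w)\<bar> \<le> norm (z w) * norm (grad (bump c r R) (fst w))"
            by (rule Cauchy_Schwarz_ineq2)
          also have "\<dots> \<le> 1 * (8 / (R - r))"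
            using \<open>norm (z w) \<le> 1\<close> r by (intro mult_mono norm_grad_bump) auto
          finally show ?thesis using True w q by auto
        next
          case False
          then have "indicator (E \<times> {t1..t2}) w *\<^sub>R ?F2 w = 0"
            using norm_grad_bump(2)[of r R "fst w" c] r by (auto simp: indicator_def)
          then show ?thesis using r by (simp only:) simp
        qed
      qed
    qed
    also have "(LINT w|lebesgue. 8 / (R - r) * indicator ?W w) = 8 / (R - r) * measure lborel ?W"
      using Wm by (subst integral_completion) auto
    finally have F2: "- (LINT w:E \<times> {t1..t2}|lebesgue. ?F2 w) \<le> 8 / (R - r) * measure lborel ?W" .
    have F1: "(LINT w:E \<times> {t1..t2}|lebesgue. ?F1 w) = 0" by simp
    have m: "(LINT x:E|lebesgue. primitive (\<lambda>s. q) (u (x, t) - 0) * (bump c r R x * 1)) = q * m t" for t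
      by (simp add: primitive_const m_def mult.assoc)
    have "ereal (q * m t2) \<le> ereal (q * m t1 + 0 - (LINT w:E \<times> {t1..t2}|lebesgue. ?F2 w))"
      by (rule order_trans[OF add_increasing2[OF enn2ereal_nonneg order_refl] ct(2)[unfolded m F1]])
    then show ?thesis using F2 by simp
  qed
  have "\<bar>m t2 - m t1\<bar> \<le> 8 / (R - r) * measure lborel ?W"
    using *[of 1] *[of "-1"] by auto
  then show ?thesis unfolding W m_def by (simp add: mult.assoc)
qed

section \<open>Symmetry under passing from (u, z) to (-u, -z)\<close>

lemma primitive_reflect: "primitive (\<lambda>s. - p (- s)) w = primitive p (- w)"
proof -
  have "primitive (\<lambda>s. - p (- s)) w = (LBINT s=ereal 0..ereal w. - p (- s))"
    by (simp add: primitive_def zero_ereal_def)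
  also have "\<dots> = (LBINT s=- ereal w..- ereal 0. - p s)"
    by (subst interval_integral_reflect) simp
  also have "\<dots> = - (LBINT s=- ereal w..- ereal 0. p s)"
    by (rule interval_lebesgue_integral_uminus)
  also have "\<dots> = (LBINT s=- ereal 0..- ereal w. p s)"
    by (subst interval_integral_endpoints_reverse) simp
  finally show ?thesis by (simp add: primitive_def zero_ereal_def)
qed

text \<open>The inner sign reverses monotonicity and the outer one restores it.\<close>

lemma classP_reflect:
  assumes "p \<in> classP"
  shows "(\<lambda>s. - p (- s)) \<in> classP"
proof -
  obtain L K where L: "L-lipschitz_on UNIV p" and m: "mono p" and K: "compact K"
    and ae: "AE s in lborel. s \<notin> K \<longrightarrow> (p has_real_derivative 0) (at s)"
    using assms unfolding classP_def by blast
  have "L-lipschitz_on UNIV (\<lambda>s. - p (- s))"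
    unfolding lipschitz_on_def
  proof (intro conjI ballI)
    show "0 \<le> L" using L by (auto simp: lipschitz_on_def)
    fix x y :: real
    have "dist (p (- x)) (p (- y)) \<le> L * dist (- x) (- y)" using L by (auto simp: lipschitz_on_def)
    then show "dist (- p (- x)) (- p (- y)) \<le> L * dist x y" by (simp add: dist_minus)
  qed
  moreover have "mono (\<lambda>s. - p (- s))" using m by (auto simp: mono_def)
  moreover have "compact (uminus ` K)" using K by (rule compact_negations)
  moreover have "AE s in lborel. s \<notin> uminus ` K \<longrightarrow> ((\<lambda>s. - p (- s)) has_real_derivative 0) (at s)"
  proof -
    have "AE s in distr lborel borel uminus. s \<notin> K \<longrightarrow> (p has_real_derivative 0) (at s)"
      unfolding lborel_distr_uminus by (rule ae)
    then have "AE s in lborel. - s \<notin> K \<longrightarrow> (p has_real_derivative 0) (at (- s))"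
      by (rule AE_distrD[rotated]) simp
    then show ?thesis
    proof eventually_elim
      case (elim s)
      show ?case
      proof
        assume "s \<notin> uminus ` K"
        then have "- s \<notin> K" by (metis image_eqI minus_minus)
        then have "(p has_real_derivative 0) (at (- s))" using elim by simp
        moreover have "(uminus has_real_derivative - 1) (at s)" by (auto intro!: derivative_eq_intros)
        ultimately have "((\<lambda>s. p (- s)) has_real_derivative 0 * - 1) (at s)"
          by (rule DERIV_chain2)
        from DERIV_minus[OF this]
        show "((\<lambda>s. - p (- s)) has_real_derivative 0) (at s)" by simp
      qed
    qed
  qed
  ultimately show ?thesis unfolding classP_def by blast
qed

lemma tv_measure_uminus: "tv_measure E (\<lambda>x. - v x) = tv_measure E v"
  unfolding tv_measure_def total_variation_uminus ..

text \<open>The inequality for -u with p at level l is the one for u with the reflected function q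
  at level -l: the primitives agree, the sign of q cancels that of z, and total variation ignores
  signs. Hence upper bounds alone suffice.\<close>

lemma (in one_laplacian) one_laplacian_uminus: "one_laplacian E T (\<lambda>w. - u w) (\<lambda>w. - z w)"
proof
  show "open E" by (rule E)
  show "(\<lambda>w. - u w) \<in> Linf_loc (E \<times> {0<..<T})"
    using u_loc unfolding Linf_loc_def set_borel_measurable_def by auto
  show "set_integrable lebesgue E (\<lambda>x. - u (x, t))" if "t \<in> {0<..<T}" for t
    using u_int[OF that] unfolding set_integrable_def by simp
  show "(\<lambda>x. p (- u (x, t))) \<in> BV E" if "p \<in> classP" "t \<in> {0<..<T}" for p t
  proof -
    have "(\<lambda>x. - p (- u (x, t))) \<in> BV E"
      using u_BV[OF classP_reflect[OF that(1)] that(2)] .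
    then show ?thesis
      unfolding BV_def set_integrable_def by (simp add: total_variation_uminus)
  qed
  show "set_borel_measurable lebesgue (E \<times> {0<..<T}) (\<lambda>w. - z w)"
    using z_meas unfolding set_borel_measurable_def by simp
  show "AE w in lebesgue. w \<in> E \<times> {0<..<T} \<longrightarrow> norm (- z w) \<le> 1"
    using z_le by simp
  show "energy_ineq T E (\<lambda>w. - u w) (\<lambda>w. - z w)"
    unfolding energy_ineq_def
  proof (intro allI ballI impI)
    fix l :: real and p \<zeta> t1 t2
    assume p: "p \<in> classP" and \<zeta>: "\<zeta> \<in> classC T E" and t: "0 < t1 \<and> t1 \<le> t2 \<and> t2 < T"
      and i1: "set_integrable lebesgue (E \<times> {t1..t2}) (\<lambda>w. primitive p (- u w - l) * time_deriv \<zeta> w)"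
      and i2: "set_integrable lebesgue (E \<times> {t1..t2}) (\<lambda>w. (- z w \<bullet> space_grad \<zeta> w) * p (- u w - l))"
    define q where "q s = - p (- s)" for s
    have q: "q \<in> classP" unfolding q_def[abs_def] by (rule classP_reflect[OF p])
    have prim: "primitive q (u w - - l) = primitive p (- u w - l)" for w
      using primitive_reflect[of p "u w - - l"] by (simp add: q_def[abs_def])
    have qv: "(z w \<bullet> space_grad \<zeta> w) * q (u w - - l) = (- z w \<bullet> space_grad \<zeta> w) * p (- u w - l)" for w
      by (simp add: q_def)
    have tv: "tv_measure E (\<lambda>x. q (u (x, t) - - l)) = tv_measure E (\<lambda>x. p (- u (x, t) - l))" for t
      using tv_measure_uminus[of E "\<lambda>x. p (- u (x, t) - l)"] by (simp add: q_def)
    show "ereal (LINT x:E|lebesgue. primitive p (- u (x, t2) - l) * \<zeta> (x, t2))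
        + enn2ereal (\<integral>\<^sup>+t\<in>{t1..t2}.
            (\<integral>\<^sup>+x. ennreal (\<zeta> (x, t)) \<partial>tv_measure E (\<lambda>x. p (- u (x, t) - l))) \<partial>lebesgue)
        \<le> ereal ((LINT x:E|lebesgue. primitive p (- u (x, t1) - l) * \<zeta> (x, t1))
            + (LINT w:E \<times> {t1..t2}|lebesgue. primitive p (- u w - l) * time_deriv \<zeta> w)
            - (LINT w:E \<times> {t1..t2}|lebesgue. (- z w \<bullet> space_grad \<zeta> w) * p (- u w - l)))"
      using energy[unfolded energy_ineq_def, rule_format, OF q \<zeta> t, of "- l", unfolded prim qv tv, OF i1 i2] .
  qed
qed

lemma (in one_laplacian) total_variation_slice_eq:
  assumes U [measurable]: "U \<in> borel_measurable borel" and t: "t \<in> {0<..<T}"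
    and A: "open A" "A \<subseteq> E" and eq: "AE x in lborel. x \<in> A \<longrightarrow> u (x, t) = U (x, t)"
  shows "total_variation (\<lambda>x. u (x, t)) A = total_variation (\<lambda>x. U (x, t)) A"
  by (rule total_variation_borel_representative[OF u_int[OF t] _ A eq]) measurable

text \<open>Clipping a Borel version at the essential bound makes the bound hold at every point,
  hence on every time slice.\<close>

lemma (in one_laplacian) local_representative:
  assumes "cball c \<rho> \<subseteq> E" "0 < s1" "s2 < T"
  obtains U M where "U \<in> borel_measurable borel" "\<And>w. \<bar>U w\<bar> \<le> M" "0 \<le> M"
    "AE w in lborel. w \<in> ball c \<rho> \<times> {s1<..<s2} \<longrightarrow> u w = U w"
proof -
  let ?K = "cball c \<rho> \<times> {s1..s2}" and ?\<Omega> = "E \<times> {0<..<T}"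
  have "?K \<subseteq> ?\<Omega>" "compact ?K" using assms by (auto intro: compact_Times)
  then obtain M where M: "AE w in lebesgue. w \<in> ?K \<longrightarrow> \<bar>u w\<bar> \<le> M"
    using u_loc unfolding Linf_loc_def by blast
  have "(\<lambda>w. indicator ?\<Omega> w *\<^sub>R u w) \<in> borel_measurable lebesgue"
    using u_loc by (simp add: Linf_loc_def set_borel_measurable_def)
  then obtain g where g: "g \<in> borel_measurable lborel" "AE w in lborel. indicator ?\<Omega> w *\<^sub>R u w = g w"
    using completion_ex_borel_measurable_real by blast
  define U where "U w = max (- \<bar>M\<bar>) (min \<bar>M\<bar> (g w))" for w
  show thesis
  proof (rule that)
    show "U \<in> borel_measurable borel" using g(1) unfolding U_def by measurable
    show "\<bar>U w\<bar> \<le> \<bar>M\<bar>" for w by (auto simp: U_def)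
    show "AE w in lborel. w \<in> ball c \<rho> \<times> {s1<..<s2} \<longrightarrow> u w = U w"
      using g(2) M[unfolded AE_completion_iff]
    proof eventually_elim
      case (elim w)
      show ?case
      proof
        assume "w \<in> ball c \<rho> \<times> {s1<..<s2}"
        then have "w \<in> ?K" by (cases w) auto
        then have "u w = g w" "\<bar>u w\<bar> \<le> M" using elim \<open>?K \<subseteq> ?\<Omega>\<close> by (auto simp: indicator_def)
        then show "u w = U w" by (auto simp: U_def)
      qed
    qed
  qed simp
qed

section \<open>Oscillation estimates\<close>

lemma integral_bump_ge:
  fixes c :: "'a::euclidean_space"
  assumes r: "0 < r"
  shows "integrable lborel (bump c (r / 2) r)"
    and "unit_ball_vol (real DIM('a)) * (r / 2) ^ DIM('a) \<le> (LINT x|lborel. bump c (r / 2) r x)"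
proof -
  have r2: "0 \<le> r / 2" "r / 2 < r" using r by auto
  show bi: "integrable lborel (bump c (r / 2) r)"
    by (rule Ckc_integrable[OF bump_Ckc[OF r2 subset_UNIV]])
  have "unit_ball_vol (real DIM('a)) * (r / 2) ^ DIM('a) = (LINT x|lborel. indicator (ball c (r / 2)) x)"
    using r by (simp add: content_ball)
  also have "\<dots> \<le> (LINT x|lborel. bump c (r / 2) r x)"
  proof (rule integral_mono[OF _ bi])
    show "integrable lborel (indicator (ball c (r / 2)) :: 'a \<Rightarrow> real)"
      by (intro integrable_real_indicator) (auto simp: emeasure_lborel_ball_finite)
    show "indicator (ball c (r / 2)) x \<le> bump c (r / 2) r x" for x
      using bump_eq_1[OF r2, of x c] bump_bounds(1)[of c "r / 2" r x] by (auto simp: indicator_def)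
  qed
  finally show "unit_ball_vol (real DIM('a)) * (r / 2) ^ DIM('a) \<le> (LINT x|lborel. bump c (r / 2) r x)" .
qed

text \<open>Chebyshev's inequality applied to \<open>poincare_weighted_mean\<close>. The factor 4^N
  is (2 r)^N / (r / 2)^N, the ball of shifts against the ball where the weight is 1; the remaining 2
  r is the largest shift.\<close>

lemma (in one_laplacian) deviation_from_mean:
  assumes U [measurable]: "U \<in> borel_measurable borel" and UM: "\<And>w. \<bar>U w\<bar> \<le> M"
    and t: "t \<in> {0<..<T}" and r: "0 < r" "cball c (3 * r) \<subseteq> E" and \<delta>: "0 < \<delta>"
    and eq: "AE x in lborel. x \<in> ball c (3 * r) \<longrightarrow> u (x, t) = U (x, t)"
  defines "h \<equiv> (LINT x:E|lebesgue. u (x, t) * bump c (r / 2) r x) / (LINT x|lborel. bump c (r / 2) r x)"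
  shows "emeasure lborel {x\<in>ball c r. \<bar>U (x, t) - h\<bar> \<ge> \<delta>}
      \<le> ennreal (4 ^ DIM('a) * 2 * r / \<delta>) * total_variation (\<lambda>x. u (x, t)) (ball c (3 * r))"
    and "\<bar>h\<bar> \<le> M"
proof -
  let ?\<phi> = "bump c (r / 2) r" and ?N = "DIM('a)"
  define V where "V = unit_ball_vol (real ?N)"
  have V: "V > 0" by (simp add: V_def)
  have ball: "emeasure lborel (ball (y::'a) s) = ennreal (V * s ^ ?N)" if "s \<ge> 0" for s y
    using that by (simp add: emeasure_ball V_def)
  have r2: "0 \<le> r / 2" "r / 2 < r" using r by auto
  have m\<phi> [measurable]: "?\<phi> \<in> borel_measurable borel"
    by (intro borel_measurable_continuous_onI Ck_1_continuous Ck_1_bump)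
  have \<phi>0: "?\<phi> x = 0" if "x \<notin> ball c r" for x
    using bump_eq_0[OF r2(1,2) that] .
  define I where "I = (LINT x|lborel. ?\<phi> x)"
  have \<phi>i: "integrable lborel ?\<phi>" and "V * (r / 2) ^ ?N \<le> I"
    unfolding I_def V_def by (rule integral_bump_ge[OF r(1)])+
  moreover have "V * (r / 2) ^ ?N > 0" using V r by simp
  ultimately have I: "V * (r / 2) ^ ?N \<le> I" "I > 0" by auto
  have Ui: "integrable lborel (\<lambda>x. U (x, t) * ?\<phi> x)"
  proof (rule Bochner_Integration.integrable_bound)
    show "integrable lborel (\<lambda>x. M * ?\<phi> x)" using \<phi>i by simp
    show "AE x in lborel. norm (U (x, t) * ?\<phi> x) \<le> norm (M * ?\<phi> x)"
    proof (intro AE_I2)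
      fix x
      have "\<bar>U (x, t)\<bar> * ?\<phi> x \<le> \<bar>M\<bar> * ?\<phi> x"
        using UM[of "(x, t)"] by (intro mult_right_mono bump_bounds) auto
      then show "norm (U (x, t) * ?\<phi> x) \<le> norm (M * ?\<phi> x)" by (simp add: abs_mult abs_of_nonneg[OF bump_bounds(1)])
    qed
  qed measurable
  have hI: "h * I = (LINT x|lborel. U (x, t) * ?\<phi> x)"
  proof -
    have "(LINT x:E|lebesgue. u (x, t) * ?\<phi> x) = (LINT x|lebesgue. U (x, t) * ?\<phi> x)"
      unfolding set_lebesgue_integral_def
    proof (rule integral_cong_AE)
      have [measurable]: "(\<lambda>x. indicator E x *\<^sub>R u (x, t)) \<in> borel_measurable lebesgue"
        using u_int[OF t] by (auto simp: set_integrable_def)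
      have [measurable]: "?\<phi> \<in> borel_measurable lebesgue" by (intro measurable_completion) simp
      have "(\<lambda>x. (indicator E x *\<^sub>R u (x, t)) * ?\<phi> x) \<in> borel_measurable lebesgue" by measurable
      then show "(\<lambda>x. indicator E x *\<^sub>R (u (x, t) * ?\<phi> x)) \<in> borel_measurable lebesgue" by (simp add: mult.assoc)
      have "(\<lambda>x. U (x, t) * ?\<phi> x) \<in> borel_measurable borel" by measurable
      then show "(\<lambda>x. U (x, t) * ?\<phi> x) \<in> borel_measurable lebesgue" by (intro measurable_completion) simp
      show "AE x in lebesgue. indicator E x *\<^sub>R (u (x, t) * ?\<phi> x) = U (x, t) * ?\<phi> x"
        using AE_completion[OF eq]
      proof eventually_elim
        case (elim x)
        show ?case
        proof (cases "x \<in> ball c r")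
          case True
          then have "x \<in> ball c (3 * r)" "x \<in> E" using r by auto
          then show ?thesis using elim by simp
        qed (simp add: \<phi>0)
      qed
    qed
    also have "\<dots> = (LINT x|lborel. U (x, t) * ?\<phi> x)" by (rule integral_completion) measurable
    finally show ?thesis using I(2) by (simp add: h_def I_def)
  qed
  have "\<bar>h\<bar> * I \<le> M * I"
  proof -
    have "\<bar>h\<bar> * I = \<bar>LINT x|lborel. U (x, t) * ?\<phi> x\<bar>" using hI I(2) by (metis abs_mult abs_of_pos)
    also have "\<dots> \<le> (LINT x|lborel. \<bar>U (x, t) * ?\<phi> x\<bar>)" by (rule integral_abs_bound)
    also have "\<dots> \<le> (LINT x|lborel. M * ?\<phi> x)"
    proof (rule integral_mono)
      show "\<bar>U (x, t) * ?\<phi> x\<bar> \<le> M * ?\<phi> x" for x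
        unfolding abs_mult abs_of_nonneg[OF bump_bounds(1)] by (intro mult_right_mono UM bump_bounds)
    qed (use Ui \<phi>i in auto)
    finally show ?thesis by (simp add: I_def)
  qed
  then show "\<bar>h\<bar> \<le> M" using I(2) by simp
  let ?TV = "total_variation (\<lambda>x. u (x, t)) (ball c (3 * r))"
  let ?S = "{x\<in>ball c r. \<bar>U (x, t) - h\<bar> \<ge> \<delta>}"
  let ?D = "\<integral>\<^sup>+x\<in>ball c r. ennreal \<bar>U (x, t) - h\<bar> \<partial>lborel"
  have TVeq: "?TV = total_variation (\<lambda>x. U (x, t)) (ball c (3 * r))"
    by (rule total_variation_slice_eq[OF U t open_ball _ eq]) (use r ball_subset_cball in blast)
  have [measurable]: "ball c r \<in> sets borel" by simp
  have "ennreal I * ?D \<le> emeasure lborel (ball (0::'a) (2 * r)) * (ennreal (2 * r) * ?TV)"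
    unfolding TVeq
  proof (rule poincare_weighted_mean[where M = M and \<phi> = ?\<phi>])
    show "(\<lambda>x. U (x, t)) \<in> borel_measurable borel" by measurable
  qed (use UM bump_bounds \<phi>0 r I_def hI in auto)
  also have "emeasure lborel (ball (0::'a) (2 * r)) = ennreal (V * (2 * r) ^ ?N)" using r by (intro ball) simp
  finally have p: "ennreal I * ?D \<le> ennreal (V * (2 * r) ^ ?N) * (ennreal (2 * r) * ?TV)" .
  have "ennreal (V * (r / 2) ^ ?N * \<delta>) * emeasure lborel ?S
      = ennreal (V * (r / 2) ^ ?N) * (\<integral>\<^sup>+x. ennreal \<delta> * indicator ?S x \<partial>lborel)"
    using V r \<delta> by (subst nn_integral_cmult_indicator) (auto simp: ennreal_mult mult.assoc)
  also have "\<dots> \<le> ennreal I * ?D"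
  proof (rule mult_mono, goal_cases)
    case 2
    have "ennreal \<delta> * indicator ?S x \<le> ennreal \<bar>U (x, t) - h\<bar> * indicator (ball c r) x" for x
      by (cases "x \<in> ?S") (simp_all add: ennreal_leI)
    then show ?case by (rule nn_integral_mono)
  qed (use I in \<open>auto intro: ennreal_leI\<close>)
  also have "\<dots> \<le> ennreal (V * (2 * r) ^ ?N) * (ennreal (2 * r) * ?TV)" by (rule p)
  finally have p2: "ennreal (V * (r / 2) ^ ?N * \<delta>) * emeasure lborel ?S \<le> ennreal (V * (2 * r) ^ ?N) * (ennreal (2 * r) * ?TV)" .
  define q where "q = V * (r / 2) ^ ?N * \<delta>"
  have q: "q > 0" using V r \<delta> by (simp add: q_def)
  have "emeasure lborel ?S = ennreal (1 / q) * (ennreal q * emeasure lborel ?S)"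
    using q by (simp add: mult.assoc[symmetric] ennreal_mult[symmetric])
  also have "\<dots> \<le> ennreal (1 / q) * (ennreal (V * (2 * r) ^ ?N) * (ennreal (2 * r) * ?TV))"
    using p2 unfolding q_def by (intro mult_left_mono) auto
  also have "\<dots> = ennreal (1 / q * (V * (2 * r) ^ ?N) * (2 * r)) * ?TV"
  proof -
    have nn: "0 \<le> 1 / q" "0 \<le> V * (2 * r) ^ ?N" "0 \<le> 2 * r" using q V r by auto
    show ?thesis
      unfolding ennreal_mult[OF mult_nonneg_nonneg[OF nn(1,2)] nn(3)] ennreal_mult[OF nn(1,2)]
      by (simp only: mult.assoc)
  qed
  also have "1 / q * (V * (2 * r) ^ ?N) * (2 * r) = 4 ^ ?N * 2 * r / \<delta>"
  proof -
    define X where "X = (r / 2) ^ ?N"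
    have X: "X > 0" using r by (simp add: X_def)
    have eq: "(2 * r) ^ ?N = 4 ^ ?N * X"
      unfolding X_def power_mult_distrib[symmetric] by simp
    show ?thesis
      unfolding q_def eq X_def[symmetric] using V X \<delta> by (simp add: field_simps)
  qed
  finally show "emeasure lborel ?S \<le> ennreal (4 ^ ?N * 2 * r / \<delta>) * ?TV" .
qed

text \<open>The constants are fixed before the solution, the point and the radius. So they serve u
  and -u together, and r may be chosen afterwards, when the variation has become small
  enough.\<close>

lemma one_sided_bound:
  fixes M \<delta> :: real
  assumes M: "0 \<le> M" and \<delta>: "0 < \<delta>"
  obtains \<epsilon> \<epsilon>' \<eta> where "0 < \<epsilon>" "0 < \<epsilon>'" "0 < \<eta>"
    and "\<And>(E :: 'a::euclidean_space set) T u z x0 t0 U r.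
      \<lbrakk>one_laplacian E T u z; 0 < r; cball x0 (3 * r) \<subseteq> E; 0 < t0 - 3 * r; t0 + 3 * r < T;
       U \<in> borel_measurable borel; \<And>w. \<bar>U w\<bar> \<le> M;
       AE w in lborel. w \<in> ball x0 (3 * r) \<times> {t0 - 3 * r<..<t0 + 3 * r} \<longrightarrow> u w = U w;
       (\<integral>\<^sup>+t\<in>{t0 - 3 * r..t0}. total_variation (\<lambda>x. u (x, t)) (ball x0 (3 * r)) \<partial>lebesgue) \<le> ennreal (\<eta> * r ^ DIM('a))\<rbrakk>
      \<Longrightarrow> AE w in lborel. w \<in> ball x0 (r / 2) \<times> {t0 - \<epsilon> * r / 2<..<t0 + \<epsilon>' * r} \<longrightarrow>
        U w \<le> (LINT x:E|lebesgue. u (x, t0) * bump x0 (r / 2) r x) / (LINT x|lborel. bump x0 (r / 2) r x) + 3 * \<delta>"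
proof -
  define N where "N = DIM('a)"
  define V where "V = unit_ball_vol (real N)"
  have V: "V > 0" by (simp add: V_def)
  have ball: "emeasure lborel (ball (y::'a) s) = ennreal (V * s ^ N)" "measure lborel (ball (y::'a) s) = V * s ^ N"
    if "s \<ge> 0" for s y
    using that by (simp_all add: emeasure_ball content_ball V_def N_def)
  \<comment> \<open>Over a time \<epsilon> r the unnormalised means drift by at most 8 / (r - r / 2)
    * V r^N * \<epsilon> r. Dividing by the integral of the bump, at least V (r / 2)^N, leaves 16 *
    2^N * \<epsilon>.\<close>
  define \<epsilon> where "\<epsilon> = min 1 (\<delta> / (16 * 2 ^ N))"
  have \<epsilon>: "0 < \<epsilon>" "\<epsilon> \<le> 1" "16 * 2 ^ N * \<epsilon> \<le> \<delta>" using \<delta> by (auto simp: \<epsilon>_def min_def field_simps)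
  obtain \<nu> where \<nu>: "0 < \<nu>"
    and dg: "\<And>(c :: 'a) U \<rho> a b k.
      \<lbrakk>U \<in> borel_measurable borel; caccioppoli c \<rho> a b U; 0 < \<rho>; a + \<epsilon> * \<rho> \<le> b;
       AE w in lborel. w \<in> ball c \<rho> \<times> {a<..<b} \<longrightarrow> U w - k \<le> 2 * M;
       emeasure lborel {w \<in> ball c \<rho> \<times> {a<..<b}. U w > k} \<le> ennreal (\<nu> * \<rho> ^ Suc DIM('a))\<rbrakk>
      \<Longrightarrow> AE w in lborel. w \<in> ball c (\<rho> / 2) \<times> {a + \<epsilon> * \<rho> / 2<..<b} \<longrightarrow> U w \<le> k + \<delta>"
    using de_giorgi[OF \<epsilon>(1) \<delta>, of "2 * M"] M by auto
  \<comment> \<open>After t0 no smallness is known. That part of the cylinder is counted in full, V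
    \<epsilon>' r^(N + 1), and takes half of the threshold.\<close>
  define \<epsilon>' where "\<epsilon>' = min \<epsilon> (\<nu> / (2 * V))"
  have \<epsilon>'le: "0 < \<epsilon>'" "\<epsilon>' \<le> \<epsilon>" "\<epsilon>' \<le> \<nu> / (2 * V)"
    using \<epsilon>(1) \<nu> V by (simp_all add: \<epsilon>'_def)
  have \<epsilon>': "0 < \<epsilon>'" "\<epsilon>' \<le> 1" "V * \<epsilon>' \<le> \<nu> / 2" "\<epsilon>' \<le> \<epsilon>"
    using \<epsilon>'le \<epsilon>(2) mult_left_mono[OF \<epsilon>'le(3), of V] V by simp_all
  \<comment> \<open>The other half is for the past: \<open>deviation_from_mean\<close> integrated in
    time gives (4^N * 2 r / \<delta>) * \<eta> r^N.\<close>
  define \<eta> where "\<eta> = \<nu> * \<delta> / (4 * 4 ^ N)"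
  have \<eta>: "0 < \<eta>" using \<nu> \<delta> by (simp add: \<eta>_def)
  show thesis
  proof (rule that[OF \<epsilon>(1) \<epsilon>'(1) \<eta>])
    fix E :: "'a set" and T u z x0 t0 U r
    assume ol: "one_laplacian E T u z" and r: "0 < r" "cball x0 (3 * r) \<subseteq> E" "0 < t0 - 3 * r" "t0 + 3 * r < T"
      and U [measurable]: "U \<in> borel_measurable borel" and UM: "\<And>w. \<bar>U w\<bar> \<le> M"
      and uU: "AE w in lborel. w \<in> ball x0 (3 * r) \<times> {t0 - 3 * r<..<t0 + 3 * r} \<longrightarrow> u w = U w"
      and J: "(\<integral>\<^sup>+t\<in>{t0 - 3 * r..t0}. total_variation (\<lambda>x. u (x, t)) (ball x0 (3 * r)) \<partial>lebesgue) \<le> ennreal (\<eta> * r ^ DIM('a))"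
    interpret one_laplacian E T u z by (rule ol)
    let ?\<phi> = "bump x0 (r / 2) r"
    define I where "I = (LINT x|lborel. ?\<phi> x)"
    define h where "h t = (LINT x:E|lebesgue. u (x, t) * ?\<phi> x) / I" for t
    \<comment> \<open>One \<delta> covers the drift of the mean between t and t0, so at past times U
      > \<open>?k\<close> forces a deviation from h t of more than the other \<delta>. The iteration
      adds the third.\<close>
    let ?a = "t0 - \<epsilon> * r" and ?b = "t0 + \<epsilon>' * r" and ?k = "h t0 + 2 * \<delta>"
    have \<epsilon>r: "0 < \<epsilon> * r" "\<epsilon> * r \<le> r" "0 < \<epsilon>' * r" "\<epsilon>' * r \<le> r" "\<epsilon>' * r \<le> \<epsilon> * r"
      using \<epsilon> \<epsilon>' r(1) by (auto intro!: mult_right_mono)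
    have ab: "t0 - 3 * r \<le> ?a" "?b \<le> t0 + 3 * r" "0 < ?a" "?b < T"
      using \<epsilon>r r by linarith+
    have cr: "cball x0 r \<subseteq> E" using r by (auto simp: subset_eq)
    have sub: "ball x0 r \<subseteq> ball x0 (3 * r)" using r by (intro subset_ball) auto
    have slices: "AE t in lborel. AE x in lborel. (x, t) \<in> ball x0 (3 * r) \<times> {t0 - 3 * r<..<t0 + 3 * r} \<longrightarrow> u (x, t) = U (x, t)"
      by (rule AE_lborel_slices[OF uU])
    have I: "I \<ge> V * (r / 2) ^ N"
      unfolding I_def V_def N_def by (rule integral_bump_ge[OF r(1)])
    have Ipos: "I > 0" using I V r by (smt (verit) half_gt_zero mult_pos_pos zero_less_power)
    have hlip: "\<bar>h t - h t0\<bar> \<le> \<delta>" if t: "\<bar>t - t0\<bar> \<le> \<epsilon> * r" for t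
    proof -
      define m where "m t = (LINT x:E|lebesgue. u (x, t) * ?\<phi> x)" for t
      have T: "0 < t" "t < T" using t \<epsilon>r(2) r by linarith+
      have "\<bar>m t - m t0\<bar> \<le> 8 / (r - r / 2) * (V * r ^ N) * \<bar>t - t0\<bar>"
      proof (cases "t0 \<le> t")
        case True
        then show ?thesis
          using mean_lipschitz[of "r / 2" r x0 t0 t] r T \<epsilon>r cr ball(2)[of r x0] by (simp add: m_def)
      next
        case False
        then show ?thesis
          using mean_lipschitz[of "r / 2" r x0 t t0] r T \<epsilon>r cr ball(2)[of r x0] by (simp add: m_def abs_minus_commute)
      qed
      also have "\<dots> \<le> 8 / (r - r / 2) * (V * r ^ N) * (\<epsilon> * r)"
        using t V r by (intro mult_left_mono) auto
      also have "\<dots> = (16 * 2 ^ N * \<epsilon>) * (V * (r / 2) ^ N)"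
        using r by (simp add: power_divide field_simps)
      also have "\<dots> \<le> \<delta> * I"
        using \<epsilon> I V r \<delta> by (intro mult_mono) auto
      finally have "\<bar>(m t - m t0) / I\<bar> \<le> \<delta>" using Ipos by (simp add: abs_div field_simps)
      then show ?thesis by (simp add: h_def m_def diff_divide_distrib)
    qed
    have dev: "AE t in lborel. t \<in> {t0 - 3 * r<..<t0 + 3 * r} \<longrightarrow>
        emeasure lborel {x\<in>ball x0 r. \<bar>U (x, t) - h t\<bar> \<ge> \<delta>}
          \<le> ennreal (4 ^ DIM('a) * 2 * r / \<delta>) * total_variation (\<lambda>x. u (x, t)) (ball x0 (3 * r)) \<and> \<bar>h t\<bar> \<le> M"
      using slices
    proof eventually_elim
      case (elim t)
      show ?case
      proof
        assume t: "t \<in> {t0 - 3 * r<..<t0 + 3 * r}"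
        then have T: "t \<in> {0<..<T}" using r by auto
        have eq: "AE x in lborel. x \<in> ball x0 (3 * r) \<longrightarrow> u (x, t) = U (x, t)"
          using elim by eventually_elim (use t in auto)
        show "emeasure lborel {x\<in>ball x0 r. \<bar>U (x, t) - h t\<bar> \<ge> \<delta>}
          \<le> ennreal (4 ^ DIM('a) * 2 * r / \<delta>) * total_variation (\<lambda>x. u (x, t)) (ball x0 (3 * r)) \<and> \<bar>h t\<bar> \<le> M"
          unfolding h_def I_def using deviation_from_mean[OF U UM T r(1,2) \<delta> eq] by blast
      qed
    qed
    \<comment> \<open>\<open>dev\<close> holds for almost every time and may fail at t0. Nearby
      times and the Lipschitz bound replace it at the cost of \<delta>, which the 2 * \<delta> in
      \<open>?k\<close> absorbs when U - \<open>?k\<close> is bounded by 2 * M.\<close>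
    have h0: "\<bar>h t0\<bar> \<le> M + \<delta>"
    proof (rule ccontr)
      assume *: "\<not> \<bar>h t0\<bar> \<le> M + \<delta>"
      have "AE t in lborel. t \<notin> {?a<..<t0}"
        using dev
      proof eventually_elim
        case (elim t)
        show ?case
        proof
          assume t: "t \<in> {?a<..<t0}"
          then have "\<bar>h t\<bar> \<le> M" using elim \<epsilon>r r by auto
          moreover have "\<bar>h t - h t0\<bar> \<le> \<delta>" using t by (intro hlip) auto
          ultimately show False using * by linarith
        qed
      qed
      then have "emeasure lborel {?a<..<t0} = 0"
        by (auto dest!: emeasure_eq_0_AE simp only: space_lborel space_borel UNIV_I simp_thms Collect_mem_eq)
      then show False using \<epsilon>r by simp
    qed
    let ?A = "{w \<in> ball x0 r \<times> {?a<..<?b}. U w > ?k}"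
    have [measurable]: "ball x0 r \<times> {?a<..<?b} \<in> sets borel" by (intro borel_open open_Times) auto
    have [measurable]: "?A \<in> sets borel" by measurable
    define G where "G t = total_variation (\<lambda>x. u (x, t)) (ball x0 (3 * r)) * indicator {t0 - 3 * r..t0} t" for t
    have "emeasure lborel ?A = (\<integral>\<^sup>+t. emeasure lborel {x. (x, t) \<in> ?A} \<partial>lborel)"
      by (rule emeasure_lborel_slices) measurable
    also have "\<dots> = (\<integral>\<^sup>+t. emeasure lborel {x. (x, t) \<in> ?A} * indicator {..<t0} t + emeasure lborel {x. (x, t) \<in> ?A} * indicator {t0..} t \<partial>lborel)"
      by (intro nn_integral_cong) (auto simp: indicator_def)
    also have "\<dots> = (\<integral>\<^sup>+t\<in>{..<t0}. emeasure lborel {x. (x, t) \<in> ?A} \<partial>lborel) + (\<integral>\<^sup>+t\<in>{t0..}. emeasure lborel {x. (x, t) \<in> ?A} \<partial>lborel)"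
    proof (rule nn_integral_add)
      have "?A \<in> sets (lborel \<Otimes>\<^sub>M lborel)"
        by (simp only: sets_pair_measure_cong[OF sets_lborel sets_lborel] borel_prod) measurable
      from lborel_pair.measurable_emeasure_Pair2[OF this]
      have [measurable]: "(\<lambda>t. emeasure lborel {x. (x, t) \<in> ?A}) \<in> borel_measurable borel"
        by (simp add: vimage_def)
      show "(\<lambda>t. emeasure lborel {x. (x, t) \<in> ?A} * indicator {..<t0} t) \<in> borel_measurable lborel"
        "(\<lambda>t. emeasure lborel {x. (x, t) \<in> ?A} * indicator {t0..} t) \<in> borel_measurable lborel"
        by measurable
    qed
    finally have split: "emeasure lborel ?A = (\<integral>\<^sup>+t\<in>{..<t0}. emeasure lborel {x. (x, t) \<in> ?A} \<partial>lborel)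
        + (\<integral>\<^sup>+t\<in>{t0..}. emeasure lborel {x. (x, t) \<in> ?A} \<partial>lborel)" .
    have "(\<integral>\<^sup>+t\<in>{..<t0}. emeasure lborel {x. (x, t) \<in> ?A} \<partial>lborel) \<le> (\<integral>\<^sup>+t. ennreal (4 ^ N * 2 * r / \<delta>) * G t \<partial>lborel)"
    proof (rule nn_integral_mono_AE, use dev in eventually_elim)
      case (elim t)
      show ?case
      proof (cases "?a < t \<and> t < t0")
        case True
        then have "t0 - r < t" using \<epsilon>r(2) by linarith
        then have tt: "t \<in> {t0 - 3 * r<..<t0 + 3 * r}" "t \<in> {t0 - 3 * r..t0}" using True r(1) by auto
        have [measurable]: "ball x0 r \<in> sets borel" by simp
        have "\<bar>h t - h t0\<bar> \<le> \<delta>" using True by (intro hlip) auto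
        then have "{x. (x, t) \<in> ?A} \<subseteq> {x\<in>ball x0 r. \<bar>U (x, t) - h t\<bar> \<ge> \<delta>}" by auto
        then have "emeasure lborel {x. (x, t) \<in> ?A} \<le> emeasure lborel {x\<in>ball x0 r. \<bar>U (x, t) - h t\<bar> \<ge> \<delta>}"
          by (rule emeasure_mono) measurable
        also have "\<dots> \<le> ennreal (4 ^ N * 2 * r / \<delta>) * total_variation (\<lambda>x. u (x, t)) (ball x0 (3 * r))"
          using elim tt by (simp add: N_def)
        finally show ?thesis using True tt by (simp add: G_def)
      next
        case False
        then have "t \<notin> {..<t0} \<or> {x. (x, t) \<in> ?A} = {}" by auto
        then have "emeasure lborel {x. (x, t) \<in> ?A} * indicator {..<t0} t = 0"
        proof
          assume "{x. (x, t) \<in> ?A} = {}"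
          then show ?thesis by (simp only: emeasure_empty mult_zero_left)
        qed simp
        then show ?thesis by (simp only: zero_le)
      qed
    qed
    also have "(\<integral>\<^sup>+t. ennreal (4 ^ N * 2 * r / \<delta>) * G t \<partial>lborel) = ennreal (4 ^ N * 2 * r / \<delta>) * (\<integral>\<^sup>+t. G t \<partial>lborel)"
      using r \<delta> by (intro nn_integral_cmult_nonmeasurable) auto
    also have "\<dots> \<le> ennreal (4 ^ N * 2 * r / \<delta>) * ennreal (\<eta> * r ^ N)"
      using J unfolding G_def N_def nn_integral_completion by (intro mult_left_mono) auto
    finally have past: "(\<integral>\<^sup>+t\<in>{..<t0}. emeasure lborel {x. (x, t) \<in> ?A} \<partial>lborel)
        \<le> ennreal (4 ^ N * 2 * r / \<delta>) * ennreal (\<eta> * r ^ N)" .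
    have "(\<integral>\<^sup>+t\<in>{t0..}. emeasure lborel {x. (x, t) \<in> ?A} \<partial>lborel) \<le> (\<integral>\<^sup>+t. ennreal (V * r ^ N) * indicator {t0..?b} t \<partial>lborel)"
    proof (rule nn_integral_mono)
      fix t
      show "emeasure lborel {x. (x, t) \<in> ?A} * indicator {t0..} t \<le> ennreal (V * r ^ N) * indicator {t0..?b} t"
      proof (cases "t0 \<le> t \<and> t < ?b")
        case True
        have "emeasure lborel {x. (x, t) \<in> ?A} \<le> emeasure lborel (ball x0 r)"
          by (intro emeasure_mono) auto
        then show ?thesis using True ball(1)[of r x0] r by simp
      next
        case False
        then have "t \<notin> {t0..} \<or> {x. (x, t) \<in> ?A} = {}" by auto
        then have "emeasure lborel {x. (x, t) \<in> ?A} * indicator {t0..} t = 0"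
        proof
          assume "{x. (x, t) \<in> ?A} = {}"
          then show ?thesis by (simp only: emeasure_empty mult_zero_left)
        qed simp
        then show ?thesis by (simp only: zero_le)
      qed
    qed
    also have "(\<integral>\<^sup>+t. ennreal (V * r ^ N) * indicator {t0..?b} t \<partial>lborel) = ennreal (V * r ^ N) * ennreal (\<epsilon>' * r)"
      using \<epsilon>r by (subst nn_integral_cmult_indicator) auto
    finally have future: "(\<integral>\<^sup>+t\<in>{t0..}. emeasure lborel {x. (x, t) \<in> ?A} \<partial>lborel)
        \<le> ennreal (V * r ^ N) * ennreal (\<epsilon>' * r)" .
    have "emeasure lborel ?A \<le> ennreal (4 ^ N * 2 * r / \<delta>) * ennreal (\<eta> * r ^ N) + ennreal (V * r ^ N) * ennreal (\<epsilon>' * r)"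
      unfolding split by (rule add_mono[OF past future])
    also have "ennreal (4 ^ N * 2 * r / \<delta>) * ennreal (\<eta> * r ^ N) + ennreal (V * r ^ N) * ennreal (\<epsilon>' * r)
        = ennreal (4 ^ N * 2 * r / \<delta> * (\<eta> * r ^ N) + V * r ^ N * (\<epsilon>' * r))"
    proof -
      have "ennreal (4 ^ N * 2 * r / \<delta>) * ennreal (\<eta> * r ^ N) = ennreal (4 ^ N * 2 * r / \<delta> * (\<eta> * r ^ N))"
        using r \<delta> \<eta> by (intro ennreal_mult[symmetric]) auto
      moreover have "ennreal (V * r ^ N) * ennreal (\<epsilon>' * r) = ennreal (V * r ^ N * (\<epsilon>' * r))"
        using r V \<epsilon>r by (intro ennreal_mult[symmetric]) auto
      ultimately show ?thesis
        using r \<delta> \<eta> V \<epsilon>r by (subst ennreal_plus) (auto intro!: mult_nonneg_nonneg)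
    qed
    also have "\<dots> \<le> ennreal (\<nu> * r ^ Suc N)"
    proof (rule ennreal_leI)
      have "4 ^ N * 2 * r / \<delta> * (\<eta> * r ^ N) = \<nu> / 2 * r ^ Suc N"
        unfolding \<eta>_def using \<delta> by (simp add: field_simps)
      moreover have "V * r ^ N * (\<epsilon>' * r) \<le> \<nu> / 2 * r ^ Suc N"
        using mult_right_mono[OF \<epsilon>'(3), of "r ^ Suc N"] r by (simp add: mult_ac)
      moreover have "\<nu> / 2 * r ^ Suc N + \<nu> / 2 * r ^ Suc N = \<nu> * r ^ Suc N"
        unfolding distrib_right[symmetric] by simp
      ultimately show "4 ^ N * 2 * r / \<delta> * (\<eta> * r ^ N) + V * r ^ N * (\<epsilon>' * r) \<le> \<nu> * r ^ Suc N"
        by (metis add_left_mono)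
    qed
    finally have small: "emeasure lborel ?A \<le> ennreal (\<nu> * r ^ Suc N)" .
    have "AE w in lborel. w \<in> ball x0 (r / 2) \<times> {?a + \<epsilon> * r / 2<..<?b} \<longrightarrow> U w \<le> ?k + \<delta>"
    proof (rule dg[OF U _ r(1)])
      have "AE w in lborel. w \<in> ball x0 r \<times> {?a<..<?b} \<longrightarrow> u w = U w"
        using uU
      proof eventually_elim
        case (elim w)
        then show ?case using sub ab(1,2) by (cases w) auto
      qed
      then show "caccioppoli x0 r ?a ?b U"
        by (intro caccioppoli_representative U cr ab(3,4))
      show "?a + \<epsilon> * r \<le> ?b" using \<epsilon>r by simp
      show "AE w in lborel. w \<in> ball x0 r \<times> {?a<..<?b} \<longrightarrow> U w - ?k \<le> 2 * M"
      proof (intro AE_I2 impI)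
        fix w show "U w - ?k \<le> 2 * M" using UM[of w] h0 \<delta> by linarith
      qed
      show "emeasure lborel ?A \<le> ennreal (\<nu> * r ^ Suc DIM('a))" using small by (simp add: N_def)
    qed
    then show "AE w in lborel. w \<in> ball x0 (r / 2) \<times> {t0 - \<epsilon> * r / 2<..<t0 + \<epsilon>' * r} \<longrightarrow>
        U w \<le> (LINT x:E|lebesgue. u (x, t0) * ?\<phi> x) / (LINT x|lborel. ?\<phi> x) + 3 * \<delta>"
      by (simp add: h_def I_def add.assoc)
  qed
qed

section \<open>Essential oscillation and the scaled variation\<close>

lemma AE_lebesgue_on_iff:
  "S \<in> sets lebesgue \<Longrightarrow> (AE w in lebesgue_on S. P w) \<longleftrightarrow> (AE w in lebesgue. w \<in> S \<longrightarrow> P w)"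
  by (intro AE_restrict_space_iff) auto

text \<open>The two essential bounds stay extended reals: they are bounded above by M, but may be
  -infinity when S is null.\<close>

lemma ess_osc_obtain:
  assumes S: "S \<in> sets lebesgue" and u: "u \<in> borel_measurable (lebesgue_on S)"
    and M: "AE w in lebesgue. w \<in> S \<longrightarrow> \<bar>u w\<bar> \<le> M"
  obtains a b where "ess_osc u S = a - (- b)" "a \<le> ereal M" "b \<le> ereal M"
    "AE w in lebesgue. w \<in> S \<longrightarrow> ereal (u w) \<le> a \<and> ereal (- u w) \<le> b"
proof
  show "ess_osc u S = esssup (lebesgue_on S) (\<lambda>w. ereal (u w)) - (- esssup (lebesgue_on S) (\<lambda>w. ereal (- u w)))"
    by (rule ess_osc_def)
  show "esssup (lebesgue_on S) (\<lambda>w. ereal (u w)) \<le> ereal M"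
    "esssup (lebesgue_on S) (\<lambda>w. ereal (- u w)) \<le> ereal M"
    by (rule esssup_I; use u M in \<open>auto simp: AE_lebesgue_on_iff[OF S] elim: eventually_mono\<close>)+
  show "AE w in lebesgue. w \<in> S \<longrightarrow> ereal (u w) \<le> esssup (lebesgue_on S) (\<lambda>w. ereal (u w)) \<and>
      ereal (- u w) \<le> esssup (lebesgue_on S) (\<lambda>w. ereal (- u w))"
    unfolding AE_lebesgue_on_iff[OF S, symmetric] by (intro AE_conjI esssup_AE)
qed

text \<open>If one of the bounds is -infinity, almost no point lies in S and any l will do;
  otherwise l is the essential infimum.\<close>

lemma ess_osc_less_imp:
  assumes S: "S \<in> sets lebesgue" and u: "u \<in> borel_measurable (lebesgue_on S)"
    and M: "AE w in lebesgue. w \<in> S \<longrightarrow> \<bar>u w\<bar> \<le> M" and osc: "ess_osc u S < ereal d"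
  obtains l where "AE w in lebesgue. w \<in> S \<longrightarrow> l \<le> u w \<and> u w \<le> l + d"
proof -
  obtain a b where ab: "ess_osc u S = a - (- b)" "a \<le> ereal M" "b \<le> ereal M"
    "AE w in lebesgue. w \<in> S \<longrightarrow> ereal (u w) \<le> a \<and> ereal (- u w) \<le> b"
    using ess_osc_obtain[OF S u M] .
  then consider "a = - \<infinity> \<or> b = - \<infinity>" | a' b' where "a = ereal a'" "b = ereal b'"
    by (cases a; cases b) auto
  then show thesis
  proof cases
    case 1
    have "AE w in lebesgue. w \<in> S \<longrightarrow> 0 \<le> u w \<and> u w \<le> 0 + d"
      using ab(4) by eventually_elim (use 1 in auto)
    then show thesis by (rule that)
  next
    case 2
    have "AE w in lebesgue. w \<in> S \<longrightarrow> - b' \<le> u w \<and> u w \<le> - b' + d"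
      using ab(4) by eventually_elim (use 2 osc ab(1) in auto)
    then show thesis by (rule that)
  qed
qed

lemma ess_osc_le:
  assumes S: "S \<in> sets lebesgue" and u: "u \<in> borel_measurable (lebesgue_on S)"
    and c: "AE w in lebesgue. w \<in> S \<longrightarrow> \<bar>u w - c\<bar> \<le> e"
  shows "ess_osc u S \<le> ereal (2 * e)"
proof -
  note iff = AE_lebesgue_on_iff[OF S]
  have "AE w in lebesgue. w \<in> S \<longrightarrow> ereal (u w) \<le> ereal (c + e)"
    using c by eventually_elim (auto simp: abs_le_iff)
  then have "esssup (lebesgue_on S) (\<lambda>w. ereal (u w)) \<le> ereal (c + e)"
    using u by (intro esssup_I) (simp_all add: iff)
  moreover have "AE w in lebesgue. w \<in> S \<longrightarrow> ereal (- u w) \<le> ereal (- c + e)"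
    using c by eventually_elim (auto simp: abs_le_iff)
  then have "esssup (lebesgue_on S) (\<lambda>w. ereal (- u w)) \<le> ereal (- c + e)"
    using u by (intro esssup_I) (simp_all add: iff)
  then have "ereal (c - e) \<le> - esssup (lebesgue_on S) (\<lambda>w. ereal (- u w))"
    using ereal_minus_le_minus[THEN iffD2] by fastforce
  ultimately have "ess_osc u S \<le> ereal (c + e) - ereal (c - e)"
    unfolding ess_osc_def by (rule ereal_minus_mono)
  then show ?thesis by simp
qed

text \<open>Positive measure supplies a point at which both essential bounds hold, and there they
  add up to at least 0.\<close>

lemma ess_osc_nonneg:
  assumes S: "S \<in> sets lebesgue" "emeasure lebesgue S \<noteq> 0" and u: "u \<in> borel_measurable (lebesgue_on S)"
    and M: "AE w in lebesgue. w \<in> S \<longrightarrow> \<bar>u w\<bar> \<le> M"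
  shows "0 \<le> ess_osc u S"
proof -
  obtain a b where ab: "ess_osc u S = a - (- b)" "a \<le> ereal M" "b \<le> ereal M"
    "AE w in lebesgue. w \<in> S \<longrightarrow> ereal (u w) \<le> a \<and> ereal (- u w) \<le> b"
    using ess_osc_obtain[OF S(1) u M] .
  have "\<exists>w. ereal (u w) \<le> a \<and> ereal (- u w) \<le> b"
  proof (rule ccontr)
    assume *: "\<not> ?thesis"
    have "AE w in lebesgue. w \<notin> S"
      using ab(4) by eventually_elim (use * in blast)
    then have "emeasure lebesgue S = 0"
      using AE_iff_measurable[OF S(1), of "\<lambda>w. w \<notin> S"] sets.sets_into_space[OF S(1)] by auto
    then show False using S(2) by simp
  qed
  then show ?thesis
    unfolding ab(1) using ab(2,3) by (cases a; cases b) auto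
qed

lemma ball_Pair_subset: "ball (x0, t0) s \<subseteq> ball x0 s \<times> {t0 - s<..<t0 + s}"
  for t0 :: real
proof
  fix w assume "w \<in> ball (x0, t0) s"
  then have "dist (x0, t0) w < s" by simp
  then have "dist x0 (fst w) < s" "dist t0 (snd w) < s"
    using dist_fst_le[of "(x0, t0)" w] dist_snd_le[of "(x0, t0)" w] by auto
  then show "w \<in> ball x0 s \<times> {t0 - s<..<t0 + s}"
    by (cases w) (auto simp: dist_real_def)
qed

lemma Times_subset_ball_Pair: "ball x0 s \<times> {t0 - s<..<t0 + s} \<subseteq> ball (x0, t0) (2 * s)"
  for t0 :: real
proof
  fix w assume "w \<in> ball x0 s \<times> {t0 - s<..<t0 + s}"
  then obtain x t where w: "w = (x, t)" "dist x0 x < s" "\<bar>t0 - t\<bar> < s" by auto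
  have "dist (x0, t0) (x, t) \<le> dist x0 x + dist t0 t"
    unfolding dist_Pair_Pair by (rule sqrt_sum_squares_le_sum) auto
  then show "w \<in> ball (x0, t0) (2 * s)" using w by (simp add: dist_real_def)
qed

lemma measure_Qcyl:
  assumes "0 < \<rho>"
  shows "measure lebesgue (Qcyl \<rho> :: ('a::euclidean_space \<times> real) set) = unit_ball_vol (real DIM('a)) * \<rho> ^ DIM('a) * \<rho>"
proof -
  have "emeasure (lborel \<Otimes>\<^sub>M lborel) (ball (0::'a) \<rho> \<times> {-\<rho><..0}) = emeasure lborel (ball (0::'a) \<rho>) * emeasure lborel {-\<rho><..0}"
    by (rule lborel.emeasure_pair_measure_Times) auto
  then have "emeasure lborel (Qcyl \<rho> :: ('a \<times> real) set) = ennreal (unit_ball_vol (real DIM('a)) * \<rho> ^ DIM('a) * \<rho>)"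
    using assms by (simp add: lborel_prod Qcyl_def emeasure_ball ennreal_mult)
  moreover have "(Qcyl \<rho> :: ('a \<times> real) set) \<in> sets borel"
    unfolding Qcyl_def by (intro borel_Times) auto
  ultimately show ?thesis
    using assms by (simp add: measure_def)
qed

section \<open>The two implications, at a cylinder compactly inside the domain\<close>

context one_laplacian
begin

lemma measurable_lebesgue_on:
  assumes S: "S \<in> sets lebesgue" "S \<subseteq> E \<times> {0<..<T}"
  shows "u \<in> borel_measurable (lebesgue_on S)"
proof -
  have [measurable]: "(\<lambda>w. indicator (E \<times> {0<..<T}) w *\<^sub>R u w) \<in> borel_measurable lebesgue" "S \<in> sets lebesgue"
    using u_loc S by (simp_all add: Linf_loc_def set_borel_measurable_def)
  have "(\<lambda>w. indicator S w *\<^sub>R (indicator (E \<times> {0<..<T}) w *\<^sub>R u w)) \<in> borel_measurable lebesgue"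
    by measurable
  moreover have "(\<lambda>w. indicator S w *\<^sub>R (indicator (E \<times> {0<..<T}) w *\<^sub>R u w)) = (\<lambda>w. indicator S w *\<^sub>R u w)"
    using S(2) by (auto simp: fun_eq_iff indicator_def)
  ultimately show ?thesis
    using S(1) by (subst borel_measurable_restrict_space_iff) (simp_all only: Int_UNIV_right space_completion space_lborel space_borel)
qed

text \<open>A ramp as high as the oscillation truncates nothing: U = d * ramp d (U - l) + l near the
  point. So the variation of u is at most d times that of the ramp, and the latter is bounded by the
  Caccioppoli inequality in terms of the full measure of the cylinder.\<close>

lemma total_variation_small_of_ess_continuous:
  assumes \<rho>0: "0 < \<rho>0" "cball x0 \<rho>0 \<subseteq> E" "\<rho>0 < t0" "t0 + \<rho>0 < T"
    and cont: "ess_continuous_at u (x0, t0)" and e: "0 < e"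
  shows "\<forall>\<^sub>F \<rho> in at_right 0. ennreal (\<rho> / measure lebesgue (Qcyl \<rho> :: ('a \<times> real) set)) *
      (\<integral>\<^sup>+t\<in>{t0 - \<rho>..t0}. total_variation (\<lambda>x. u (x, t)) (ball x0 \<rho>) \<partial>lebesgue) \<le> ennreal e"
proof -
  define N where "N = DIM('a)"
  define V where "V = unit_ball_vol (real N)"
  have V: "V > 0" by (simp add: V_def)
  \<comment> \<open>The Caccioppoli factor is (4 d + 8) / \<rho> \<le> 12 / \<rho> because d \<le>
    1. The cylinder has radius 2 \<rho> and height 3 \<rho>, and division by V \<rho>^N leaves d *
    36 * 2^N.\<close>
  define d where "d = min 1 (e / (36 * 2 ^ N))"
  have d: "0 < d" "d \<le> 1" "d * (36 * 2 ^ N) \<le> e" using e by (auto simp: d_def min_def field_simps)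
  have s1: "0 < t0 - \<rho>0" using \<rho>0 by simp
  obtain U M where U [measurable]: "U \<in> borel_measurable borel" and UM: "\<And>w. \<bar>U w\<bar> \<le> M" "0 \<le> M"
    and uU: "AE w in lborel. w \<in> ball x0 \<rho>0 \<times> {t0 - \<rho>0<..<t0 + \<rho>0} \<longrightarrow> u w = U w"
    using local_representative[OF \<rho>0(2) s1 \<rho>0(4)] by blast
  have cac: "caccioppoli x0 \<rho>0 (t0 - \<rho>0) (t0 + \<rho>0) U"
    by (rule caccioppoli_representative[OF U s1 \<rho>0(4,2) uU])
  have "\<forall>\<^sub>F r in at_right 0. ess_osc u (ball (x0, t0) r) < ereal d"
    using cont d(1) unfolding ess_continuous_at_def by (intro order_tendstoD(2)) auto
  then obtain s0 where s0: "s0 > 0" "\<And>s. 0 < s \<Longrightarrow> s < s0 \<Longrightarrow> ess_osc u (ball (x0, t0) s) < ereal d"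
    unfolding eventually_at_right_field by auto
  have "ennreal (\<rho> / measure lebesgue (Qcyl \<rho> :: ('a \<times> real) set)) *
      (\<integral>\<^sup>+t\<in>{t0 - \<rho>..t0}. total_variation (\<lambda>x. u (x, t)) (ball x0 \<rho>) \<partial>lebesgue) \<le> ennreal e"
    if \<rho>: "0 < \<rho>" "\<rho> < min (s0 / 4) (\<rho>0 / 4)" for \<rho>
  proof -
    \<comment> \<open>Essential continuity speaks of balls in space-time; radius 4 \<rho> suffices
      to contain the product of radius 2 \<rho>.\<close>
    let ?S = "ball (x0, t0) (4 * \<rho>)" and ?B = "ball x0 (2 * \<rho>) \<times> {t0 - 2 * \<rho><..<t0 + 2 * \<rho>}"
    have sub1: "?B \<subseteq> ?S" using Times_subset_ball_Pair[of x0 "2 * \<rho>" t0] by simp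
    have sub2: "?S \<subseteq> ball x0 \<rho>0 \<times> {t0 - \<rho>0<..<t0 + \<rho>0}"
      using ball_Pair_subset[of x0 t0 "4 * \<rho>"] \<rho> by auto
    also have "\<dots> \<subseteq> E \<times> {0<..<T}" using \<rho>0 by auto
    finally have SO: "?S \<subseteq> E \<times> {0<..<T}" .
    have uU': "AE w in lebesgue. w \<in> ball x0 \<rho>0 \<times> {t0 - \<rho>0<..<t0 + \<rho>0} \<longrightarrow> u w = U w"
      by (rule AE_completion[OF uU])
    have "AE w in lebesgue. w \<in> ?S \<longrightarrow> \<bar>u w\<bar> \<le> M"
      using uU' by eventually_elim (use sub2 UM in force)
    moreover have "ess_osc u ?S < ereal d" using s0(2)[of "4 * \<rho>"] \<rho> by auto
    ultimately obtain l where l: "AE w in lebesgue. w \<in> ?S \<longrightarrow> l \<le> u w \<and> u w \<le> l + d"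
      using ess_osc_less_imp[OF _ measurable_lebesgue_on[OF _ SO]] by auto
    have Ul: "AE w in lborel. w \<in> ?B \<longrightarrow> u w = U w \<and> l \<le> U w \<and> U w \<le> l + d"
      using l[unfolded AE_completion_iff] uU by eventually_elim (use sub1 sub2 in auto)
    let ?K = "ennreal (4 * d / (t0 - \<rho> - (t0 - 2 * \<rho>)) + 8 / (2 * \<rho> - \<rho>)) *
        emeasure lborel {w \<in> ball x0 (2 * \<rho>) \<times> {t0 - 2 * \<rho><..<t0 + \<rho>}. U w > l}"
    have "AE w in lborel. w \<in> ball x0 (2 * \<rho>) \<times> {t0 - 2 * \<rho><..<t0 + \<rho>} \<longrightarrow> U w - l \<le> d"
      using Ul by eventually_elim (use \<rho> in auto)
    then have TVK: "(\<integral>\<^sup>+t\<in>{t0 - \<rho><..<t0 + \<rho>}. total_variation (\<lambda>x. ramp d (U (x, t) - l)) (ball x0 \<rho>) \<partial>lborel) \<le> ?K"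
      using cac[unfolded caccioppoli_def, rule_format, of d \<rho> "2 * \<rho>" "t0 - 2 * \<rho>" "t0 - \<rho>" "t0 + \<rho>" d l ?K] d \<rho> by simp
    have "emeasure lborel {w \<in> ball x0 (2 * \<rho>) \<times> {t0 - 2 * \<rho><..<t0 + \<rho>}. U w > l}
        \<le> emeasure lborel (ball x0 (2 * \<rho>) \<times> {t0 - 2 * \<rho><..<t0 + \<rho>})"
      by (intro emeasure_mono) (auto intro!: borel_open open_Times)
    also have "\<dots> = emeasure lborel (ball x0 (2 * \<rho>)) * emeasure lborel {t0 - 2 * \<rho><..<t0 + \<rho>}"
      unfolding lborel_prod[symmetric] by (rule lborel.emeasure_pair_measure_Times) auto
    also have "\<dots> = ennreal (V * (2 * \<rho>) ^ N * (3 * \<rho>))"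
    proof -
      have "emeasure lborel (ball x0 (2 * \<rho>)) = ennreal (V * (2 * \<rho>) ^ N)"
        using \<rho> by (simp add: emeasure_ball V_def N_def)
      moreover have "emeasure lborel {t0 - 2 * \<rho><..<t0 + \<rho>} = ennreal (3 * \<rho>)"
        using \<rho> by simp
      moreover have "0 \<le> V * (2 * \<rho>) ^ N" "0 \<le> 3 * \<rho>" using V \<rho> by auto
      ultimately show ?thesis by (simp only: ennreal_mult)
    qed
    finally have em: "emeasure lborel {w \<in> ball x0 (2 * \<rho>) \<times> {t0 - 2 * \<rho><..<t0 + \<rho>}. U w > l}
        \<le> ennreal (V * (2 * \<rho>) ^ N * (3 * \<rho>))" .
    have "4 * d / (t0 - \<rho> - (t0 - 2 * \<rho>)) + 8 / (2 * \<rho> - \<rho>) \<le> 12 / \<rho>"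
      using d \<rho> by (simp add: field_simps)
    then have "?K \<le> ennreal (12 / \<rho>) * ennreal (V * (2 * \<rho>) ^ N * (3 * \<rho>))"
      by (intro mult_mono ennreal_leI em) auto
    also have "\<dots> = ennreal (12 / \<rho> * (V * (2 * \<rho>) ^ N * (3 * \<rho>)))"
      using V \<rho> by (intro ennreal_mult[symmetric]) auto
    finally have K: "?K \<le> ennreal (12 / \<rho> * (V * (2 * \<rho>) ^ N * (3 * \<rho>)))" .
    have slices: "AE t in lborel. AE x in lborel. (x, t) \<in> ?B \<longrightarrow> u (x, t) = U (x, t) \<and> l \<le> U (x, t) \<and> U (x, t) \<le> l + d"
      by (rule AE_lborel_slices[OF Ul])
    have "(\<integral>\<^sup>+t\<in>{t0 - \<rho>..t0}. total_variation (\<lambda>x. u (x, t)) (ball x0 \<rho>) \<partial>lebesgue)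
        = (\<integral>\<^sup>+t\<in>{t0 - \<rho>..t0}. total_variation (\<lambda>x. u (x, t)) (ball x0 \<rho>) \<partial>lborel)"
      by (rule nn_integral_completion)
    also have "\<dots> \<le> (\<integral>\<^sup>+t. ennreal d * (total_variation (\<lambda>x. ramp d (U (x, t) - l)) (ball x0 \<rho>) * indicator {t0 - \<rho><..<t0 + \<rho>} t) \<partial>lborel)"
    \<comment> \<open>The closed interval of the claim has to fit into the open one of the
      Caccioppoli inequality: that one extends beyond t0, and the left endpoint is null.\<close>
    proof (rule nn_integral_mono_AE, use slices AE_lborel_singleton[of "t0 - \<rho>"] in eventually_elim)
      case (elim t)
      show ?case
      proof (cases "t \<in> {t0 - \<rho>..t0}")
        case True
        then have t: "t \<in> {t0 - \<rho><..<t0 + \<rho>}" "t \<in> {t0 - 2 * \<rho><..<t0 + 2 * \<rho>}" "t \<in> {0<..<T}"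
          using elim(2) \<rho> \<rho>0 by auto
        have br: "ball x0 \<rho> \<subseteq> E" using \<rho>0(1,2) \<rho> by (auto simp: subset_eq)
        have sl: "AE x in lborel. x \<in> ball x0 \<rho> \<longrightarrow> u (x, t) = U (x, t) \<and> l \<le> U (x, t) \<and> U (x, t) \<le> l + d"
          using elim(1) by eventually_elim (use t \<rho> in auto)
        have [measurable]: "ball x0 \<rho> \<in> sets borel" by simp
        have "total_variation (\<lambda>x. u (x, t)) (ball x0 \<rho>) = total_variation (\<lambda>x. U (x, t)) (ball x0 \<rho>)"
          by (rule total_variation_slice_eq[OF U t(3) open_ball br]) (use sl in \<open>auto elim: eventually_mono\<close>)
        also have "\<dots> = total_variation (\<lambda>x. d * ramp d (U (x, t) - l) + l) (ball x0 \<rho>)"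
        proof (rule total_variation_cong_AE)
          show "set_borel_measurable lebesgue (ball x0 \<rho>) (\<lambda>x. U (x, t))"
            "set_borel_measurable lebesgue (ball x0 \<rho>) (\<lambda>x. d * ramp d (U (x, t) - l) + l)"
            by (rule set_borel_measurable_lebesgue; measurable)+
          show "AE x in lborel. x \<in> ball x0 \<rho> \<longrightarrow> U (x, t) = d * ramp d (U (x, t) - l) + l"
            using sl
          proof eventually_elim
            case (elim x)
            show ?case
            proof
              assume "x \<in> ball x0 \<rho>"
              then have "0 \<le> U (x, t) - l" "U (x, t) - l \<le> d" using elim by auto
              then have "ramp d (U (x, t) - l) = (U (x, t) - l) / d" using d by (simp add: ramp_def)
              then show "U (x, t) = d * ramp d (U (x, t) - l) + l" using d by simp
            qed
          qed
        qed
        also have "\<dots> \<le> ennreal d * total_variation (\<lambda>x. ramp d (U (x, t) - l)) (ball x0 \<rho>)"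
        proof (rule total_variation_affine_le)
          show "set_integrable lebesgue (ball x0 \<rho>) (\<lambda>x. ramp d (U (x, t) - l))"
            unfolding set_integrable_def
            by (subst integrable_completion, measurable,
                intro integrableI_bounded_set_indicator[where B = 1])
              (use ramp_bounds in \<open>auto simp: emeasure_lborel_ball_finite\<close>)
          show "set_integrable lebesgue (ball x0 \<rho>) (\<lambda>x. 1 :: real)"
            unfolding set_integrable_def
            by (subst integrable_completion, measurable,
                intro integrableI_bounded_set_indicator[where B = 1])
              (auto simp: emeasure_lborel_ball_finite)
        qed (use d in simp)
        finally show ?thesis using t True by simp
      qed simp
    qed
    also have "\<dots> = ennreal d * (\<integral>\<^sup>+t\<in>{t0 - \<rho><..<t0 + \<rho>}. total_variation (\<lambda>x. ramp d (U (x, t) - l)) (ball x0 \<rho>) \<partial>lborel)"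
      by (rule nn_integral_cmult_nonmeasurable[OF d(1)])
    also have "\<dots> \<le> ennreal d * ennreal (12 / \<rho> * (V * (2 * \<rho>) ^ N * (3 * \<rho>)))"
      by (intro mult_left_mono order_trans[OF TVK K]) auto
    also have "\<dots> = ennreal (d * (12 / \<rho> * (V * (2 * \<rho>) ^ N * (3 * \<rho>))))"
      using V \<rho> d by (intro ennreal_mult[symmetric]) auto
    finally have J: "(\<integral>\<^sup>+t\<in>{t0 - \<rho>..t0}. total_variation (\<lambda>x. u (x, t)) (ball x0 \<rho>) \<partial>lebesgue)
        \<le> ennreal (d * (12 / \<rho> * (V * (2 * \<rho>) ^ N * (3 * \<rho>))))" .
    have q: "\<rho> / measure lebesgue (Qcyl \<rho> :: ('a \<times> real) set) = 1 / (V * \<rho> ^ N)"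
      unfolding measure_Qcyl[OF \<rho>(1)] using \<rho> by (simp add: V_def N_def)
    have "ennreal (\<rho> / measure lebesgue (Qcyl \<rho> :: ('a \<times> real) set)) *
        (\<integral>\<^sup>+t\<in>{t0 - \<rho>..t0}. total_variation (\<lambda>x. u (x, t)) (ball x0 \<rho>) \<partial>lebesgue)
        \<le> ennreal (1 / (V * \<rho> ^ N)) * ennreal (d * (12 / \<rho> * (V * (2 * \<rho>) ^ N * (3 * \<rho>))))"
      unfolding q by (intro mult_left_mono J) auto
    also have "\<dots> = ennreal (1 / (V * \<rho> ^ N) * (d * (12 / \<rho> * (V * (2 * \<rho>) ^ N * (3 * \<rho>)))))"
      using V \<rho> d by (intro ennreal_mult[symmetric]) auto
    also have "1 / (V * \<rho> ^ N) * (d * (12 / \<rho> * (V * (2 * \<rho>) ^ N * (3 * \<rho>)))) = d * (36 * 2 ^ N)"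
    proof -
      define X where "X = \<rho> ^ N"
      have X: "X > 0" using \<rho> by (simp add: X_def)
      show ?thesis
        unfolding power_mult_distrib X_def[symmetric] using V X \<rho> by (simp add: field_simps)
    qed
    also have "ennreal (d * (36 * 2 ^ N)) \<le> ennreal e" using d(3) by (rule ennreal_leI)
    finally show ?thesis .
  qed
  then show ?thesis
    unfolding eventually_at_right_field using s0(1) \<rho>0(1) by (intro exI[of _ "min (s0 / 4) (\<rho>0 / 4)"]) auto
qed

text \<open>The bounds for u and -u are centred at the same number c, because the weighted mean
  changes sign with u. One radius r per tolerance is enough: the bound on its cylinder passes to all
  smaller balls.\<close>

lemma ess_continuous_of_total_variation_small:
  assumes \<rho>0: "0 < \<rho>0" "cball x0 \<rho>0 \<subseteq> E" "\<rho>0 < t0" "t0 + \<rho>0 < T"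
    and lim: "\<And>q. 0 < q \<Longrightarrow> \<forall>\<^sub>F \<rho> in at_right 0. ennreal (\<rho> / measure lebesgue (Qcyl \<rho> :: ('a \<times> real) set)) *
      (\<integral>\<^sup>+t\<in>{t0 - \<rho>..t0}. total_variation (\<lambda>x. u (x, t)) (ball x0 \<rho>) \<partial>lebesgue) \<le> ennreal q"
  shows "ess_continuous_at u (x0, t0)"
proof -
  define N where "N = DIM('a)"
  define V where "V = unit_ball_vol (real N)"
  have V: "V > 0" by (simp add: V_def)
  have s1: "0 < t0 - \<rho>0" using \<rho>0 by simp
  let ?\<Omega> = "ball x0 \<rho>0 \<times> {t0 - \<rho>0<..<t0 + \<rho>0}"
  obtain U M where U [measurable]: "U \<in> borel_measurable borel" and UM: "\<And>w. \<bar>U w\<bar> \<le> M" "0 \<le> M"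
    and uU: "AE w in lborel. w \<in> ?\<Omega> \<longrightarrow> u w = U w"
    using local_representative[OF \<rho>0(2) s1 \<rho>0(4)] by blast
  have \<Omega>E: "?\<Omega> \<subseteq> E \<times> {0<..<T}" using \<rho>0 by auto
  have ballO: "ball (x0, t0) s \<subseteq> ?\<Omega>" if "s \<le> \<rho>0" for s
    using ball_Pair_subset[of x0 t0 s] that by auto
  have meas: "u \<in> borel_measurable (lebesgue_on (ball (x0, t0) s))" if "s \<le> \<rho>0" for s
    using ballO[OF that] \<Omega>E by (intro measurable_lebesgue_on) auto
  have nonneg: "0 \<le> ess_osc u (ball (x0, t0) s)" if s: "0 < s" "s \<le> \<rho>0" for s
  proof (rule ess_osc_nonneg)
    show "emeasure lebesgue (ball (x0, t0) s) \<noteq> 0"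
      using emeasure_lborel_ball_pos[OF s(1), of "(x0, t0)"] by simp
    show "AE w in lebesgue. w \<in> ball (x0, t0) s \<longrightarrow> \<bar>u w\<bar> \<le> M"
      using AE_completion[OF uU] by eventually_elim (use ballO[OF s(2)] UM in force)
  qed (use meas s in auto)
  show ?thesis
    unfolding ess_continuous_at_def
  proof (rule order_tendstoI)
    fix y :: ereal assume "y < 0"
    then show "\<forall>\<^sub>F s in at_right 0. y < ess_osc u (ball (x0, t0) s)"
      unfolding eventually_at_right_field using nonneg \<rho>0(1)
      by (intro exI[of _ \<rho>0]) (auto intro: less_le_trans)
  next
    fix y :: ereal assume "0 < y"
    then obtain e where e: "0 < ereal e" "ereal e < y" using ereal_dense2 by blast
    \<comment> \<open>|u - c| \<le> 3 * \<delta> gives oscillation at most 6 * \<delta>.\<close>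
    define \<delta> where "\<delta> = e / 6"
    have \<delta>: "0 < \<delta>" using e by (simp add: \<delta>_def)
    show "\<forall>\<^sub>F s in at_right 0. ess_osc u (ball (x0, t0) s) < y"
    proof (rule one_sided_bound[where 'a = 'a, OF UM(2) \<delta>])
      fix \<epsilon> \<epsilon>' \<eta> :: real
      assume pos: "0 < \<epsilon>" "0 < \<epsilon>'" "0 < \<eta>"
        and osb: "\<And>(E :: 'a set) T u z x0 t0 U r.
          \<lbrakk>one_laplacian E T u z; 0 < r; cball x0 (3 * r) \<subseteq> E; 0 < t0 - 3 * r; t0 + 3 * r < T;
           U \<in> borel_measurable borel; \<And>w. \<bar>U w\<bar> \<le> M;
           AE w in lborel. w \<in> ball x0 (3 * r) \<times> {t0 - 3 * r<..<t0 + 3 * r} \<longrightarrow> u w = U w;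
           (\<integral>\<^sup>+t\<in>{t0 - 3 * r..t0}. total_variation (\<lambda>x. u (x, t)) (ball x0 (3 * r)) \<partial>lebesgue) \<le> ennreal (\<eta> * r ^ DIM('a))\<rbrakk>
          \<Longrightarrow> AE w in lborel. w \<in> ball x0 (r / 2) \<times> {t0 - \<epsilon> * r / 2<..<t0 + \<epsilon>' * r} \<longrightarrow>
            U w \<le> (LINT x:E|lebesgue. u (x, t0) * bump x0 (r / 2) r x) / (LINT x|lborel. bump x0 (r / 2) r x) + 3 * \<delta>"
      \<comment> \<open>Chosen so that V (3 r)^N q = \<eta> r^N: the assumption at radius 3 r then
        reads as the variation bound of \<open>one_sided_bound\<close>.\<close>
      define q where "q = \<eta> / (V * 3 ^ N)"
      have q: "q > 0" using pos V by (simp add: q_def)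
      obtain b where b: "b > 0" "\<And>\<rho>. 0 < \<rho> \<Longrightarrow> \<rho> < b \<Longrightarrow> ennreal (\<rho> / measure lebesgue (Qcyl \<rho> :: ('a \<times> real) set)) *
        (\<integral>\<^sup>+t\<in>{t0 - \<rho>..t0}. total_variation (\<lambda>x. u (x, t)) (ball x0 \<rho>) \<partial>lebesgue) \<le> ennreal q"
        using lim[OF q] unfolding eventually_at_right_field by auto
      define r where "r = min b \<rho>0 / 6"
      have r: "0 < r" "3 * r < b" "3 * r < \<rho>0" using b(1) \<rho>0(1) by (auto simp: r_def min_def)
      let ?J = "\<integral>\<^sup>+t\<in>{t0 - 3 * r..t0}. total_variation (\<lambda>x. u (x, t)) (ball x0 (3 * r)) \<partial>lebesgue"
      have J: "?J \<le> ennreal (\<eta> * r ^ N)"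
      proof -
        define W where "W = V * (3 * r) ^ N"
        have W: "W > 0" using V r by (simp add: W_def)
        have "3 * r / measure lebesgue (Qcyl (3 * r) :: ('a \<times> real) set) = 1 / W"
          using r by (subst measure_Qcyl) (simp_all add: W_def V_def N_def)
        then have "ennreal (1 / W) * ?J \<le> ennreal q" using b(2)[of "3 * r"] r by simp
        then have "ennreal W * (ennreal (1 / W) * ?J) \<le> ennreal W * ennreal q" by (intro mult_left_mono) auto
        also have "ennreal W * (ennreal (1 / W) * ?J) = ?J"
          using W by (simp add: mult.assoc[symmetric] ennreal_mult[symmetric])
        also have "ennreal W * ennreal q = ennreal (W * q)" using W q by (intro ennreal_mult[symmetric]) auto
        also have "W * q = \<eta> * r ^ N"
          unfolding W_def q_def power_mult_distrib using V by simp
        finally show ?thesis .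
      qed
      have cr: "cball x0 (3 * r) \<subseteq> E" using \<rho>0(2) r(3) by (auto simp: subset_eq)
      have tr: "0 < t0 - 3 * r" "t0 + 3 * r < T" using \<rho>0 r by auto
      have uUr: "AE w in lborel. w \<in> ball x0 (3 * r) \<times> {t0 - 3 * r<..<t0 + 3 * r} \<longrightarrow> u w = U w"
        using uU by eventually_elim (use r in auto)
      define c where "c = (LINT x:E|lebesgue. u (x, t0) * bump x0 (r / 2) r x) / (LINT x|lborel. bump x0 (r / 2) r x)"
      have up: "AE w in lborel. w \<in> ball x0 (r / 2) \<times> {t0 - \<epsilon> * r / 2<..<t0 + \<epsilon>' * r} \<longrightarrow> U w \<le> c + 3 * \<delta>"
        unfolding c_def using J unfolding N_def
        by (intro osb[OF one_laplacian_axioms r(1) cr tr U UM(1) uUr])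
      have "AE w in lborel. w \<in> ball x0 (r / 2) \<times> {t0 - \<epsilon> * r / 2<..<t0 + \<epsilon>' * r} \<longrightarrow>
          - U w \<le> (LINT x:E|lebesgue. - u (x, t0) * bump x0 (r / 2) r x) / (LINT x|lborel. bump x0 (r / 2) r x) + 3 * \<delta>"
      proof (rule osb[OF one_laplacian_uminus r(1) cr tr])
        show "(\<lambda>w. - U w) \<in> borel_measurable borel" by measurable
        show "\<bar>- U w\<bar> \<le> M" for w using UM(1)[of w] by simp
        show "AE w in lborel. w \<in> ball x0 (3 * r) \<times> {t0 - 3 * r<..<t0 + 3 * r} \<longrightarrow> - u w = - U w"
          using uUr by simp
        show "(\<integral>\<^sup>+t\<in>{t0 - 3 * r..t0}. total_variation (\<lambda>x. - u (x, t)) (ball x0 (3 * r)) \<partial>lebesgue) \<le> ennreal (\<eta> * r ^ DIM('a))"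
          using J unfolding total_variation_uminus N_def .
      qed
      then have low: "AE w in lborel. w \<in> ball x0 (r / 2) \<times> {t0 - \<epsilon> * r / 2<..<t0 + \<epsilon>' * r} \<longrightarrow> - U w \<le> - c + 3 * \<delta>"
        by (simp add: c_def set_lebesgue_integral_def)
      define s0 where "s0 = min (r / 2) (min (\<epsilon> * r / 2) (\<epsilon>' * r))"
      have s0: "0 < s0" "s0 \<le> r / 2" "s0 \<le> \<epsilon> * r / 2" "s0 \<le> \<epsilon>' * r" using r pos by (auto simp: s0_def)
      have "ess_osc u (ball (x0, t0) s) < y" if s: "0 < s" "s < s0" for s
      proof -
        have s\<rho>: "s \<le> \<rho>0" using s s0 r by linarith
        have bs: "ball (x0, t0) s \<subseteq> ball x0 (r / 2) \<times> {t0 - \<epsilon> * r / 2<..<t0 + \<epsilon>' * r}"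
          using ball_Pair_subset[of x0 t0 s] s s0 by auto
        have "AE w in lborel. w \<in> ball (x0, t0) s \<longrightarrow> \<bar>u w - c\<bar> \<le> 3 * \<delta>"
          using up low uU
        proof eventually_elim
          case (elim w)
          show ?case
          proof
            assume "w \<in> ball (x0, t0) s"
            then have "U w \<le> c + 3 * \<delta>" "- U w \<le> - c + 3 * \<delta>" "u w = U w"
              using elim bs ballO[OF s\<rho>] by blast+
            then show "\<bar>u w - c\<bar> \<le> 3 * \<delta>" by auto
          qed
        qed
        then have "AE w in lebesgue. w \<in> ball (x0, t0) s \<longrightarrow> \<bar>u w - c\<bar> \<le> 3 * \<delta>"
          by (rule AE_completion)
        then have "ess_osc u (ball (x0, t0) s) \<le> ereal (2 * (3 * \<delta>))"
          by (intro ess_osc_le meas[OF s\<rho>]) auto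
        also have "\<dots> < y" using e by (simp add: \<delta>_def)
        finally show ?thesis .
      qed
      then show "\<forall>\<^sub>F s in at_right 0. ess_osc u (ball (x0, t0) s) < y"
        unfolding eventually_at_right_field using s0(1) by blast
    qed
  qed
qed

end

section \<open>Reduction of local solutions to the locale, and conclusion\<close>

lemma one_laplacian_of_local_solution:
  assumes "open E" "u \<in> Linf_loc (E \<times> {0<..<T})" "local_solution T E u"
  obtains z where "one_laplacian E T u z"
proof -
  obtain z where z: "set_borel_measurable lebesgue (E \<times> {0<..<T}) z"
      "AE w in lebesgue. w \<in> E \<times> {0<..<T} \<longrightarrow> norm (z w) \<le> 1" "energy_ineq T E u z"
    and u: "u \<in> Cloc_L1 T E" and BV: "\<And>p. p \<in> classP \<Longrightarrow> (\<lambda>w. p (u w)) \<in> L1loc_BV T E"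
    using assms(3) unfolding local_solution_def by blast
  have "one_laplacian E T u z"
  proof
    show "set_integrable lebesgue E (\<lambda>x. u (x, t))" if "t \<in> {0<..<T}" for t
      using u that unfolding Cloc_L1_def by blast
    show "(\<lambda>x. p (u (x, t))) \<in> BV E" if "p \<in> classP" "t \<in> {0<..<T}" for p t
    proof -
      \<comment> \<open>\<open>L1_BV\<close> asserts bounded variation at every time of the closed
        interval, so any compact interval around t yields it at t itself and not just at almost
        every time.\<close>
      have "0 < t / 2 \<and> t / 2 < (t + T) / 2 \<and> (t + T) / 2 < T" using that(2) by auto
      then have "(\<lambda>w. p (u w)) \<in> L1_BV (t / 2) ((t + T) / 2) E"
        using BV[OF that(1)] unfolding L1loc_BV_def by blast
      moreover have "t \<in> {t / 2..(t + T) / 2}" using that(2) by auto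
      ultimately show ?thesis unfolding L1_BV_def by blast
    qed
  qed (use assms z in auto)
  then show thesis by (rule that)
qed

theorem corollary4p1:
  fixes E :: "'a::euclidean_space set" and T :: real
    and u :: "'a \<times> real \<Rightarrow> real" and x0 :: 'a and t0 :: real
  assumes "open E" and "T > 0"
    and "u \<in> Linf_loc (E \<times> {0<..<T})"
    and "local_solution T E u"
    and "(x0, t0) \<in> E \<times> {0<..<T}"
  shows "ess_continuous_at u (x0, t0) \<longleftrightarrow>
    Limsup (at_right 0) (\<lambda>\<rho>::real.
      ennreal (\<rho> / measure lebesgue (Qcyl \<rho> :: ('a \<times> real) set)) *
      (\<integral>\<^sup>+t\<in>{t0 - \<rho>..t0}. total_variation (\<lambda>x. u (x, t)) (ball x0 \<rho>) \<partial>lebesgue)) = 0"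
    (is "_ \<longleftrightarrow> Limsup _ ?F = 0")
proof -
  obtain z where "one_laplacian E T u z"
    using one_laplacian_of_local_solution[OF assms(1,3,4)] .
  then interpret one_laplacian E T u z .
  have x0: "x0 \<in> E" and t0: "0 < t0" "t0 < T" using assms(5) by auto
  obtain r where r: "r > 0" "cball x0 r \<subseteq> E"
    using assms(1) x0 open_contains_cball by blast
  \<comment> \<open>The halves keep the closed cylinder strictly inside the time interval.\<close>
  define \<rho>0 where "\<rho>0 = min r (min (t0 / 2) ((T - t0) / 2))"
  have le: "\<rho>0 \<le> r" "\<rho>0 \<le> t0 / 2" "\<rho>0 \<le> (T - t0) / 2"
    unfolding \<rho>0_def
    by (rule min.cobounded1 order_trans[OF min.cobounded2 min.cobounded1] order_trans[OF min.cobounded2 min.cobounded2])+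
  have \<rho>0: "0 < \<rho>0" "cball x0 \<rho>0 \<subseteq> E" "\<rho>0 < t0" "t0 + \<rho>0 < T"
  proof -
    show "0 < \<rho>0" using r t0 by (simp add: \<rho>0_def)
    show "cball x0 \<rho>0 \<subseteq> E" using r(2) subset_cball[OF le(1), of x0] by blast
    show "\<rho>0 < t0" using le(2) t0(1) by linarith
    have "2 * \<rho>0 \<le> T - t0" using le(3) by simp
    then show "t0 + \<rho>0 < T" using t0(2) by linarith
  qed
  show ?thesis
  proof
    assume "ess_continuous_at u (x0, t0)"
    then have "Limsup (at_right 0) ?F \<le> 0 + ennreal e" if "0 < e" for e
      using total_variation_small_of_ess_continuous[OF \<rho>0 _ that] by (simp add: Limsup_bounded)
    then have "Limsup (at_right 0) ?F \<le> 0" by (rule ennreal_le_epsilon)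
    then show "Limsup (at_right 0) ?F = 0" by simp
  next
    assume lim: "Limsup (at_right 0) ?F = 0"
    show "ess_continuous_at u (x0, t0)"
    proof (rule ess_continuous_of_total_variation_small[OF \<rho>0])
      fix q :: real assume "0 < q"
      then have "Limsup (at_right 0) ?F < ennreal q" using lim by simp
      then show "\<forall>\<^sub>F \<rho> in at_right 0. ?F \<rho> \<le> ennreal q"
        by (rule eventually_mono[OF Limsup_lessD]) simp
    qed
  qed
qed

end
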